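(* Let $\Omega\subset\mathbb R^3$ be an unbounded domain with smooth boundary, and let $\Sigma$ be a connected, complete, noncompact, orientable, immersed free boundary minimal surface in $\Omega$ with nonempty compact boundary $\partial\Sigma\subset\partial\Omega$. If $\Sigma$ has finite Morse index and is not totally geodesic, then $$\dim_{\mathbb R}\bigl(\mathcal L^\star(\Sigma)\cap L^2\mathcal H^1_T(\Sigma)\bigr)\le1.$$
   Context: Free boundary: $\Sigma$ is immersed in $\overline\Omega$ (position map $X=(x_1,x_2,x_3)$) and meets $\partial\Omega$ exactly along $\partial\Sigma$, orthogonally; $\nu$ is the outward unit conormal of $\partial\Sigma$ in $\Sigma$. Let $\eta$ be the outward unit normal of $\partial\Omega$, $\mathrm{II}_{\partial\Omega}(Y,Z)=\langle D_Y\eta,Z\rangle$, $N$ a unit normal of $\Sigma$, $A(Y)=D_YN$. The Morse index is the supremum of the dimensions of subspaces of $C_c^\infty(\Sigma)$ (functions not required to vanish on $\partial\Sigma$) on which $\mathcal Q(\phi,\phi)=\int_\Sigma(|\nabla\phi|^2-|A|^2\phi^2)\,d\mu-\int_{\partial\Sigma}\mathrm{II}_{\partial\Omega}(N,N)\phi^2\,d\sigma$ is negative definite. $L^2\mathcal H^1_T(\Sigma)$ is the space of tangent vector fields $\xi$ on $\Sigma$, smooth up to $\partial\Sigma$, such that $\xi^\flat$ is closed and coclosed, $\langle\xi,\nu\rangle=0$ along $\partial\Sigma$, and $\int_\Sigma|\xi|^2\,d\mu<\infty$. $\mathcal L^\star(\Sigma)=\operatorname{span}\{\star\nabla x_1,\star\nabla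 x_2,\star\nabla x_3\}$, where $\star$ is the rotation by $+\pi/2$ in the tangent planes of $\Sigma$ (Hodge star). *)

theory Defs
  imports "HOL-Analysis.Analysis" "HOL-Library.Function_Algebras"
begin

(* Pointwise real vector space structure on functions, so that subspace, span and dim apply to
   spaces of functions and of vector fields. *)

instantiation "fun" :: (type, scaleR) scaleR
begin
definition scaleR_fun :: "real \<Rightarrow> ('a \<Rightarrow> 'b) \<Rightarrow> 'a \<Rightarrow> 'b"
  where "scaleR_fun r f = (\<lambda>x. r *\<^sub>R f x)"
instance ..
end

instance "fun" :: (type, real_vector) real_vector
  by standard (auto simp: scaleR_fun_def scaleR_add_right scaleR_add_left fun_eq_iff)


section \<open>Smooth maps\<close>

(* Meaningful for open S. *)
fun Ck_on :: "nat \<Rightarrow> ('a::euclidean_space \<Rightarrow> 'b::real_normed_vector) \<Rightarrow> 'a set \<Rightarrow> bool"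
where
  "Ck_on 0 f S \<longleftrightarrow> continuous_on S f"
| "Ck_on (Suc k) f S \<longleftrightarrow>
     (\<forall>x\<in>S. f differentiable at x) \<and> (\<forall>v. Ck_on k (\<lambda>x. frechet_derivative f (at x) v) S)"

(* S need not be open: f is required to extend smoothly to a neighbourhood of each point. *)
definition smooth_map_on :: "'a::euclidean_space set \<Rightarrow> ('a \<Rightarrow> 'b::real_normed_vector) \<Rightarrow> bool" where
  "smooth_map_on S f \<longleftrightarrow>
     (\<forall>x\<in>S. \<exists>W g. open W \<and> x \<in> W \<and> (\<forall>k. Ck_on k g W) \<and> (\<forall>y\<in>S \<inter> W. g y = f y))"


section \<open>Surfaces with boundary\<close>

(* The surface is the type 'a itself (Hausdorff, second countable), with its smooth structure given
   by an atlas. A chart is a pair of a coordinate domain U and a coordinate map, which is a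
   homeomorphism of U onto a relatively open subset of the closed upper half plane. *)

type_synonym 'a chart = "'a set \<times> ('a \<Rightarrow> real \<times> real)"

definition half_plane :: "(real \<times> real) set" where
  "half_plane = {x. 0 \<le> snd x}"

definition chart_image :: "'a chart \<Rightarrow> (real \<times> real) set" where
  "chart_image c = snd c ` fst c"

definition local_rep :: "'a chart \<Rightarrow> ('a \<Rightarrow> 'b) \<Rightarrow> real \<times> real \<Rightarrow> 'b" where
  "local_rep c f = f \<circ> inv_into (fst c) (snd c)"

definition is_chart :: "'a::topological_space chart \<Rightarrow> bool" where
  "is_chart c \<longleftrightarrow> open (fst c) \<and> openin (top_of_set half_plane) (chart_image c) \<and>
     homeomorphism (fst c) (chart_image c) (snd c) (inv_into (fst c) (snd c))"

(* Partial derivatives in half-plane coordinates, one-sided at the edge. *)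
definition partial_u :: "(real \<times> real \<Rightarrow> 'b::real_normed_vector) \<Rightarrow> real \<times> real \<Rightarrow> 'b" where
  "partial_u f x = frechet_derivative f (at x within half_plane) (1, 0)"

definition partial_v :: "(real \<times> real \<Rightarrow> 'b::real_normed_vector) \<Rightarrow> real \<times> real \<Rightarrow> 'b" where
  "partial_v f x = frechet_derivative f (at x within half_plane) (0, 1)"

definition smooth_atlas :: "'a::topological_space chart set \<Rightarrow> bool" where
  "smooth_atlas A \<longleftrightarrow> (\<forall>c\<in>A. is_chart c) \<and> (\<Union>c\<in>A. fst c) = UNIV \<and>
     (\<forall>c\<in>A. \<forall>d\<in>A. smooth_map_on (snd c ` (fst c \<inter> fst d)) (local_rep c (snd d)))"

(* All transition maps have positive Jacobian determinant. *)
definition oriented_atlas :: "'a chart set \<Rightarrow> bool" where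
  "oriented_atlas A \<longleftrightarrow>
     (\<forall>c\<in>A. \<forall>d\<in>A. \<forall>x \<in> snd c ` (fst c \<inter> fst d).
        let a = partial_u (local_rep c (snd d)) x; b = partial_v (local_rep c (snd d)) x
        in fst a * snd b - snd a * fst b > 0)"

definition bdry :: "'a chart set \<Rightarrow> 'a set" where
  "bdry A = {p. \<exists>c\<in>A. p \<in> fst c \<and> snd (snd c p) = 0}"

definition smooth_fun :: "'a chart set \<Rightarrow> ('a \<Rightarrow> 'b::real_normed_vector) \<Rightarrow> bool" where
  "smooth_fun A f \<longleftrightarrow> (\<forall>c\<in>A. smooth_map_on (chart_image c) (local_rep c f))"

(* A chosen chart around p. For oriented A, the only definition below that depends on the choice,
   beyond coord_diff itself, is the orthonormal frame (frame1, frame2), and even that does not at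
   boundary points. *)
definition chart_at :: "'a chart set \<Rightarrow> 'a \<Rightarrow> 'a chart" where
  "chart_at A p = (SOME c. c \<in> A \<and> p \<in> fst c)"

definition coord_diff ::
  "'a chart set \<Rightarrow> ('a \<Rightarrow> 'b::real_normed_vector) \<Rightarrow> 'a \<Rightarrow> real \<times> real \<Rightarrow> 'b" where
  "coord_diff A f p = (let c = chart_at A p in
     frechet_derivative (local_rep c f) (at (snd c p) within half_plane))"

definition immersion :: "'a chart set \<Rightarrow> ('a \<Rightarrow> real^3) \<Rightarrow> bool" where
  "immersion A X \<longleftrightarrow> smooth_fun A X \<and> (\<forall>p. inj (coord_diff A X p))"


section \<open>Geometry of an immersed oriented surface\<close>

(* Tangent vectors of the surface at p are identified, via the differential of the immersion X,
   with vectors in its image in R^3; the metric is the induced one. *)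

definition tangent_plane :: "'a chart set \<Rightarrow> ('a \<Rightarrow> real^3) \<Rightarrow> 'a \<Rightarrow> (real^3) set" where
  "tangent_plane A X p = range (coord_diff A X p)"

(* Derivative of f at p in the direction of the tangent vector Y; only for Y in the tangent plane. *)
definition dir_deriv ::
  "'a chart set \<Rightarrow> ('a \<Rightarrow> real^3) \<Rightarrow> ('a \<Rightarrow> 'b::real_normed_vector) \<Rightarrow> 'a \<Rightarrow> real^3 \<Rightarrow> 'b" where
  "dir_deriv A X f p Y = coord_diff A f p (inv (coord_diff A X p) Y)"

definition unit_normal :: "'a chart set \<Rightarrow> ('a \<Rightarrow> real^3) \<Rightarrow> 'a \<Rightarrow> real^3" where
  "unit_normal A X p = sgn (cross3 (coord_diff A X p (1, 0)) (coord_diff A X p (0, 1)))"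

(* Rotation by +pi/2 in the oriented tangent planes. *)
definition star :: "'a chart set \<Rightarrow> ('a \<Rightarrow> real^3) \<Rightarrow> ('a \<Rightarrow> real^3) \<Rightarrow> 'a \<Rightarrow> real^3" where
  "star A X \<xi> p = cross3 (unit_normal A X p) (\<xi> p)"

(* A positively oriented orthonormal basis of the tangent plane at p. *)
definition frame1 :: "'a chart set \<Rightarrow> ('a \<Rightarrow> real^3) \<Rightarrow> 'a \<Rightarrow> real^3" where
  "frame1 A X p = sgn (coord_diff A X p (1, 0))"

definition frame2 :: "'a chart set \<Rightarrow> ('a \<Rightarrow> real^3) \<Rightarrow> 'a \<Rightarrow> real^3" where
  "frame2 A X = star A X (frame1 A X)"

definition gradient :: "'a chart set \<Rightarrow> ('a \<Rightarrow> real^3) \<Rightarrow> ('a \<Rightarrow> real) \<Rightarrow> 'a \<Rightarrow> real^3" where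
  "gradient A X \<phi> p = dir_deriv A X \<phi> p (frame1 A X p) *\<^sub>R frame1 A X p
                    + dir_deriv A X \<phi> p (frame2 A X p) *\<^sub>R frame2 A X p"

definition shape_op :: "'a chart set \<Rightarrow> ('a \<Rightarrow> real^3) \<Rightarrow> 'a \<Rightarrow> real^3 \<Rightarrow> real^3" where
  "shape_op A X p Y = dir_deriv A X (unit_normal A X) p Y"

definition shape_trace :: "'a chart set \<Rightarrow> ('a \<Rightarrow> real^3) \<Rightarrow> 'a \<Rightarrow> real" where
  "shape_trace A X p = shape_op A X p (frame1 A X p) \<bullet> frame1 A X p
                     + shape_op A X p (frame2 A X p) \<bullet> frame2 A X p"

definition shape_norm_sq :: "'a chart set \<Rightarrow> ('a \<Rightarrow> real^3) \<Rightarrow> 'a \<Rightarrow> real" where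
  "shape_norm_sq A X p = (norm (shape_op A X p (frame1 A X p)))\<^sup>2
                       + (norm (shape_op A X p (frame2 A X p)))\<^sup>2"

definition minimal :: "'a chart set \<Rightarrow> ('a \<Rightarrow> real^3) \<Rightarrow> bool" where
  "minimal A X \<longleftrightarrow> (\<forall>p. shape_trace A X p = 0)"

definition totally_geodesic :: "'a chart set \<Rightarrow> ('a \<Rightarrow> real^3) \<Rightarrow> bool" where
  "totally_geodesic A X \<longleftrightarrow> (\<forall>p. \<forall>Y\<in>tangent_plane A X p. shape_op A X p Y = 0)"

(* Outward unit conormal at a boundary point. There frame1 is tangent to the boundary and
   frame2 has positive inner product with the image of the inward coordinate vector (0,1). *)
definition conormal :: "'a chart set \<Rightarrow> ('a \<Rightarrow> real^3) \<Rightarrow> 'a \<Rightarrow> real^3" where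
  "conormal A X p = - frame2 A X p"

(* The norm of the cross product is the square root of the determinant of the metric. *)
definition area_density :: "('a \<Rightarrow> real^3) \<Rightarrow> 'a chart \<Rightarrow> real \<times> real \<Rightarrow> real" where
  "area_density X c x = norm (cross3 (partial_u (local_rep c X) x) (partial_v (local_rep c X) x))"

definition area_measure :: "'a::topological_space chart set \<Rightarrow> ('a \<Rightarrow> real^3) \<Rightarrow> 'a measure" where
  "area_measure A X = (THE \<mu>. sets \<mu> = sets borel \<and>
     (\<forall>c\<in>A. \<forall>B\<in>sets borel. B \<subseteq> fst c \<longrightarrow>
        emeasure \<mu> B = (\<integral>\<^sup>+x\<in>snd c ` B. ennreal (area_density X c x) \<partial>lborel)))"

(* Arc length of the boundary curve, as a measure on the whole surface concentrated on bdry A. *)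
definition bdry_measure :: "'a::topological_space chart set \<Rightarrow> ('a \<Rightarrow> real^3) \<Rightarrow> 'a measure" where
  "bdry_measure A X = (THE \<sigma>. sets \<sigma> = sets borel \<and>
     (\<forall>c\<in>A. \<forall>B\<in>sets borel. B \<subseteq> fst c \<longrightarrow>
        emeasure \<sigma> B =
          (\<integral>\<^sup>+t\<in>{t. (t, 0) \<in> snd c ` B}. ennreal (norm (partial_u (local_rep c X) (t, 0))) \<partial>lborel)))"

(* Since X is an immersion, a continuous curve g in the surface is piecewise C^1 if and only if
   X o g is, and the two curves have the same length. Integrability is required because valid_path
   allows the derivative to be unbounded near the finitely many exceptional points, while integral
   is 0 for functions that are not integrable. *)
definition curve_lengths :: "('a::topological_space \<Rightarrow> real^3) \<Rightarrow> 'a \<Rightarrow> 'a \<Rightarrow> real set" where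
  "curve_lengths X p q =
     {integral {0..1} (\<lambda>t. norm (vector_derivative (X \<circ> g) (at t))) |g.
        path g \<and> pathstart g = p \<and> pathfinish g = q \<and> valid_path (X \<circ> g) \<and>
        (\<lambda>t. norm (vector_derivative (X \<circ> g) (at t))) integrable_on {0..1}}"

definition intrinsic_dist :: "('a::topological_space \<Rightarrow> real^3) \<Rightarrow> 'a \<Rightarrow> 'a \<Rightarrow> real" where
  "intrinsic_dist X p q = Inf (curve_lengths X p q)"

definition complete_surface :: "('a::topological_space \<Rightarrow> real^3) \<Rightarrow> bool" where
  "complete_surface X \<longleftrightarrow> Metric_space.mcomplete UNIV (intrinsic_dist X)"


section \<open>Domains with smooth boundary\<close>

definition local_defining_function ::
  "(real^3) set \<Rightarrow> (real^3) set \<Rightarrow> (real^3 \<Rightarrow> real) \<Rightarrow> bool" where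
  "local_defining_function \<Omega> W f \<longleftrightarrow> open W \<and> smooth_map_on W f \<and>
     \<Omega> \<inter> W = {x\<in>W. f x < 0} \<and> frontier \<Omega> \<inter> W = {x\<in>W. f x = 0} \<and>
     (\<forall>x\<in>W. \<not> (GDERIV f x :> 0))"

definition smooth_domain :: "(real^3) set \<Rightarrow> bool" where
  "smooth_domain \<Omega> \<longleftrightarrow> open \<Omega> \<and> connected \<Omega> \<and>
     (\<forall>x\<in>frontier \<Omega>. \<exists>W f. x \<in> W \<and> local_defining_function \<Omega> W f)"

definition outward_normal :: "(real^3) set \<Rightarrow> real^3 \<Rightarrow> real^3" where
  "outward_normal \<Omega> x = (THE n. \<exists>W f g. x \<in> W \<and> local_defining_function \<Omega> W f \<and>
     (GDERIV f x :> g) \<and> n = sgn g)"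

(* For x in the frontier and Y, Z tangent to it. The derivative of the normal within the frontier
   is uniquely determined on tangent vectors Y (only on these). *)
definition second_fund_form :: "(real^3) set \<Rightarrow> real^3 \<Rightarrow> real^3 \<Rightarrow> real^3 \<Rightarrow> real" where
  "second_fund_form \<Omega> x Y Z =
     frechet_derivative (outward_normal \<Omega>) (at x within frontier \<Omega>) Y \<bullet> Z"


section \<open>Free boundary minimal surfaces and the Morse index\<close>

definition free_boundary ::
  "(real^3) set \<Rightarrow> 'a chart set \<Rightarrow> ('a \<Rightarrow> real^3) \<Rightarrow> bool" where
  "free_boundary \<Omega> A X \<longleftrightarrow> range X \<subseteq> closure \<Omega> \<and> X -` frontier \<Omega> = bdry A \<and>
     (\<forall>p\<in>bdry A. outward_normal \<Omega> (X p) \<in> tangent_plane A X p)"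

definition smooth_compact_support :: "'a::topological_space chart set \<Rightarrow> ('a \<Rightarrow> real) set" where
  "smooth_compact_support A = {\<phi>. smooth_fun A \<phi> \<and> compact (closure {p. \<phi> p \<noteq> 0})}"

definition stability_form ::
  "(real^3) set \<Rightarrow> 'a::topological_space chart set \<Rightarrow> ('a \<Rightarrow> real^3) \<Rightarrow> ('a \<Rightarrow> real) \<Rightarrow> real" where
  "stability_form \<Omega> A X \<phi> =
     (\<integral>p. (norm (gradient A X \<phi> p))\<^sup>2 - shape_norm_sq A X p * (\<phi> p)\<^sup>2 \<partial>area_measure A X)
   - (\<integral>p\<in>bdry A. second_fund_form \<Omega> (X p) (unit_normal A X p) (unit_normal A X p) * (\<phi> p)\<^sup>2
        \<partial>bdry_measure A X)"

(* Only finite-dimensional subspaces V = span B need to be considered: an infinite-dimensional one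
   contains subspaces of every finite dimension. *)
definition morse_index ::
  "(real^3) set \<Rightarrow> 'a::topological_space chart set \<Rightarrow> ('a \<Rightarrow> real^3) \<Rightarrow> enat" where
  "morse_index \<Omega> A X = Sup {enat (dim V) |V.
     subspace V \<and> (\<exists>B. finite B \<and> V = span B) \<and> V \<subseteq> smooth_compact_support A \<and>
     (\<forall>\<phi>\<in>V. \<phi> \<noteq> 0 \<longrightarrow> stability_form \<Omega> A X \<phi> < 0)}"


section \<open>Tangential harmonic fields\<close>

(* The 1-form dual to \<xi> is closed: its components in coordinates (u,v) are the inner products
   of \<xi> with the partial derivatives of X. *)
definition flat_closed ::
  "'a chart set \<Rightarrow> ('a \<Rightarrow> real^3) \<Rightarrow> ('a \<Rightarrow> real^3) \<Rightarrow> bool" where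
  "flat_closed A X \<xi> \<longleftrightarrow> (\<forall>c\<in>A. \<forall>x\<in>chart_image c.
     partial_u (\<lambda>y. local_rep c \<xi> y \<bullet> partial_v (local_rep c X) y) x
   = partial_v (\<lambda>y. local_rep c \<xi> y \<bullet> partial_u (local_rep c X) y) x)"

(* The codifferential of a 1-form w is, up to sign, *d*w, and the Hodge star of the form dual
   to \<xi> is the form dual to star \<xi>. *)
definition flat_coclosed ::
  "'a chart set \<Rightarrow> ('a \<Rightarrow> real^3) \<Rightarrow> ('a \<Rightarrow> real^3) \<Rightarrow> bool" where
  "flat_coclosed A X \<xi> \<longleftrightarrow> flat_closed A X (star A X \<xi>)"

definition L2_harmonic_tangential ::
  "'a::topological_space chart set \<Rightarrow> ('a \<Rightarrow> real^3) \<Rightarrow> ('a \<Rightarrow> real^3) set" where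
  "L2_harmonic_tangential A X = {\<xi>. smooth_fun A \<xi> \<and> (\<forall>p. \<xi> p \<in> tangent_plane A X p) \<and>
     flat_closed A X \<xi> \<and> flat_coclosed A X \<xi> \<and> (\<forall>p\<in>bdry A. \<xi> p \<bullet> conormal A X p = 0) \<and>
     (\<integral>\<^sup>+p. ennreal ((norm (\<xi> p))\<^sup>2) \<partial>area_measure A X) < \<infinity>}"

definition L_star :: "'a chart set \<Rightarrow> ('a \<Rightarrow> real^3) \<Rightarrow> ('a \<Rightarrow> real^3) set" where
  "L_star A X = span (range (\<lambda>i::3. star A X (gradient A X (\<lambda>p. X p $ i))))"

end

theory Submission
  imports Defs "HOL-Real_Asymp.Real_Asymp"
begin

text \<open>
  The elements of \<open>L_star\<close> are the fields \<open>N \<times> v\<close> with \<open>v\<close> in \<open>\<real>\<^sup>3\<close>, and \<open>\<bar>N \<times> v\<bar>\<^sup>2 + \<bar>N \<times> w\<bar>\<^sup>2\<close> is bounded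
  below by a positive constant when \<open>v\<close> and \<open>w\<close> are independent, because a unit vector is never parallel
  to both. Two independent square integrable elements would therefore force the area to be finite.
  A complete noncompact minimal surface with compact boundary has infinite area, however: by the Hopf-Rinow
  argument closed intrinsic balls are compact, so some ball of any given radius \<open>R\<close> misses the boundary,
  and testing the first variation identity \<open>div (X - X p) = 2\<close> (tangential divergence) against cutoffs of the
  distance from \<open>p\<close> shows that the area of such a ball is at least a constant times \<open>R\<^sup>2\<close>.
\<close>

section \<open>Continuously differentiable maps of the half plane\<close>

text \<open>The distance from \<open>p\<close> is only Lipschitz, so the first variation identity
  cannot be tested against its cutoffs by ordinary integration by parts. The work is divided: the
  field is C1, the cutoff stays Lipschitz, and moving points along the field by a small
  \<open>t\<close> gives an inequality that asks only for an upper bound on the slope of the cutoff.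
  That bound is 1/\<delta> times the length of the tangential part of \<open>X - X p\<close>,
  charged only on the shell where the cutoff varies. Curves of the surface cause a similar
  difficulty: only their composition with \<open>X\<close> is known to be piecewise C1, so lengths
  are bounded below by chords in space and above by explicit coordinate segments. The passage from
  the shell estimate to growth like R^2 uses no differential inequality for the area of balls. A
  discrete growth step is multiplied up over an equal subdivision of the interval from \<epsilon> to
  \<open>R\<close>, and then the mesh tends to 0. Finiteness of the area is assumed until
  \<open>infinite_area\<close> contradicts it, so that areas of balls are real numbers
  throughout.\<close>

definition C1_on :: "(real \<times> real) set \<Rightarrow> (real \<times> real \<Rightarrow> 'b::real_normed_vector)
    \<Rightarrow> (real \<times> real \<Rightarrow> 'b) \<Rightarrow> (real \<times> real \<Rightarrow> 'b) \<Rightarrow> bool" where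
  "C1_on S f fu fv \<longleftrightarrow> continuous_on S fu \<and> continuous_on S fv \<and>
     (\<forall>x\<in>S. (f has_derivative (\<lambda>h. fst h *\<^sub>R fu x + snd h *\<^sub>R fv x)) (at x within S))"

lemma C1_onD:
  assumes "C1_on S f fu fv"
  shows "continuous_on S fu" "continuous_on S fv"
    "\<And>x. x \<in> S \<Longrightarrow> (f has_derivative (\<lambda>h. fst h *\<^sub>R fu x + snd h *\<^sub>R fv x)) (at x within S)"
  using assms by (auto simp: C1_on_def)

lemma C1_onI:
  assumes "continuous_on S fu" "continuous_on S fv"
    "\<And>x. x \<in> S \<Longrightarrow> (f has_derivative (\<lambda>h. fst h *\<^sub>R fu x + snd h *\<^sub>R fv x)) (at x within S)"
  shows "C1_on S f fu fv"
  using assms by (auto simp: C1_on_def)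

lemma C1_on_subset:
  assumes "C1_on S f fu fv" "T \<subseteq> S"
  shows "C1_on T f fu fv"
proof (rule C1_onI)
  show "continuous_on T fu" "continuous_on T fv"
    using C1_onD(1,2)[OF assms(1)] assms(2) continuous_on_subset by blast+
  show "(f has_derivative (\<lambda>h. fst h *\<^sub>R fu x + snd h *\<^sub>R fv x)) (at x within T)" if "x \<in> T" for x
    by (rule has_derivative_subset[OF C1_onD(3)[OF assms(1)] assms(2)]) (use that assms(2) in auto)
qed

lemma C1_on_continuous:
  assumes "C1_on S f fu fv"
  shows "continuous_on S f"
  using assms unfolding C1_on_def continuous_on_eq_continuous_within
  using has_derivative_continuous by blast

lemma C1_on_cong:
  assumes "C1_on S f fu fv" "\<And>x. x \<in> S \<Longrightarrow> g x = f x" "\<And>x. x \<in> S \<Longrightarrow> gu x = fu x"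
    "\<And>x. x \<in> S \<Longrightarrow> gv x = fv x"
  shows "C1_on S g gu gv"
proof (rule C1_onI)
  show "continuous_on S gu" "continuous_on S gv"
    using C1_onD(1,2)[OF assms(1)] continuous_on_cong[of S S gu fu] continuous_on_cong[of S S gv fv] assms(3,4) by blast+
  fix x assume x: "x \<in> S"
  have "(f has_derivative (\<lambda>h. fst h *\<^sub>R gu x + snd h *\<^sub>R gv x)) (at x within S)"
    using C1_onD(3)[OF assms(1) x] x assms by simp
  then show "(g has_derivative (\<lambda>h. fst h *\<^sub>R gu x + snd h *\<^sub>R gv x)) (at x within S)"
    by (rule has_derivative_transform[OF x, rotated]) (use assms in auto)
qed

text \<open>A relatively open subset contains a full relative neighbourhood of each of its points.
  This identifies derivatives within a chart image with derivatives within
  \<open>half_plane\<close>, from which \<open>partial_u\<close> and \<open>coord_diff\<close> are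
  built.\<close>

lemma at_within_openin:
  assumes "openin (top_of_set H) S" "x \<in> S"
  shows "at x within S = at x within H"
proof -
  obtain U where U: "open U" "S = H \<inter> U" using assms openin_open by blast
  show ?thesis
    by (rule at_within_nhd[of x U]) (use U assms in auto)
qed

text \<open>Continuity and the derivative at a point see only the filter
  \<open>at x within S\<close>, which does not change when \<open>S\<close> is cut down to a
  relatively open piece around \<open>x\<close>. This glues pieces on which a smooth extension or an
  extension by zero is known.\<close>

lemma C1_on_local:
  assumes "\<And>x. x \<in> S \<Longrightarrow> \<exists>T. openin (top_of_set S) T \<and> x \<in> T \<and> C1_on T f fu fv"
  shows "C1_on S f fu fv"
proof -
  have at_eq: "at x within S = at x within T" if "openin (top_of_set S) T" "x \<in> T" for x T
    by (rule at_within_openin[OF that, symmetric])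
  have c: "continuous_on S g"
    if "\<And>x. x \<in> S \<Longrightarrow> \<exists>T. openin (top_of_set S) T \<and> x \<in> T \<and> continuous_on T g" for g :: "real \<times> real \<Rightarrow> 'a"
    unfolding continuous_on_eq_continuous_within
  proof
    fix x assume "x \<in> S"
    from that[OF this] obtain T where T: "openin (top_of_set S) T" "x \<in> T" "continuous_on T g" by blast
    then have "continuous (at x within T) g" using continuous_on_eq_continuous_within by blast
    then show "continuous (at x within S) g" unfolding at_eq[OF T(1,2)] .
  qed
  show ?thesis
  proof (rule C1_onI)
    show "continuous_on S fu"
    proof (rule c)
      fix x assume "x \<in> S"
      from assms[OF this] show "\<exists>T. openin (top_of_set S) T \<and> x \<in> T \<and> continuous_on T fu"
        using C1_onD(1) by blast
    qed
    show "continuous_on S fv"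
    proof (rule c)
      fix x assume "x \<in> S"
      from assms[OF this] show "\<exists>T. openin (top_of_set S) T \<and> x \<in> T \<and> continuous_on T fv"
        using C1_onD(2) by blast
    qed
    fix x assume "x \<in> S"
    then obtain T where T: "openin (top_of_set S) T" "x \<in> T" "C1_on T f fu fv" using assms by blast
    show "(f has_derivative (\<lambda>h. fst h *\<^sub>R fu x + snd h *\<^sub>R fv x)) (at x within S)"
      using C1_onD(3)[OF T(3,2)] unfolding at_eq[OF T(1,2)] .
  qed
qed

lemma C1_on_const: "C1_on S (\<lambda>x. c) (\<lambda>x. 0) (\<lambda>x. 0)"
  by (rule C1_onI) auto

lemma C1_on_add:
  assumes "C1_on S f fu fv" "C1_on S g gu gv"
  shows "C1_on S (\<lambda>x. f x + g x) (\<lambda>x. fu x + gu x) (\<lambda>x. fv x + gv x)"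
proof (rule C1_onI)
  show "continuous_on S (\<lambda>x. fu x + gu x)" "continuous_on S (\<lambda>x. fv x + gv x)"
    using assms by (auto intro!: continuous_intros simp: C1_on_def)
  show "((\<lambda>x. f x + g x) has_derivative (\<lambda>h. fst h *\<^sub>R (fu x + gu x) + snd h *\<^sub>R (fv x + gv x))) (at x within S)"
    if "x \<in> S" for x
    using has_derivative_add[OF C1_onD(3)[OF assms(1) that] C1_onD(3)[OF assms(2) that]]
    by (simp add: algebra_simps)
qed

lemma C1_on_linear:
  assumes "bounded_linear L" "C1_on S f fu fv"
  shows "C1_on S (\<lambda>x. L (f x)) (\<lambda>x. L (fu x)) (\<lambda>x. L (fv x))"
proof -
  interpret L: bounded_linear L by fact
  show ?thesis
  proof (rule C1_onI)
    show "continuous_on S (\<lambda>x. L (fu x))" "continuous_on S (\<lambda>x. L (fv x))"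
      by (rule L.continuous_on[OF C1_onD(1)[OF assms(2)]], rule L.continuous_on[OF C1_onD(2)[OF assms(2)]])
    show "((\<lambda>x. L (f x)) has_derivative (\<lambda>h. fst h *\<^sub>R L (fu x) + snd h *\<^sub>R L (fv x))) (at x within S)"
      if "x \<in> S" for x
      using L.has_derivative[OF C1_onD(3)[OF assms(2) that]] by (simp add: L.add L.scaleR)
  qed
qed

lemma C1_on_bilinear:
  assumes "bounded_bilinear B" "C1_on S f fu fv" "C1_on S g gu gv"
  shows "C1_on S (\<lambda>x. B (f x) (g x)) (\<lambda>x. B (f x) (gu x) + B (fu x) (g x)) (\<lambda>x. B (f x) (gv x) + B (fv x) (g x))"
proof -
  interpret B: bounded_bilinear B by fact
  show ?thesis
  proof (rule C1_onI)
    show "continuous_on S (\<lambda>x. B (f x) (gu x) + B (fu x) (g x))" "continuous_on S (\<lambda>x. B (f x) (gv x) + B (fv x) (g x))"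
      by (rule continuous_on_add; rule B.continuous_on;
          rule C1_on_continuous[OF assms(2)] C1_on_continuous[OF assms(3)] C1_onD(1,2)[OF assms(2)] C1_onD(1,2)[OF assms(3)])+
    show "((\<lambda>x. B (f x) (g x)) has_derivative (\<lambda>h. fst h *\<^sub>R (B (f x) (gu x) + B (fu x) (g x)) + snd h *\<^sub>R (B (f x) (gv x) + B (fv x) (g x)))) (at x within S)"
      if "x \<in> S" for x
      using B.FDERIV[OF C1_onD(3)[OF assms(2) that] C1_onD(3)[OF assms(3) that]]
      by (simp add: B.add_left B.add_right B.scaleR_left B.scaleR_right algebra_simps)
  qed
qed

lemma C1_on_chain:
  assumes "C1_on S \<tau> \<tau>u \<tau>v" "C1_on T f fu fv" "\<tau> ` S \<subseteq> T"
  shows "C1_on S (\<lambda>x. f (\<tau> x)) (\<lambda>x. fst (\<tau>u x) *\<^sub>R fu (\<tau> x) + snd (\<tau>u x) *\<^sub>R fv (\<tau> x))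
     (\<lambda>x. fst (\<tau>v x) *\<^sub>R fu (\<tau> x) + snd (\<tau>v x) *\<^sub>R fv (\<tau> x))"
proof (rule C1_onI)
  have \<tau>: "continuous_on S \<tau>" using assms(1) by (rule C1_on_continuous)
  have "continuous_on S (\<lambda>x. fu (\<tau> x))" "continuous_on S (\<lambda>x. fv (\<tau> x))"
    using assms by (auto intro: continuous_on_compose2[OF _ \<tau>] simp: C1_on_def)
  then show "continuous_on S (\<lambda>x. fst (\<tau>u x) *\<^sub>R fu (\<tau> x) + snd (\<tau>u x) *\<^sub>R fv (\<tau> x))"
    "continuous_on S (\<lambda>x. fst (\<tau>v x) *\<^sub>R fu (\<tau> x) + snd (\<tau>v x) *\<^sub>R fv (\<tau> x))"
    using C1_onD(1,2)[OF assms(1)] by (auto intro!: continuous_intros)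
  fix x assume x: "x \<in> S"
  have 1: "(\<tau> has_derivative (\<lambda>h. fst h *\<^sub>R \<tau>u x + snd h *\<^sub>R \<tau>v x)) (at x within S)"
    by (rule C1_onD(3)[OF assms(1) x])
  have 2: "(f has_derivative (\<lambda>h. fst h *\<^sub>R fu (\<tau> x) + snd h *\<^sub>R fv (\<tau> x))) (at (\<tau> x) within \<tau> ` S)"
    by (rule has_derivative_subset[OF C1_onD(3)[OF assms(2)] assms(3)]) (use x assms(3) in auto)
  show "((\<lambda>x. f (\<tau> x)) has_derivative (\<lambda>h. fst h *\<^sub>R (fst (\<tau>u x) *\<^sub>R fu (\<tau> x) + snd (\<tau>u x) *\<^sub>R fv (\<tau> x))
     + snd h *\<^sub>R (fst (\<tau>v x) *\<^sub>R fu (\<tau> x) + snd (\<tau>v x) *\<^sub>R fv (\<tau> x)))) (at x within S)"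
    using has_derivative_in_compose[OF 1 2] by (simp add: algebra_simps)
qed

text \<open>The domain \<open>D\<close> is there for functions such as the inverse square root in
  \<open>C1_on_sgn\<close>, differentiable on the positive reals only.\<close>

lemma C1_on_real_comp:
  fixes f :: "real \<times> real \<Rightarrow> real"
  assumes "C1_on S f fu fv" "\<And>x. x \<in> S \<Longrightarrow> f x \<in> D"
    "\<And>y. y \<in> D \<Longrightarrow> (h has_real_derivative h' y) (at y)" "continuous_on D h'"
  shows "C1_on S (\<lambda>x. h (f x)) (\<lambda>x. h' (f x) * fu x) (\<lambda>x. h' (f x) * fv x)"
proof (rule C1_onI)
  have f: "continuous_on S f" using assms(1) by (rule C1_on_continuous)
  have "continuous_on S (\<lambda>x. h' (f x))"
    using assms by (auto intro: continuous_on_compose2[OF _ f])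
  then show "continuous_on S (\<lambda>x. h' (f x) * fu x)" "continuous_on S (\<lambda>x. h' (f x) * fv x)"
    using C1_onD(1,2)[OF assms(1)] by (auto intro!: continuous_intros)
  fix x assume x: "x \<in> S"
  have "(h has_derivative (*) (h' (f x))) (at (f x))"
    using assms(3)[OF assms(2)[OF x]] by (simp add: has_field_derivative_def)
  from has_derivative_compose[OF C1_onD(3)[OF assms(1) x] this]
  show "((\<lambda>x. h (f x)) has_derivative (\<lambda>a. fst a *\<^sub>R (h' (f x) * fu x) + snd a *\<^sub>R (h' (f x) * fv x))) (at x within S)"
    by (simp add: algebra_simps)
qed

section \<open>Derivatives up to the edge of the half plane\<close>

lemma closed_half_plane: "closed half_plane"
  unfolding half_plane_def by (intro closed_Collect_le continuous_intros)

text \<open>A derivative within a set is unique once every coordinate direction can be approached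
  inside the set. At the edge of the half plane the second direction is available from one side
  only, so the increment is taken positive.\<close>

lemma half_plane_approach:
  fixes x :: "real \<times> real"
  assumes "openin (top_of_set half_plane) S" "x \<in> S" "i \<in> Basis" "e > 0"
  shows "\<exists>d. 0 < \<bar>d\<bar> \<and> \<bar>d\<bar> < e \<and> x + d *\<^sub>R i \<in> S"
proof -
  obtain U where U: "open U" "S = half_plane \<inter> U" using assms openin_open by blast
  obtain r where r: "r > 0" "ball x r \<subseteq> U" using U(1) U(2) assms(2) openE[of U x] by blast
  define d where "d = min e r / 2"
  have d: "0 < d" "d < e" "d < r" using assms r by (auto simp: d_def)
  have "norm (d *\<^sub>R i) < r" using assms d by simp
  then have "x + d *\<^sub>R i \<in> ball x r" by (simp add: dist_norm)
  moreover have "x + d *\<^sub>R i \<in> half_plane"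
    using assms U d by (auto simp: half_plane_def Basis_prod_def)
  ultimately show ?thesis using d r U by (intro exI[of _ d]) auto
qed

lemma half_plane_derivative_unique:
  assumes "openin (top_of_set half_plane) S" "x \<in> S"
    "(f has_derivative f') (at x within S)" "(f has_derivative f'') (at x within S)"
  shows "f' = f''"
  using frechet_derivative_unique_within[OF assms(3,4)] half_plane_approach[OF assms(1,2)] by blast

lemma openin_half_plane_interior:
  assumes "openin (top_of_set half_plane) S"
  shows "open (S \<inter> {x. 0 < snd x})"
proof -
  obtain U where U: "open U" "S = half_plane \<inter> U" using assms openin_open by blast
  have "S \<inter> {x. 0 < snd x} = U \<inter> {x. 0 < snd x}" using U by (auto simp: half_plane_def)
  moreover have "open {x::real\<times>real. 0 < snd x}" by (intro open_Collect_less continuous_intros)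
  ultimately show ?thesis using U by auto
qed

text \<open>\<open>frechet_derivative\<close> is a choice among derivatives, so the partials of the
  definitions can be computed only once uniqueness within the half plane is known.
  \<open>C1_on\<close> therefore carries its partials as explicit functions, and this lemma
  translates them back.\<close>

lemma partial_eqI:
  assumes "openin (top_of_set half_plane) S" "C1_on S f fu fv" "x \<in> S"
  shows "partial_u f x = fu x" "partial_v f x = fv x"
    "frechet_derivative f (at x within half_plane) = (\<lambda>h. fst h *\<^sub>R fu x + snd h *\<^sub>R fv x)"
proof -
  note d = C1_onD(3)[OF assms(2,3)]
  have "(f has_derivative frechet_derivative f (at x within half_plane)) (at x within S)"
    using d unfolding at_within_openin[OF assms(1,3)] using frechet_derivative_works differentiableI by blast
  then show e: "frechet_derivative f (at x within half_plane) = (\<lambda>h. fst h *\<^sub>R fu x + snd h *\<^sub>R fv x)"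
    using half_plane_derivative_unique[OF assms(1,3) _ d] by blast
  show "partial_u f x = fu x" "partial_v f x = fv x" by (simp_all add: partial_u_def partial_v_def e)
qed

text \<open>The local extension \<open>g\<close> is kept in the conclusion because its partials
  extend those of \<open>f\<close>, also at the edge. They are the witnesses by which the partials
  of a smooth map are seen to be smooth again.\<close>

lemma smooth_C1_local:
  assumes S: "openin (top_of_set half_plane) S" and f: "smooth_map_on S f" and x: "x \<in> S"
  shows "\<exists>W g. open W \<and> x \<in> W \<and> (\<forall>k. Ck_on k g W) \<and> C1_on (S \<inter> W) f (\<lambda>x. frechet_derivative g (at x) (1,0)) (\<lambda>x. frechet_derivative g (at x) (0,1))
     \<and> (\<forall>y\<in>S \<inter> W. partial_u f y = frechet_derivative g (at y) (1,0) \<and> partial_v f y = frechet_derivative g (at y) (0,1))"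
proof -
  obtain W g where W: "open W" "x \<in> W" "\<And>k. Ck_on k g W" "\<And>y. y \<in> S \<inter> W \<Longrightarrow> g y = f y"
    using f x unfolding smooth_map_on_def by meson
  have 1: "Ck_on (Suc 0) g W" by (rule W)
  have "C1_on W g (\<lambda>x. frechet_derivative g (at x) (1,0)) (\<lambda>x. frechet_derivative g (at x) (0,1))"
  proof (rule C1_onI)
    show "continuous_on W (\<lambda>x. frechet_derivative g (at x) (1,0))" "continuous_on W (\<lambda>x. frechet_derivative g (at x) (0,1))"
      using 1 by auto
    fix y assume y: "y \<in> W"
    then have d: "(g has_derivative frechet_derivative g (at y)) (at y)" using 1 frechet_derivative_works by auto
    interpret linear "frechet_derivative g (at y)" using d has_derivative_linear by blast
    have "frechet_derivative g (at y) h = fst h *\<^sub>R frechet_derivative g (at y) (1, 0) + snd h *\<^sub>R frechet_derivative g (at y) (0, 1)" for h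
      by (simp flip: scale add)
    then have "frechet_derivative g (at y) = (\<lambda>h. fst h *\<^sub>R frechet_derivative g (at y) (1, 0) + snd h *\<^sub>R frechet_derivative g (at y) (0, 1))" by blast
    with d show "(g has_derivative (\<lambda>h. fst h *\<^sub>R frechet_derivative g (at y) (1, 0) + snd h *\<^sub>R frechet_derivative g (at y) (0, 1))) (at y within W)"
      using has_derivative_at_withinI by metis
  qed
  then have "C1_on (S \<inter> W) g (\<lambda>x. frechet_derivative g (at x) (1,0)) (\<lambda>x. frechet_derivative g (at x) (0,1))"
    by (rule C1_on_subset) auto
  then have c: "C1_on (S \<inter> W) f (\<lambda>x. frechet_derivative g (at x) (1,0)) (\<lambda>x. frechet_derivative g (at x) (0,1))"
    by (rule C1_on_cong) (use W in auto)
  have o: "openin (top_of_set half_plane) (S \<inter> W)" using S W by (simp add: openin_Int_open)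
  show ?thesis
    using W c partial_eqI[OF o c] by (intro exI[of _ W] exI[of _ g]) auto
qed

lemma smooth_C1:
  assumes S: "openin (top_of_set half_plane) S" and f: "smooth_map_on S f"
  shows "C1_on S f (partial_u f) (partial_v f)"
proof (rule C1_on_local)
  fix x assume "x \<in> S"
  from smooth_C1_local[OF S f this] obtain W g where W: "open W" "x \<in> W" and
    c: "C1_on (S \<inter> W) f (\<lambda>x. frechet_derivative g (at x) (1,0)) (\<lambda>x. frechet_derivative g (at x) (0,1))"
     "\<And>y. y\<in>S \<inter> W \<Longrightarrow> partial_u f y = frechet_derivative g (at y) (1,0) \<and> partial_v f y = frechet_derivative g (at y) (0,1)"
    by blast
  have "C1_on (S \<inter> W) f (partial_u f) (partial_v f)"
    by (rule C1_on_cong[OF c(1)]) (use c in auto)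
  then show "\<exists>T. openin (top_of_set S) T \<and> x \<in> T \<and> C1_on T f (partial_u f) (partial_v f)"
    using W \<open>x \<in> S\<close> by (intro exI[of _ "S \<inter> W"]) (auto intro: openin_open_Int)
qed

lemma smooth_partial:
  assumes S: "openin (top_of_set half_plane) S" and f: "smooth_map_on S f"
  shows "smooth_map_on S (partial_u f)" "smooth_map_on S (partial_v f)"
proof -
  have *: "\<exists>W g h. open W \<and> x \<in> W \<and> (\<forall>k. Ck_on k g W) \<and> (\<forall>k. Ck_on k h W) \<and> (\<forall>y\<in>S \<inter> W. g y = partial_u f y \<and> h y = partial_v f y)"
    if x: "x \<in> S" for x
  proof -
    from smooth_C1_local[OF S f x] obtain W g where W: "open W" "x \<in> W" "\<And>k. Ck_on k g W" and
     c: "\<And>y. y\<in>S \<inter> W \<Longrightarrow> partial_u f y = frechet_derivative g (at y) (1,0) \<and> partial_v f y = frechet_derivative g (at y) (0,1)"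
      by blast
    have "Ck_on k (\<lambda>y. frechet_derivative g (at y) v) W" for k v
      using W(3)[of "Suc k"] unfolding Ck_on.simps by blast
    then show ?thesis using W c
      by (intro exI[of _ W] exI[of _ "\<lambda>y. frechet_derivative g (at y) (1,0)"] exI[of _ "\<lambda>y. frechet_derivative g (at y) (0,1)"]) auto
  qed
  show "smooth_map_on S (partial_u f)"
    unfolding smooth_map_on_def
  proof
    fix x assume "x \<in> S"
    from *[OF this] show "\<exists>W g. open W \<and> x \<in> W \<and> (\<forall>k. Ck_on k g W) \<and> (\<forall>y\<in>S \<inter> W. g y = partial_u f y)"
      by fast
  qed
  show "smooth_map_on S (partial_v f)"
    unfolding smooth_map_on_def
  proof
    fix x assume "x \<in> S"
    from *[OF this] show "\<exists>W g. open W \<and> x \<in> W \<and> (\<forall>k. Ck_on k g W) \<and> (\<forall>y\<in>S \<inter> W. g y = partial_v f y)"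
      by fast
  qed
qed

text \<open>Schwarz's theorem through the mean value theorem: the second difference of
  \<open>f\<close> over a small square is h^2 times a value of \<open>fuv\<close> and also h^2 times
  a value of \<open>fvu\<close>, both at points of the square. Distinct values at \<open>x\<close>
  would stay apart nearby by continuity.\<close>

lemma mixed_partials_real:
  fixes f :: "real \<times> real \<Rightarrow> real"
  assumes S: "open S" and f: "C1_on S f fu fv" and fu: "C1_on S fu fuu fuv" and fv: "C1_on S fv fvu fvv"
    and x: "x \<in> S"
  shows "fuv x = fvu x"
proof -
  have du: "((\<lambda>s. g (s, y)) has_real_derivative gu (s, y)) (at s)"
    if g: "C1_on S g gu gv" and "(s, y) \<in> S" for g gu gv s y
  proof -
    have 1: "(g has_derivative (\<lambda>h. fst h *\<^sub>R gu (s,y) + snd h *\<^sub>R gv (s,y))) (at (s,y))"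
      using C1_onD(3)[OF g that(2)] at_within_open[OF that(2) S] by simp
    have 2: "((\<lambda>s. (s, y)) has_derivative (\<lambda>h. (h, 0))) (at s)"
      by (auto intro!: derivative_eq_intros)
    from has_derivative_compose[OF 2 1] show ?thesis
      by (simp add: has_field_derivative_def mult_commute_abs)
  qed
  have dv: "((\<lambda>s. g (y, s)) has_real_derivative gv (y, s)) (at s)"
    if g: "C1_on S g gu gv" and "(y, s) \<in> S" for g gu gv s y
  proof -
    have 1: "(g has_derivative (\<lambda>h. fst h *\<^sub>R gu (y,s) + snd h *\<^sub>R gv (y,s))) (at (y,s))"
      using C1_onD(3)[OF g that(2)] at_within_open[OF that(2) S] by simp
    have 2: "((\<lambda>s. (y, s)) has_derivative (\<lambda>h. (0, h))) (at s)"
      by (auto intro!: derivative_eq_intros)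
    from has_derivative_compose[OF 2 1] show ?thesis
      by (simp add: has_field_derivative_def mult_commute_abs)
  qed
  obtain a b where ab: "x = (a, b)" by (cases x)
  have cuv: "isCont fuv x" "isCont fvu x"
    using C1_onD(2)[OF fu] C1_onD(1)[OF fv] S x continuous_on_eq_continuous_at by blast+
  show ?thesis
  proof (rule ccontr)
    assume ne: "fuv x \<noteq> fvu x"
    define e where "e = \<bar>fuv x - fvu x\<bar> / 2"
    have e: "e > 0" using ne by (simp add: e_def)
    obtain r1 where r1: "r1 > 0" "\<And>y. dist y x < r1 \<Longrightarrow> dist (fuv y) (fuv x) < e"
      using cuv(1) e unfolding continuous_at_eps_delta by blast
    obtain r2 where r2: "r2 > 0" "\<And>y. dist y x < r2 \<Longrightarrow> dist (fvu y) (fvu x) < e"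
      using cuv(2) e unfolding continuous_at_eps_delta by blast
    obtain r3 where r3: "r3 > 0" "ball x r3 \<subseteq> S" using S x by (meson openE)
    \<comment> \<open>Points of the square with corner (a, b) and side \<open>h\<close> are within 2
      h of \<open>x\<close>; taking a third of the radii leaves the strict bound by
      \<open>3 * h\<close>.\<close>
    define h where "h = min r1 (min r2 r3) / 3"
    have h: "h > 0" "3 * h \<le> r1" "3 * h \<le> r2" "3 * h \<le> r3" using r1 r2 r3 by (auto simp: h_def)
    have near: "dist (s, t) x < 3 * h" if "a \<le> s" "s \<le> a + h" "b \<le> t" "t \<le> b + h" for s t
    proof -
      have "dist (s, t) x \<le> \<bar>s - a\<bar> + \<bar>t - b\<bar>"
        unfolding ab dist_Pair_Pair using sqrt_sum_squares_le_sum_abs[of "dist s a" "dist t b"] by (simp add: dist_real_def)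
      also have "\<dots> < 3 * h" using that h by simp
      finally show ?thesis .
    qed
    have inS: "(s, t) \<in> S" if "a \<le> s" "s \<le> a + h" "b \<le> t" "t \<le> b + h" for s t
      using near[OF that] r3 h by (auto simp: dist_commute mem_ball subset_iff)
    have "\<exists>z>a. z < a + h \<and> (f (a+h, b+h) - f (a+h, b)) - (f (a, b+h) - f (a, b)) = (a + h - a) * (fu (z, b+h) - fu (z, b))"
      by (rule MVT2[where f="\<lambda>s. f (s, b+h) - f (s, b)"]) (use h in \<open>auto intro!: DERIV_diff du[OF f] inS\<close>)
    then obtain s where s: "a < s" "s < a + h"
      "(f (a+h, b+h) - f (a+h, b)) - (f (a, b+h) - f (a, b)) = h * (fu (s, b+h) - fu (s, b))" by auto
    have "\<exists>z>b. z < b + h \<and> fu (s, b+h) - fu (s, b) = (b + h - b) * fuv (s, z)"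
      by (rule MVT2) (use h s in \<open>auto intro!: dv[OF fu] inS\<close>)
    then obtain t where t: "b < t" "t < b + h" "fu (s, b+h) - fu (s, b) = h * fuv (s, t)" by auto
    have "\<exists>z>b. z < b + h \<and> (f (a+h, b+h) - f (a, b+h)) - (f (a+h, b) - f (a, b)) = (b + h - b) * (fv (a+h, z) - fv (a, z))"
      by (rule MVT2[where f="\<lambda>s. f (a+h, s) - f (a, s)"]) (use h in \<open>auto intro!: DERIV_diff dv[OF f] inS\<close>)
    then obtain t' where t': "b < t'" "t' < b + h"
      "(f (a+h, b+h) - f (a, b+h)) - (f (a+h, b) - f (a, b)) = h * (fv (a+h, t') - fv (a, t'))" by auto
    have "\<exists>z>a. z < a + h \<and> fv (a+h, t') - fv (a, t') = (a + h - a) * fvu (z, t')"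
      by (rule MVT2) (use h t' in \<open>auto intro!: du[OF fv] inS\<close>)
    then obtain s' where s': "a < s'" "s' < a + h" "fv (a+h, t') - fv (a, t') = h * fvu (s', t')" by auto
    have "(f (a+h, b+h) - f (a+h, b)) - (f (a, b+h) - f (a, b)) = h * (h * fuv (s, t))"
      using s(3) t(3) by simp
    moreover have "(f (a+h, b+h) - f (a, b+h)) - (f (a+h, b) - f (a, b)) = h * (h * fvu (s', t'))"
      using t'(3) s'(3) by simp
    ultimately have "h * (h * fuv (s, t)) = h * (h * fvu (s', t'))" by linarith
    then have eq: "fuv (s, t) = fvu (s', t')" using h by simp
    have "dist (fuv (s,t)) (fuv x) < e" using r1(2) near[of s t] s t h by fastforce
    moreover have "dist (fvu (s',t')) (fvu x) < e" using r2(2) near[of s' t'] s' t' h by fastforce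
    ultimately show False using eq unfolding e_def dist_real_def by argo
  qed
qed

lemma mixed_partials:
  fixes f :: "real \<times> real \<Rightarrow> 'b::real_inner"
  assumes S: "open S" and f: "C1_on S f fu fv" and fu: "C1_on S fu fuu fuv" and fv: "C1_on S fv fvu fvv"
    and x: "x \<in> S"
  shows "fuv x = fvu x"
proof -
  have "fuv x \<bullet> c = fvu x \<bullet> c" for c
  proof -
    have b: "bounded_linear (\<lambda>y. y \<bullet> c)" by (rule bounded_linear_inner_left)
    show ?thesis
      by (rule mixed_partials_real[OF S C1_on_linear[OF b f] C1_on_linear[OF b fu] C1_on_linear[OF b fv] x])
  qed
  then show ?thesis by (metis vector_eq_rdot)
qed

section \<open>Change of variables\<close>

definition det2 :: "(real \<times> real \<Rightarrow> real \<times> real) \<Rightarrow> real" where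
  "det2 L = fst (L (1, 0)) * snd (L (0, 1)) - snd (L (1, 0)) * fst (L (0, 1))"

text \<open>\<open>has_measure_differentiable_image\<close> and \<open>det\<close> live on
  \<open>real^2\<close>. This map and its inverse carry the plane of the charts there and back,
  preserving Lebesgue measure.\<close>

definition vec_of_pair :: "real \<times> real \<Rightarrow> real^2" where
  "vec_of_pair x = vector [fst x, snd x]"

definition pair_of_vec :: "real^2 \<Rightarrow> real \<times> real" where
  "pair_of_vec y = (y $ 1, y $ 2)"

lemma pair_vec_inverse [simp]: "pair_of_vec (vec_of_pair x) = x" "vec_of_pair (pair_of_vec y) = y"
  by (simp_all add: pair_of_vec_def vec_of_pair_def vec_eq_iff forall_2 vector_def)

lemma bounded_linear_vec_of_pair: "bounded_linear vec_of_pair"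
  by (intro linear_conv_bounded_linear[THEN iffD1] linearI)
    (simp_all add: vec_of_pair_def vec_eq_iff forall_2 vector_def)

lemma bounded_linear_pair_of_vec: "bounded_linear pair_of_vec"
  by (intro linear_conv_bounded_linear[THEN iffD1] linearI) (simp_all add: pair_of_vec_def)

lemma measurable_vec_of_pair [measurable]: "vec_of_pair \<in> borel_measurable borel"
  by (intro borel_measurable_continuous_onI linear_continuous_on bounded_linear_vec_of_pair)

lemma measurable_pair_of_vec [measurable]: "pair_of_vec \<in> borel_measurable borel"
  by (intro borel_measurable_continuous_onI linear_continuous_on bounded_linear_pair_of_vec)

lemma lborel_vec_of_pair: "(lborel :: (real^2) measure) = distr lborel borel vec_of_pair"
proof (rule lborel_eqI)
  fix l u :: "real^2" assume lu: "\<And>b. b \<in> Basis \<Longrightarrow> l \<bullet> b \<le> u \<bullet> b"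
  have lu': "l $ i \<le> u $ i" for i
    using lu[of "axis i 1"] by (simp add: cart_eq_inner_axis axis_in_Basis_iff)
  have pre: "vec_of_pair -` box l u \<inter> space lborel = box (pair_of_vec l) (pair_of_vec u)"
    by (auto simp: mem_box_cart forall_2 vec_of_pair_def pair_of_vec_def mem_box Basis_prod_def)
  have "emeasure (distr lborel borel vec_of_pair) (box l u) = emeasure lborel (box (pair_of_vec l) (pair_of_vec u))"
    using pre by (subst emeasure_distr) simp_all
  also have "\<dots> = ennreal (\<Prod>b\<in>Basis. (pair_of_vec u - pair_of_vec l) \<bullet> b)"
    by (subst emeasure_lborel_box) (use lu' in \<open>auto simp: pair_of_vec_def Basis_prod_def\<close>)
  also have "(\<Prod>b\<in>Basis. (pair_of_vec u - pair_of_vec l) \<bullet> b) = (u $ 1 - l $ 1) * (u $ 2 - l $ 2)"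
    by (simp add: Basis_prod_def pair_of_vec_def prod.insert)
  also have "\<dots> = (\<Prod>i\<in>UNIV. (u - l) $ i)" by (simp add: UNIV_2)
  also have "\<dots> = (\<Prod>b\<in>Basis. (u - l) \<bullet> b)"
  proof -
    have "Basis = range (\<lambda>i. axis i (1::real) :: real^2)" by (auto simp: Basis_vec_def)
    then have "(\<Prod>b\<in>Basis. (u - l) \<bullet> b) = (\<Prod>b\<in>range (\<lambda>i. axis i (1::real) :: real^2). (u - l) \<bullet> b)" by simp
    also have "\<dots> = (\<Prod>i\<in>UNIV. (u - l) \<bullet> axis i 1)"
      by (subst prod.reindex) (auto simp: inj_on_def axis_eq_axis)
    finally show ?thesis by (simp add: inner_axis)
  qed
  finally show "emeasure (distr lborel borel vec_of_pair) (box l u) = ennreal (\<Prod>b\<in>Basis. (u - l) \<bullet> b)" .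
qed simp

lemma emeasure_vec_of_pair_image:
  assumes "B \<in> sets borel"
  shows "emeasure lborel (vec_of_pair ` B) = emeasure lborel B" "vec_of_pair ` B \<in> sets borel"
proof -
  have e: "vec_of_pair ` B = pair_of_vec -` B \<inter> space borel"
    by (auto simp: image_iff) (metis pair_vec_inverse(2))
  show m: "vec_of_pair ` B \<in> sets borel" unfolding e using assms by measurable
  have "vec_of_pair -` (vec_of_pair ` B) = B"
    by (auto simp: image_iff) (metis pair_vec_inverse(1))
  then show "emeasure lborel (vec_of_pair ` B) = emeasure lborel B"
    using m by (subst lborel_vec_of_pair) (simp add: emeasure_distr)
qed

text \<open>The area formula for injective maps is an equivalence between a finite measure of the
  image and an existing integral of the Jacobian. The case of infinite values is added by
  contradiction from the same equivalence.\<close>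

lemma emeasure_differentiable_image:
  fixes g :: "real \<times> real \<Rightarrow> real \<times> real"
  assumes S: "S \<in> sets borel" and T: "g ` S \<in> sets borel"
    and der: "\<And>x. x \<in> S \<Longrightarrow> (g has_derivative g' x) (at x within S)"
    and inj: "inj_on g S" and cont: "continuous_on S (\<lambda>x. det2 (g' x))"
  shows "emeasure lborel (g ` S) = (\<integral>\<^sup>+x. ennreal \<bar>det2 (g' x)\<bar> * indicator S x \<partial>lborel)"
proof -
  define S' where "S' = vec_of_pair ` S"
  define G where "G = vec_of_pair \<circ> g \<circ> pair_of_vec"
  define G' where "G' y = vec_of_pair \<circ> g' (pair_of_vec y) \<circ> pair_of_vec" for y
  have S'b: "S' \<in> sets borel" unfolding S'_def by (rule emeasure_vec_of_pair_image(2)[OF S])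
  have GS: "G ` S' = vec_of_pair ` (g ` S)" by (auto simp: G_def S'_def image_iff)
  have GSb: "G ` S' \<in> sets borel" unfolding GS by (rule emeasure_vec_of_pair_image(2)[OF T])
  have PS: "pair_of_vec ` S' = S" by (auto simp: S'_def image_iff)
  have derG: "(G has_derivative G' y) (at y within S')" if "y \<in> S'" for y
  proof -
    have p: "(pair_of_vec has_derivative pair_of_vec) (at y within S')"
      using bounded_linear_imp_has_derivative[OF bounded_linear_pair_of_vec] .
    have "pair_of_vec y \<in> S" using that PS by blast
    then have q: "(g has_derivative g' (pair_of_vec y)) (at (pair_of_vec y) within pair_of_vec ` S')"
      unfolding PS by (rule der)
    have "((\<lambda>z. vec_of_pair (g (pair_of_vec z))) has_derivative (\<lambda>h. vec_of_pair (g' (pair_of_vec y) (pair_of_vec h)))) (at y within S')"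
      by (rule bounded_linear.has_derivative[OF bounded_linear_vec_of_pair has_derivative_in_compose[OF p q]])
    then show ?thesis by (simp add: G_def G'_def o_def)
  qed
  have injG: "inj_on G S'"
    using inj unfolding inj_on_def G_def S'_def by auto (metis pair_vec_inverse(1))
  have det: "det (matrix (G' y)) = det2 (g' (pair_of_vec y))" for y
  proof -
    have "pair_of_vec (axis 1 1) = (1, 0)" "pair_of_vec (axis 2 1) = (0, 1)" by (auto simp: pair_of_vec_def axis_def)
    then show ?thesis
      by (simp add: det_2 matrix_def G'_def det2_def vec_of_pair_def vector_def)
  qed
  define f where "f y = \<bar>det2 (g' (pair_of_vec y))\<bar> * indicator S' y" for y
  have fm: "f \<in> borel_measurable borel"
  proof -
    have "continuous_on S' (\<lambda>y. det2 (g' (pair_of_vec y)))"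
      by (rule continuous_on_compose2[OF cont linear_continuous_on[OF bounded_linear_pair_of_vec]]) (simp add: PS)
    then have "(\<lambda>y. indicator S' y *\<^sub>R \<bar>det2 (g' (pair_of_vec y))\<bar>) \<in> borel_measurable borel"
      using S'b by (intro borel_measurable_continuous_on_indicator continuous_intros) auto
    then show ?thesis by (simp add: f_def[abs_def] mult.commute)
  qed
  have f0: "0 \<le> f y" for y by (simp add: f_def)
  have ind: "((\<lambda>y. \<bar>det (matrix (G' y))\<bar>) has_integral m) S' \<longleftrightarrow> (f has_integral m) UNIV" for m
  proof -
    have "f = (\<lambda>y. if y \<in> S' then \<bar>det (matrix (G' y))\<bar> else 0)" by (auto simp: f_def det)
    then show ?thesis by (simp add: has_integral_restrict_UNIV)
  qed
  have hm: "G ` S' \<in> lmeasurable \<and> measure lebesgue (G ` S') = m \<longleftrightarrow> (f has_integral m) UNIV" for m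
    using has_measure_differentiable_image[OF _ derG injG, of m] S'b unfolding ind by auto
  have leb: "emeasure lebesgue (G ` S') = emeasure lborel (G ` S')" using GSb by simp
  have "emeasure lborel (G ` S') = (\<integral>\<^sup>+y. ennreal (f y) \<partial>lborel)"
  proof (cases "(\<integral>\<^sup>+y. ennreal (f y) \<partial>lborel) < \<infinity>")
    case True
    then obtain r where r: "0 \<le> r" "(\<integral>\<^sup>+y. ennreal (f y) \<partial>lborel) = ennreal r"
      by (cases "\<integral>\<^sup>+y. ennreal (f y) \<partial>lborel") auto
    have "(f has_integral r) UNIV" by (rule nn_integral_has_integral) (use fm f0 r in auto)
    then have "G ` S' \<in> lmeasurable" "measure lebesgue (G ` S') = r" using hm[of r] by auto
    then have "emeasure lebesgue (G ` S') = ennreal r"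
      by (metis emeasure_eq_measure2 fmeasurableD2 infinity_ennreal_def top.not_eq_extremum)
    then show ?thesis using r leb by simp
  next
    case False
    show ?thesis
    proof (rule ccontr)
      assume "\<not> ?thesis"
      then have "emeasure lborel (G ` S') < \<infinity>"
        using False by (metis infinity_ennreal_def top.not_eq_extremum)
      then have "G ` S' \<in> lmeasurable" using GSb leb by (auto simp: fmeasurable_def)
      then have "(f has_integral measure lebesgue (G ` S')) UNIV" using hm by blast
      then have "(\<integral>\<^sup>+y. ennreal (f y) \<partial>lborel) = ennreal (measure lebesgue (G ` S'))"
        by (intro nn_integral_has_integral_lborel) (use fm f0 in auto)
      then show False using False by simp
    qed
  qed
  also have "\<dots> = (\<integral>\<^sup>+x. ennreal (f (vec_of_pair x)) \<partial>lborel)"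
    by (subst lborel_vec_of_pair, subst nn_integral_distr) (use fm in auto)
  also have "\<dots> = (\<integral>\<^sup>+x. ennreal \<bar>det2 (g' x)\<bar> * indicator S x \<partial>lborel)"
  proof (intro nn_integral_cong)
    fix x
    have "vec_of_pair x \<in> S' \<longleftrightarrow> x \<in> S" unfolding S'_def by (metis imageE imageI pair_vec_inverse(1))
    then show "ennreal (f (vec_of_pair x)) = ennreal \<bar>det2 (g' x)\<bar> * indicator S x"
      by (simp add: f_def indicator_def)
  qed
  finally show ?thesis using emeasure_vec_of_pair_image(1)[OF T] unfolding GS by simp
qed

text \<open>The formula for images of sets says that two measures agree: Lebesgue measure restricted
  to \<open>T\<close>, and the push-forward under \<open>g\<close> of the Jacobian density on
  \<open>S\<close>. Integrating \<open>f\<close> against both yields the formula.\<close>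

lemma nn_integral_change_of_variables:
  fixes g :: "real \<times> real \<Rightarrow> real \<times> real"
  assumes hom: "homeomorphism S T g h" and S: "S \<in> sets borel" and T: "T \<in> sets borel"
    and der: "\<And>x. x \<in> S \<Longrightarrow> (g has_derivative g' x) (at x within S)"
    and cont: "continuous_on S (\<lambda>x. det2 (g' x))"
    and f: "f \<in> borel_measurable borel"
  shows "(\<integral>\<^sup>+y. f y * indicator T y \<partial>lborel) = (\<integral>\<^sup>+x. f (g x) * ennreal \<bar>det2 (g' x)\<bar> * indicator S x \<partial>lborel)"
proof -
  \<comment> \<open>\<open>g\<close> is controlled on \<open>S\<close> only; the value 0 elsewhere
    gives a Borel map of the whole plane, and the weight \<open>w\<close> makes the new values
    invisible.\<close>
  define G where "G x = indicator S x *\<^sub>R g x" for x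
  have gS: "g ` S = T" "continuous_on S g" "inj_on g S"
    using hom inj_on_inverseI[of S h g] by (simp_all add: homeomorphism_def)
  have Gm [measurable]: "G \<in> borel_measurable borel"
    unfolding G_def[abs_def] using S gS by (intro borel_measurable_continuous_on_indicator) auto
  define w where "w x = ennreal \<bar>det2 (g' x)\<bar> * indicator S x" for x
  have wm [measurable]: "w \<in> borel_measurable borel"
  proof -
    have "(\<lambda>x. indicator S x *\<^sub>R \<bar>det2 (g' x)\<bar>) \<in> borel_measurable borel"
      using cont S by (intro borel_measurable_continuous_on_indicator continuous_intros) auto
    then have "(\<lambda>x. ennreal (indicator S x *\<^sub>R \<bar>det2 (g' x)\<bar>)) \<in> borel_measurable borel" by measurable
    also have "(\<lambda>x. ennreal (indicator S x *\<^sub>R \<bar>det2 (g' x)\<bar>)) = w" by (auto simp: w_def indicator_def)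
    finally show ?thesis .
  qed
  have Tm [measurable]: "T \<in> sets borel" and Sm [measurable]: "S \<in> sets borel" by fact+
  have eq: "density lborel (indicator T) = distr (density lborel w) borel G"
  proof (rule measure_eqI)
    fix A assume "A \<in> sets (density lborel (indicator T :: real \<times> real \<Rightarrow> ennreal))"
    then have A [measurable]: "A \<in> sets borel" by simp
    define B where "B = S \<inter> G -` A"
    have Bm [measurable]: "B \<in> sets borel" unfolding B_def
      using measurable_sets_borel[OF Gm A] S by auto
    have BS: "B \<subseteq> S" by (auto simp: B_def)
    have gB: "g ` B = T \<inter> A" using gS by (auto simp: B_def G_def)
    have "emeasure (density lborel (indicator T)) A = emeasure lborel (T \<inter> A)"
      by (simp add: emeasure_density flip: indicator_inter_arith)
    also have "\<dots> = emeasure lborel (g ` B)" by (simp add: gB)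
    also have "\<dots> = (\<integral>\<^sup>+x. ennreal \<bar>det2 (g' x)\<bar> * indicator B x \<partial>lborel)"
    proof (rule emeasure_differentiable_image)
      show "g ` B \<in> sets borel" unfolding gB by measurable
      show "(g has_derivative g' x) (at x within B)" if "x \<in> B" for x
        using der[of x] that BS has_derivative_subset by blast
      show "inj_on g B" using gS(3) BS inj_on_subset by blast
      show "continuous_on B (\<lambda>x. det2 (g' x))" using cont BS continuous_on_subset by blast
    qed measurable
    also have "\<dots> = (\<integral>\<^sup>+x. w x * indicator (G -` A) x \<partial>lborel)"
      by (intro nn_integral_cong) (auto simp: w_def B_def indicator_def)
    also have "\<dots> = emeasure (density lborel w) (G -` A \<inter> space borel)"
      using measurable_sets_borel[OF Gm A] by (subst emeasure_density) auto
    also have "\<dots> = emeasure (distr (density lborel w) borel G) A"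
      by (subst emeasure_distr) auto
    finally show "emeasure (density lborel (indicator T)) A = emeasure (distr (density lborel w) borel G) A" .
  qed simp
  have "(\<integral>\<^sup>+y. f y * indicator T y \<partial>lborel) = (\<integral>\<^sup>+y. f y \<partial>density lborel (indicator T))"
    using f by (subst nn_integral_density) (auto simp: mult.commute)
  also have "\<dots> = (\<integral>\<^sup>+x. f (G x) \<partial>density lborel w)"
    unfolding eq using f by (subst nn_integral_distr) auto
  also have "\<dots> = (\<integral>\<^sup>+x. w x * f (G x) \<partial>lborel)"
    using f by (subst nn_integral_density) auto
  also have "\<dots> = (\<integral>\<^sup>+x. f (g x) * ennreal \<bar>det2 (g' x)\<bar> * indicator S x \<partial>lborel)"
    by (intro nn_integral_cong) (auto simp: w_def G_def indicator_def mult.commute)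
  finally show ?thesis .
qed

section \<open>A weak divergence inequality\<close>

lemma C1_on_zero_outside:
  assumes F: "C1_on UNIV F Fu Fv" and K: "compact K" and F0: "\<And>x. x \<notin> K \<Longrightarrow> F x = 0"
    and x: "x \<notin> K"
  shows "Fu x = 0" "Fv x = 0"
proof -
  have o: "open (- K)" using K compact_imp_closed by auto
  have d: "(F has_derivative (\<lambda>h. fst h *\<^sub>R Fu x + snd h *\<^sub>R Fv x)) (at x)"
    using C1_onD(3)[OF F, of x] by simp
  have "((\<lambda>x. 0) has_derivative (\<lambda>h. fst h *\<^sub>R Fu x + snd h *\<^sub>R Fv x)) (at x)"
    by (rule has_derivative_transform_within_open[OF d o]) (use x F0 in auto)
  then have "(\<lambda>h. fst h *\<^sub>R Fu x + snd h *\<^sub>R Fv x) = (\<lambda>h. 0)"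
    using has_derivative_unique has_derivative_const by blast
  from fun_cong[OF this, of "(1,0)"] fun_cong[OF this, of "(0,1)"] show "Fu x = 0" "Fv x = 0" by simp_all
qed

text \<open>Off \<open>K\<close> the partials vanish together with the field, so bounds on the
  compact set are global. The factor 2 comes from estimating the two coordinate directions
  separately.\<close>

lemma C1_compact_bound:
  fixes F :: "real \<times> real \<Rightarrow> 'b::real_normed_vector"
  assumes F: "C1_on UNIV F Fu Fv" and K: "compact K" and F0: "\<And>x. x \<notin> K \<Longrightarrow> F x = 0"
  obtains B where "B > 0" "\<And>x. norm (Fu x) \<le> B" "\<And>x. norm (Fv x) \<le> B" "\<And>x y. norm (F x - F y) \<le> 2 * B * norm (x - y)"
proof -
  have "continuous_on K Fu" "continuous_on K Fv" using C1_onD(1,2)[OF F] continuous_on_subset by blast+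
  then have "bounded (Fu ` K)" "bounded (Fv ` K)" using K compact_continuous_image compact_imp_bounded by blast+
  then obtain B1 B2 where B: "\<And>x. x \<in> K \<Longrightarrow> norm (Fu x) \<le> B1" "\<And>x. x \<in> K \<Longrightarrow> norm (Fv x) \<le> B2"
    unfolding bounded_iff by blast
  define B where "B = max 1 (max B1 B2)"
  have b: "norm (Fu x) \<le> B \<and> norm (Fv x) \<le> B" for x
  proof (cases "x \<in> K")
    case True then show ?thesis using B[of x] by (auto simp: B_def)
  next
    case False then show ?thesis using C1_on_zero_outside[OF F K F0 False] by (auto simp: B_def)
  qed
  have "norm (F x - F y) \<le> 2 * B * norm (x - y)" for x y
  proof (rule differentiable_bound[OF convex_UNIV])
    show "(F has_derivative (\<lambda>h. fst h *\<^sub>R Fu z + snd h *\<^sub>R Fv z)) (at z within UNIV)" for z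
      using C1_onD(3)[OF F] by auto
    show "onorm (\<lambda>h. fst h *\<^sub>R Fu z + snd h *\<^sub>R Fv z) \<le> 2 * B" for z
    proof (rule onorm_bound)
      fix h :: "real \<times> real"
      have "norm (fst h *\<^sub>R Fu z + snd h *\<^sub>R Fv z) \<le> \<bar>fst h\<bar> * norm (Fu z) + \<bar>snd h\<bar> * norm (Fv z)"
        by (metis norm_triangle_ineq norm_scaleR)
      also have "\<dots> \<le> norm h * B + norm h * B"
        using b[of z] norm_fst_le[of "fst h" "snd h"] norm_snd_le[of "snd h" "fst h"]
        by (intro add_mono mult_mono) auto
      finally show "norm (fst h *\<^sub>R Fu z + snd h *\<^sub>R Fv z) \<le> 2 * B * norm h" by (simp add: algebra_simps)
    qed (simp add: B_def)
  qed auto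
  then show thesis using that[of B] b by (auto simp: B_def)
qed

text \<open>Since t L < 1, the perturbation is a contraction. This gives injectivity directly, and a
  preimage of \<open>y\<close> as the fixed point of x -> y - t F(x). Points outside
  \<open>K\<close> do not move, which forces \<open>K\<close> onto itself.\<close>

lemma perturbed_identity_homeomorphism:
  fixes F :: "real \<times> real \<Rightarrow> real \<times> real"
  assumes L: "\<And>x y. norm (F x - F y) \<le> L * norm (x - y)" and K: "compact K"
    and F0: "\<And>x. x \<notin> K \<Longrightarrow> F x = 0" and t: "0 \<le> t" "t * L < 1" and L0: "0 \<le> L"
  shows "\<exists>h. homeomorphism K K (\<lambda>x. x + t *\<^sub>R F x) h"
proof -
  define T where "T x = x + t *\<^sub>R F x" for x
  have inj: "x = y" if "T x = T y" for x y
  proof -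
    have "x - y = t *\<^sub>R (F y - F x)" using that by (simp add: T_def algebra_simps)
    then have "norm (x - y) \<le> t * (L * norm (y - x))" using L[of y x] t
      by (metis abs_of_nonneg mult_left_mono norm_scaleR)
    also have "\<dots> = (t * L) * norm (x - y)" by (simp add: norm_minus_commute)
    finally have "(1 - t * L) * norm (x - y) \<le> 0" by (simp add: algebra_simps)
    then show ?thesis using t by (simp add: mult_le_0_iff)
  qed
  have out: "T x = x" if "x \<notin> K" for x using F0[OF that] by (simp add: T_def)
  have img: "T ` K = K"
  proof
    show "T ` K \<subseteq> K" using inj out by fastforce
    show "K \<subseteq> T ` K"
    proof
      fix y assume y: "y \<in> K"
      have "\<exists>!x. y - t *\<^sub>R F x = x"
      proof (rule banach_fix_type[of "t * L"])
        show "0 \<le> t * L" "t * L < 1" using t L0 by auto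
        show "\<forall>x z. dist (y - t *\<^sub>R F x) (y - t *\<^sub>R F z) \<le> t * L * dist x z"
        proof (intro allI)
          fix x z
          have "dist (y - t *\<^sub>R F x) (y - t *\<^sub>R F z) = norm (t *\<^sub>R (F z - F x))" by (simp add: dist_norm algebra_simps)
          also have "\<dots> \<le> t * (L * norm (z - x))" using L[of z x] t by (simp add: mult_left_mono)
          finally show "dist (y - t *\<^sub>R F x) (y - t *\<^sub>R F z) \<le> t * L * dist x z" by (simp add: dist_norm norm_minus_commute)
        qed
      qed
      then obtain x where "y - t *\<^sub>R F x = x" by blast
      then have "T x = y" by (simp add: T_def algebra_simps)
      then show "y \<in> T ` K" using out y by (metis image_eqI)
    qed
  qed
  have cont: "continuous_on K T"
  proof -
    have "L-lipschitz_on UNIV F" using L L0 by (intro lipschitz_onI) (auto simp: dist_norm)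
    then have "continuous_on K F" using lipschitz_on_continuous_on continuous_on_subset by blast
    then show ?thesis unfolding T_def[abs_def] by (intro continuous_intros)
  qed
  have "\<exists>h. homeomorphism K K T h"
    by (rule homeomorphism_compact[OF K cont img]) (use inj in \<open>auto simp: inj_on_def\<close>)
  then show ?thesis by (simp add: T_def[abs_def])
qed

text \<open>Integration by parts against a merely Lipschitz \<open>\<phi>\<close>: for small \<open>t\<close> the map \<open>x \<mapsto> x + t F x\<close> is a
  bijection of \<open>K\<close>, and the divergence of \<open>F\<close> is the derivative of its Jacobian at \<open>t = 0\<close>.\<close>

lemma weak_divergence_le:
  fixes F :: "real \<times> real \<Rightarrow> real \<times> real" and \<phi> h :: "real \<times> real \<Rightarrow> real"
  assumes F: "C1_on UNIV F Fu Fv" and K: "compact K" and F0: "\<And>x. x \<notin> K \<Longrightarrow> F x = 0"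
    and \<phi>m [measurable]: "\<phi> \<in> borel_measurable borel" and \<phi>: "\<And>x. 0 \<le> \<phi> x" "\<And>x. \<phi> x \<le> 1"
    and hm [measurable]: "h \<in> borel_measurable borel" and h0: "\<And>x. 0 \<le> h x" and hM: "\<And>x. x \<in> K \<Longrightarrow> h x \<le> M"
    and lip: "\<And>t x. 0 < t \<Longrightarrow> t < t0 \<Longrightarrow> x \<in> K \<Longrightarrow> \<bar>\<phi> (x + t *\<^sub>R F x) - \<phi> x\<bar> \<le> C * t" and t0: "0 < t0"
    and slope: "\<And>x \<eta>. x \<in> K \<Longrightarrow> 0 < \<eta> \<Longrightarrow> \<exists>t1>0. \<forall>t. 0 < t \<and> t < t1 \<longrightarrow> \<phi> x - \<phi> (x + t *\<^sub>R F x) \<le> t * (h x + \<eta>)"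
  shows "(LINT x:K|lborel. \<phi> x * (fst (Fu x) + snd (Fv x))) \<le> (LINT x:K|lborel. h x)"
proof -
  obtain B where B: "B > 0" "\<And>x. norm (Fu x) \<le> B" "\<And>x. norm (Fv x) \<le> B"
     "\<And>x y. norm (F x - F y) \<le> 2 * B * norm (x - y)"
    using C1_compact_bound[OF F K F0] by blast
  define dv where "dv x = fst (Fu x) + snd (Fv x)" for x
  define D where "D x = fst (Fu x) * snd (Fv x) - snd (Fu x) * fst (Fv x)" for x
  have comp: "\<bar>fst (Fu x)\<bar> \<le> B" "\<bar>snd (Fu x)\<bar> \<le> B" "\<bar>fst (Fv x)\<bar> \<le> B" "\<bar>snd (Fv x)\<bar> \<le> B" for x
    using B(2,3)[of x] norm_fst_le[of "fst (Fu x)" "snd (Fu x)"] norm_snd_le[of "snd (Fu x)" "fst (Fu x)"]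
     norm_fst_le[of "fst (Fv x)" "snd (Fv x)"] norm_snd_le[of "snd (Fv x)" "fst (Fv x)"] by auto
  have dvb: "\<bar>dv x\<bar> \<le> 2 * B" for x using comp[of x] by (auto simp: dv_def)
  have Db: "\<bar>D x\<bar> \<le> 2 * B^2" for x
  proof -
    have "\<bar>D x\<bar> \<le> \<bar>fst (Fu x)\<bar> * \<bar>snd (Fv x)\<bar> + \<bar>snd (Fu x)\<bar> * \<bar>fst (Fv x)\<bar>"
      unfolding D_def by (metis abs_mult abs_triangle_ineq4)
    also have "\<dots> \<le> B * B + B * B" using comp[of x] B(1) by (intro add_mono mult_mono) auto
    finally show ?thesis by (simp add: power2_eq_square)
  qed
  have cont: "continuous_on UNIV Fu" "continuous_on UNIV Fv" using C1_onD(1,2)[OF F] .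
  have Fm [measurable]: "F \<in> borel_measurable borel"
    using C1_on_continuous[OF F] borel_measurable_continuous_onI by blast
  have dvm [measurable]: "dv \<in> borel_measurable borel" and Dm [measurable]: "D \<in> borel_measurable borel"
    unfolding dv_def[abs_def] D_def[abs_def] using cont by (auto intro!: borel_measurable_continuous_onI continuous_intros)
  have Kb [measurable]: "K \<in> sets borel" using K by (simp add: borel_compact)
  have Kfin: "emeasure lborel K < \<infinity>" using K emeasure_compact_finite by auto
  \<comment> \<open>For t < \<tau> both t B and (t B)^2 are at most 1/8, the summand 1 giving t <= 1
    for the second. With |dv| <= 2 B and |D| <= 2 B^2 the Jacobian then stays between 1/2 and
    2.\<close>
  define \<tau> where "\<tau> = min t0 (1 / (8 * B + 8 * B^2 + 1))"
  have \<tau>0: "0 < \<tau>" using t0 B(1) by (auto simp: \<tau>_def intro!: divide_pos_pos add_pos_pos)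
  define jac where "jac t x = 1 + t * dv x + t^2 * D x" for t x
  have small: "t * B \<le> 1/8" "t^2 * B^2 \<le> 1/8" if "0 < t" "t < \<tau>" for t
  proof -
    have p: "8 * B + 8 * B^2 + 1 > 0" using B(1) by (auto intro!: add_pos_pos)
    have "t * (8 * B + 8 * B^2 + 1) \<le> 1"
      using that p by (simp add: \<tau>_def less_divide_eq)
    then have *: "t * B * 8 + t * B^2 * 8 + t \<le> 1" by (simp add: algebra_simps)
    have n: "0 \<le> t * B * 8" "0 \<le> t * B^2 * 8" using that B(1) by auto
    show "t * B \<le> 1/8" using * n that by linarith
    have "t \<le> 1" using * n by linarith
    then have "t^2 * B^2 \<le> t * B^2" using that by (intro mult_right_mono) (auto simp: power2_eq_square mult_left_le)
    then show "t^2 * B^2 \<le> 1/8" using * n that by linarith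
  qed
  have jacb: "1/2 \<le> jac t x" "jac t x \<le> 2" if "0 < t" "t < \<tau>" for t x
  proof -
    have "\<bar>t * dv x\<bar> \<le> t * (2 * B)" using dvb[of x] that by (simp add: abs_mult mult_left_mono)
    moreover have "\<bar>t^2 * D x\<bar> \<le> t^2 * (2 * B^2)" using Db[of x] by (simp add: abs_mult mult_left_mono)
    ultimately show "1/2 \<le> jac t x" "jac t x \<le> 2" using small[OF that] unfolding jac_def by linarith+
  qed
  have jacm [measurable]: "jac t \<in> borel_measurable borel" for t unfolding jac_def[abs_def] by measurable
  have intK: "set_integrable lborel K f" if "f \<in> borel_measurable borel" "\<And>x. x \<in> K \<Longrightarrow> \<bar>f x\<bar> \<le> c" for f :: "real\<times>real \<Rightarrow> real" and c
    unfolding set_integrable_def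
    by (rule integrableI_bounded_set_indicator[where B=c]) (use that Kfin in auto)
  have to_nn: "(\<integral>\<^sup>+x. ennreal (f x) * indicator K x \<partial>lborel) = ennreal (LINT x:K|lborel. f x)"
    if "f \<in> borel_measurable borel" "\<And>x. x \<in> K \<Longrightarrow> \<bar>f x\<bar> \<le> c" "\<And>x. 0 \<le> f x" for f :: "real\<times>real \<Rightarrow> real" and c
  proof -
    have "(\<integral>\<^sup>+x. ennreal (f x) * indicator K x \<partial>lborel) = (\<integral>\<^sup>+x. ennreal (indicator K x *\<^sub>R f x) \<partial>lborel)"
      by (intro nn_integral_cong) (auto simp: indicator_def)
    also have "\<dots> = ennreal (LINT x:K|lborel. f x)"
      unfolding set_lebesgue_integral_def
      by (rule nn_integral_eq_integral) (use intK[OF that(1,2)] that(3) in \<open>auto simp: set_integrable_def\<close>)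
    finally show ?thesis .
  qed
  \<comment> \<open>Substitution by x + t F(x), a bijection of \<open>K\<close> with Jacobian
    determinant \<open>jac t\<close>: the right-hand integral does not depend on \<open>t\<close>.
    Differentiating this at t = 0 would be integration by parts; here only difference quotients are
    available.\<close>
  have cov: "(LINT x:K|lborel. \<phi> x) = (LINT x:K|lborel. \<phi> (x + t *\<^sub>R F x) * jac t x)" if t: "0 < t" "t < \<tau>" for t
  proof -
    have "\<exists>k. homeomorphism K K (\<lambda>x. x + t *\<^sub>R F x) k"
      by (rule perturbed_identity_homeomorphism[OF B(4) K F0]) (use t small[OF t] B(1) in auto)
    then obtain k where k: "homeomorphism K K (\<lambda>x. x + t *\<^sub>R F x) k" by blast
    define T' where "T' x = (\<lambda>h::real\<times>real. h + t *\<^sub>R (fst h *\<^sub>R Fu x + snd h *\<^sub>R Fv x))" for x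
    have det: "det2 (T' x) = jac t x" for x
      by (simp add: det2_def T'_def jac_def dv_def D_def power2_eq_square algebra_simps)
    have "(\<integral>\<^sup>+y. ennreal (\<phi> y) * indicator K y \<partial>lborel)
       = (\<integral>\<^sup>+x. ennreal (\<phi> (x + t *\<^sub>R F x)) * ennreal \<bar>det2 (T' x)\<bar> * indicator K x \<partial>lborel)"
    proof (rule nn_integral_change_of_variables[OF k Kb Kb])
      show "((\<lambda>x. x + t *\<^sub>R F x) has_derivative T' x) (at x within K)" for x
        unfolding T'_def using has_derivative_subset[OF C1_onD(3)[OF F, of x]]
        by (auto intro!: derivative_eq_intros)
      show "continuous_on K (\<lambda>x. det2 (T' x))"
        unfolding det jac_def dv_def D_def using cont
        by (auto intro!: continuous_intros intro: continuous_on_subset)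
      show "(\<lambda>x. ennreal (\<phi> x)) \<in> borel_measurable borel" by measurable
    qed
    also have "\<dots> = (\<integral>\<^sup>+x. ennreal (\<phi> (x + t *\<^sub>R F x) * jac t x) * indicator K x \<partial>lborel)"
    proof (intro nn_integral_cong)
      fix x
      have "\<bar>det2 (T' x)\<bar> = jac t x" using jacb(1)[OF t, of x] det by auto
      then show "ennreal (\<phi> (x + t *\<^sub>R F x)) * ennreal \<bar>det2 (T' x)\<bar> * indicator K x
         = ennreal (\<phi> (x + t *\<^sub>R F x) * jac t x) * indicator K x"
        using jacb(1)[OF t, of x] \<phi> by (simp add: ennreal_mult)
    qed
    finally have e: "(\<integral>\<^sup>+y. ennreal (\<phi> y) * indicator K y \<partial>lborel) = \<dots>" .
    have pos: "0 \<le> \<phi> (x + t *\<^sub>R F x) * jac t x" for x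
      using jacb(1)[OF t, of x] \<phi>[of "x + t *\<^sub>R F x"] by auto
    have 1: "(\<integral>\<^sup>+y. ennreal (\<phi> y) * indicator K y \<partial>lborel) = ennreal (LINT x:K|lborel. \<phi> x)"
      by (rule to_nn[where c=1]) (use \<phi> in auto)
    have 2: "(\<integral>\<^sup>+x. ennreal (\<phi> (x + t *\<^sub>R F x) * jac t x) * indicator K x \<partial>lborel) = ennreal (LINT x:K|lborel. \<phi> (x + t *\<^sub>R F x) * jac t x)"
    proof (rule to_nn[where c=2])
      show "\<bar>\<phi> (x + t *\<^sub>R F x) * jac t x\<bar> \<le> 2" for x
        using jacb[OF t, of x] \<phi>[of "x + t *\<^sub>R F x"] mult_mono[of "\<phi> (x + t *\<^sub>R F x)" 1 "jac t x" 2] by (auto simp: abs_mult)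
      show "0 \<le> \<phi> (x + t *\<^sub>R F x) * jac t x" for x by (rule pos)
    qed measurable
    have nn: "0 \<le> (LINT x:K|lborel. \<phi> x)" "0 \<le> (LINT x:K|lborel. \<phi> (x + t *\<^sub>R F x) * jac t x)"
      unfolding set_lebesgue_integral_def by (auto intro!: integral_nonneg simp: \<phi> pos)
    show ?thesis using e 1 2 nn by simp
  qed
  define tn where "tn n = \<tau> / (real n + 2)" for n
  have tn: "0 < tn n" "tn n < \<tau>" for n
    using \<tau>0 by (auto simp: tn_def divide_less_eq)
  have tn_lim: "tn \<longlonglongrightarrow> 0" unfolding tn_def by real_asymp
  define q where "q n x = (\<phi> x - \<phi> (x + tn n *\<^sub>R F x)) / tn n * jac (tn n) x" for n x
  \<comment> \<open>The slope hypothesis bounds the quotients \<open>q n\<close> from above in the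
    limit but does not make them converge. Their excess over \<open>h\<close> does tend to 0 and is
    dominated by 2 C, so dominated convergence is applied to the excess alone.\<close>
  define e where "e n x = max 0 (q n x - h x)" for n x
  have qm [measurable]: "q n \<in> borel_measurable borel" for n unfolding q_def[abs_def] by measurable
  have em [measurable]: "e n \<in> borel_measurable borel" for n unfolding e_def[abs_def] by measurable
  have tn_t0: "tn n < t0" for n using tn[of n] by (auto simp: \<tau>_def)
  have C0: "0 \<le> C" if "x \<in> K" for x
  proof -
    have "0 \<le> C * tn 0" using lip[OF tn(1) tn_t0 that, of 0] by linarith
    then show ?thesis using tn(1)[of 0] by (simp add: zero_le_mult_iff)
  qed
  have qb: "\<bar>q n x\<bar> \<le> 2 * C" if "x \<in> K" for n x
  proof -
    have "\<bar>q n x\<bar> = \<bar>\<phi> (x + tn n *\<^sub>R F x) - \<phi> x\<bar> / tn n * jac (tn n) x"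
      using tn(1)[of n] jacb(1)[OF tn, of n x] by (simp add: q_def abs_mult abs_minus_commute)
    also have "\<dots> \<le> C * 2"
      using lip[OF tn(1) tn_t0 that, of n] tn(1)[of n] jacb[OF tn, of n x] C0[OF that]
      by (intro mult_mono) (auto simp: divide_le_eq)
    finally show ?thesis by simp
  qed
  have eb: "\<bar>e n x\<bar> \<le> 2 * C" if "x \<in> K" for n x
    using qb[OF that, of n] h0[of x] C0[OF that] by (auto simp: e_def)
  have e_lim: "(\<lambda>n. e n x) \<longlonglongrightarrow> 0" if x: "x \<in> K" for x
  proof (rule LIMSEQ_I)
    fix r :: real assume r: "0 < r"
    obtain t1 where t1: "t1 > 0" "\<And>t. 0 < t \<Longrightarrow> t < t1 \<Longrightarrow> \<phi> x - \<phi> (x + t *\<^sub>R F x) \<le> t * (h x + r / 8)"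
      using slope[OF x, of "r/8"] r by auto
    have "(\<lambda>n. jac (tn n) x) \<longlonglongrightarrow> 1 + 0 * dv x + 0^2 * D x"
      unfolding jac_def by (intro tendsto_intros tn_lim)
    then have "(\<lambda>n. h x * (jac (tn n) x - 1)) \<longlonglongrightarrow> h x * (1 + 0 * dv x + 0^2 * D x - 1)" by (intro tendsto_intros)
    then have "(\<lambda>n. h x * (jac (tn n) x - 1)) \<longlonglongrightarrow> 0" by simp
    then have "\<forall>\<^sub>F n in sequentially. h x * (jac (tn n) x - 1) < r / 2"
      by (rule order_tendstoD) (use r in auto)
    moreover have "\<forall>\<^sub>F n in sequentially. tn n < t1" by (rule order_tendstoD(2)[OF tn_lim t1(1)])
    ultimately have "\<forall>\<^sub>F n in sequentially. norm (e n x - 0) < r"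
    proof eventually_elim
      fix n assume a: "h x * (jac (tn n) x - 1) < r / 2" "tn n < t1"
      have "(\<phi> x - \<phi> (x + tn n *\<^sub>R F x)) / tn n \<le> h x + r / 8"
        using t1(2)[OF tn(1) a(2)] tn(1)[of n] by (simp add: divide_le_eq mult.commute)
      then have "q n x \<le> (h x + r / 8) * jac (tn n) x"
        unfolding q_def using jacb(1)[OF tn, of n x] by (intro mult_right_mono) auto
      also have "\<dots> = h x + h x * (jac (tn n) x - 1) + r / 8 * jac (tn n) x" by (simp add: algebra_simps)
      also have "r / 8 * jac (tn n) x \<le> r / 8 * 2" using jacb(2)[OF tn, of n x] r by (intro mult_left_mono) auto
      finally have "q n x - h x < r" using a(1) r by linarith
      then show "norm (e n x - 0) < r" using r by (auto simp: e_def)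
    qed
    then show "\<exists>no. \<forall>n\<ge>no. norm (e n x - 0) < r" by (simp add: eventually_sequentially)
  qed
  have int_e: "(\<lambda>n. LINT x:K|lborel. e n x) \<longlonglongrightarrow> 0"
  proof -
    have "(\<lambda>n. LINT x|lborel. indicator K x *\<^sub>R e n x) \<longlonglongrightarrow> (LINT x|(lborel :: (real\<times>real) measure). 0)"
    proof (rule integral_dominated_convergence[where w="\<lambda>x. indicator K x *\<^sub>R (2 * C)"])
      show "integrable lborel (\<lambda>x. indicator K x *\<^sub>R (2 * C))"
        using intK[of "\<lambda>x. 2 * C" "\<bar>2 * C\<bar>"] by (simp add: set_integrable_def)
      show "AE x in lborel. (\<lambda>n. indicator K x *\<^sub>R e n x) \<longlonglongrightarrow> 0"
        using e_lim by (intro AE_I2) (auto simp: indicator_def)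
      show "AE x in lborel. norm (indicator K x *\<^sub>R e n x) \<le> indicator K x *\<^sub>R (2 * C)" for n
        using eb by (intro AE_I2) (auto simp: indicator_def)
    qed measurable
    then show ?thesis by (simp add: set_lebesgue_integral_def)
  qed
  have key: "(LINT x:K|lborel. \<phi> x * dv x) \<le> (LINT x:K|lborel. h x) + (LINT x:K|lborel. e n x) - tn n * (LINT x:K|lborel. \<phi> x * D x)" for n
  proof -
    define t where "t = tn n"
    have t: "0 < t" "t < \<tau>" using tn by (auto simp: t_def)
    have i1: "set_integrable lborel K \<phi>" by (rule intK[where c=1]) (use \<phi> in auto)
    have i2: "set_integrable lborel K (\<lambda>x. \<phi> (x + t *\<^sub>R F x) * jac t x)"
    proof (rule intK[where c=2])
      show "\<bar>\<phi> (x + t *\<^sub>R F x) * jac t x\<bar> \<le> 2" for x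
        using jacb[OF t, of x] \<phi>[of "x + t *\<^sub>R F x"] mult_mono[of "\<phi> (x + t *\<^sub>R F x)" 1 "jac t x" 2] by (auto simp: abs_mult)
    qed measurable
    have i3: "set_integrable lborel K (q n)" by (rule intK[OF _ qb]) auto
    have i4: "set_integrable lborel K (\<lambda>x. \<phi> x * D x)"
    proof (rule intK[where c="2 * B^2"])
      show "\<bar>\<phi> x * D x\<bar> \<le> 2 * B^2" for x
        using \<phi>[of x] Db[of x] mult_mono[of "\<phi> x" 1 "\<bar>D x\<bar>" "2 * B^2"] by (auto simp: abs_mult)
    qed measurable
    have i5: "set_integrable lborel K h" by (rule intK[where c=M]) (use h0 hM in auto)
    have i6: "set_integrable lborel K (e n)" by (rule intK[OF _ eb]) auto
    \<comment> \<open>After expanding \<open>jac\<close>, the first quotient has integral 0 by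
      \<open>cov\<close>, \<open>q n\<close> is the term to be estimated, and the last term is of
      order \<open>t\<close>.\<close>
    have pt: "\<phi> x * dv x = (\<phi> (x + t *\<^sub>R F x) * jac t x - \<phi> x) / t + q n x - t * (\<phi> x * D x)" for x
      using t unfolding q_def jac_def t_def[symmetric] by (simp add: field_simps power2_eq_square)
    have "(LINT x:K|lborel. \<phi> x * dv x) = (LINT x:K|lborel. (\<phi> (x + t *\<^sub>R F x) * jac t x - \<phi> x) / t + q n x - t * (\<phi> x * D x))"
      by (simp add: pt)
    also have "\<dots> = ((LINT x:K|lborel. \<phi> (x + t *\<^sub>R F x) * jac t x) - (LINT x:K|lborel. \<phi> x)) / t + (LINT x:K|lborel. q n x) - t * (LINT x:K|lborel. \<phi> x * D x)"
      using i1 i2 i3 i4 by (simp add: set_integral_diff set_integral_add)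
    also have "\<dots> = (LINT x:K|lborel. q n x) - t * (LINT x:K|lborel. \<phi> x * D x)" using cov[OF t] by simp
    also have "(LINT x:K|lborel. q n x) \<le> (LINT x:K|lborel. h x + e n x)"
      by (rule set_integral_mono[OF i3 set_integral_add(1)[OF i5 i6]]) (auto simp: e_def)
    also have "\<dots> = (LINT x:K|lborel. h x) + (LINT x:K|lborel. e n x)" using i5 i6 by (simp add: set_integral_add)
    finally show ?thesis by (simp add: t_def)
  qed
  have "(\<lambda>n. (LINT x:K|lborel. h x) + (LINT x:K|lborel. e n x) - tn n * (LINT x:K|lborel. \<phi> x * D x)) \<longlonglongrightarrow>
     (LINT x:K|lborel. h x) + 0 - 0 * (LINT x:K|lborel. \<phi> x * D x)"
    by (intro tendsto_intros int_e tn_lim)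
  then have "(LINT x:K|lborel. \<phi> x * dv x) \<le> (LINT x:K|lborel. h x) + 0 - 0 * (LINT x:K|lborel. \<phi> x * D x)"
    by (rule LIMSEQ_le_const) (use key in auto)
  then show ?thesis by (simp add: dv_def)
qed

section \<open>Local geometry of the surface\<close>

lemma bounded_bilinear_cross3: "bounded_bilinear cross3"
  using bilinear_cross bilinear_conv_bounded_bilinear by blast

text \<open>Crossing with \<open>n\<close> is the quarter turn of the plane of \<open>f1\<close> and
  \<open>f2\<close>. Doing it twice removes the normal part and reverses the tangential part, which
  yields the expansion of \<open>v\<close>.\<close>

lemma orthonormal_cross_expansion:
  assumes "f1 \<bullet> f1 = 1" "f2 \<bullet> f2 = 1" "f1 \<bullet> f2 = 0"
  defines "n \<equiv> cross3 f1 f2"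
  shows "cross3 n v = (f1 \<bullet> v) *\<^sub>R f2 - (f2 \<bullet> v) *\<^sub>R f1" "n \<bullet> n = 1" "n \<bullet> f1 = 0" "n \<bullet> f2 = 0"
    "v = (v \<bullet> f1) *\<^sub>R f1 + (v \<bullet> f2) *\<^sub>R f2 + (v \<bullet> n) *\<^sub>R n"
proof -
  show 1: "cross3 n v = (f1 \<bullet> v) *\<^sub>R f2 - (f2 \<bullet> v) *\<^sub>R f1" for v
    unfolding n_def by (simp add: cross3_simps forall_3)
  show "n \<bullet> f1 = 0" "n \<bullet> f2 = 0" by (simp_all add: n_def dot_cross_self inner_commute)
  show n: "n \<bullet> n = 1"
    using norm_cross_dot[of f1 f2] assms by (simp add: power2_norm_eq_inner power_mult_distrib)
  have "cross3 n (cross3 n v) = (n \<bullet> v) *\<^sub>R n - v"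
    using n by (simp add: cross_triple Lagrange)
  moreover have "cross3 n (cross3 n v) = - ((f1 \<bullet> v) *\<^sub>R f1) - (f2 \<bullet> v) *\<^sub>R f2"
    unfolding 1[of v] using assms(1-3) 
    by (simp add: right_diff_distrib cross_mult_right 1 inner_commute inner_diff_right)
  ultimately show "v = (v \<bullet> f1) *\<^sub>R f1 + (v \<bullet> f2) *\<^sub>R f2 + (v \<bullet> n) *\<^sub>R n"
    by (simp add: algebra_simps inner_commute)
qed

text \<open>With \<open>U\<close>, \<open>V\<close> the partials of \<open>X\<close> and
  \<open>M\<close>, \<open>W\<close> those of the normal, the last bracket is the trace of the shape
  operator times X_u x X_v. It is alternating in the two coordinate directions, so a change of
  coordinates only multiplies it by the Jacobian. This carries minimality from the chosen chart to
  every chart.\<close>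

lemma cross_sum_change_basis:
  "cross3 (a1 *\<^sub>R M + a2 *\<^sub>R W) (b1 *\<^sub>R U + b2 *\<^sub>R V) + cross3 (a1 *\<^sub>R U + a2 *\<^sub>R V) (b1 *\<^sub>R M + b2 *\<^sub>R W)
     = (a1 * b2 - a2 * b1) *\<^sub>R (cross3 M V + cross3 U W)"
  by (simp add: cross3_simps forall_3)

lemma C1_on_sgn:
  fixes f :: "real \<times> real \<Rightarrow> 'b::real_inner"
  assumes f: "C1_on S f fu fv" and nz: "\<And>x. x \<in> S \<Longrightarrow> f x \<noteq> 0"
  obtains gu gv where "C1_on S (\<lambda>x. sgn (f x)) gu gv"
proof -
  have 1: "C1_on S (\<lambda>x. f x \<bullet> f x) (\<lambda>x. f x \<bullet> fu x + fu x \<bullet> f x) (\<lambda>x. f x \<bullet> fv x + fv x \<bullet> f x)"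
    by (rule C1_on_bilinear[OF bounded_bilinear_inner f f])
  have der: "((\<lambda>y. inverse (sqrt y)) has_real_derivative - (inverse (sqrt y) / (2 * y))) (at y)" if "y \<in> {0<..}" for y
    using that by (auto intro!: derivative_eq_intros simp: divide_simps power2_eq_square)
  have 2: "C1_on S (\<lambda>x. inverse (sqrt (f x \<bullet> f x))) (\<lambda>x. - (inverse (sqrt (f x \<bullet> f x)) / (2 * (f x \<bullet> f x))) * (f x \<bullet> fu x + fu x \<bullet> f x))
     (\<lambda>x. - (inverse (sqrt (f x \<bullet> f x)) / (2 * (f x \<bullet> f x))) * (f x \<bullet> fv x + fv x \<bullet> f x))"
    by (rule C1_on_real_comp[OF 1 _ der, where D="{0<..}"]) (use nz in \<open>auto intro!: continuous_intros\<close>)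
  have eq: "sgn (f x) = inverse (sqrt (f x \<bullet> f x)) *\<^sub>R f x" for x
    by (simp add: sgn_div_norm norm_eq_sqrt_inner)
  show thesis
    by (rule that, rule C1_on_cong[OF C1_on_bilinear[OF bounded_bilinear_scaleR 2 f] eq refl refl])
qed

abbreviation param :: "'a chart \<Rightarrow> real \<times> real \<Rightarrow> 'a" where
  "param c \<equiv> inv_into (fst c) (snd c)"

definition C1_fun :: "'a chart set \<Rightarrow> ('a \<Rightarrow> 'b::real_normed_vector) \<Rightarrow> bool" where
  "C1_fun A f \<longleftrightarrow> (\<forall>c\<in>A. C1_on (chart_image c) (local_rep c f) (partial_u (local_rep c f)) (partial_v (local_rep c f)))"

section \<open>Charts, transition maps and the unit normal\<close>

locale surface =
  fixes A :: "'a::{t2_space, second_countable_topology} chart set" and X :: "'a \<Rightarrow> real^3"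
  assumes atlas: "smooth_atlas A" and oriented: "oriented_atlas A" and immersed: "immersion A X"
begin

lemma chart_facts:
  assumes "c \<in> A"
  shows "open (fst c)" "openin (top_of_set half_plane) (chart_image c)"
    "homeomorphism (fst c) (chart_image c) (snd c) (param c)"
    "chart_image c \<subseteq> half_plane"
proof -
  show 1: "open (fst c)" "openin (top_of_set half_plane) (chart_image c)"
    "homeomorphism (fst c) (chart_image c) (snd c) (param c)"
    using assms atlas by (auto simp: smooth_atlas_def is_chart_def)
  show "chart_image c \<subseteq> half_plane" using 1(2) openin_imp_subset by blast
qed

lemma param_in: "c \<in> A \<Longrightarrow> x \<in> chart_image c \<Longrightarrow> param c x \<in> fst c"
  and coord_param [simp]: "c \<in> A \<Longrightarrow> x \<in> chart_image c \<Longrightarrow> snd c (param c x) = x"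
  and param_coord [simp]: "c \<in> A \<Longrightarrow> p \<in> fst c \<Longrightarrow> param c (snd c p) = p"
  and coord_in: "c \<in> A \<Longrightarrow> p \<in> fst c \<Longrightarrow> snd c p \<in> chart_image c"
  using chart_facts(3)[of c] unfolding homeomorphism_def by auto

lemma local_rep_coord: "c \<in> A \<Longrightarrow> p \<in> fst c \<Longrightarrow> local_rep c f (snd c p) = f p"
  by (simp add: local_rep_def)

lemma chart_at: "chart_at A p \<in> A" "p \<in> fst (chart_at A p)"
proof -
  have "\<exists>c. c \<in> A \<and> p \<in> fst c" using atlas unfolding smooth_atlas_def by blast
  from someI_ex[OF this] show "chart_at A p \<in> A" "p \<in> fst (chart_at A p)" by (auto simp: chart_at_def)
qed

lemma openin_coord_image:
  assumes c: "c \<in> A" and U: "open U"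
  shows "openin (top_of_set half_plane) (snd c ` (fst c \<inter> U))"
proof -
  have "openin (top_of_set (chart_image c)) (snd c ` (fst c \<inter> U))"
    by (rule homeomorphism_imp_open_map[OF chart_facts(3)[OF c]]) (use U in \<open>auto intro: openin_open_Int\<close>)
  then show ?thesis using chart_facts(2)[OF c] openin_trans by blast
qed

lemma open_param_image:
  assumes c: "c \<in> A" and U: "open U"
  shows "open (param c ` (chart_image c \<inter> U))"
proof -
  have "openin (top_of_set (fst c)) (param c ` (chart_image c \<inter> U))"
    by (rule homeomorphism_imp_open_map[OF homeomorphism_symD[OF chart_facts(3)[OF c]]]) (use U in \<open>auto intro: openin_open_Int\<close>)
  then show ?thesis using chart_facts(1)[OF c] openin_open_eq by blast
qed

definition trans :: "'a chart \<Rightarrow> 'a chart \<Rightarrow> real \<times> real \<Rightarrow> real \<times> real" where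
  "trans c d = local_rep c (snd d)"

definition overlap :: "'a chart \<Rightarrow> 'a chart \<Rightarrow> (real \<times> real) set" where
  "overlap c d = snd c ` (fst c \<inter> fst d)"

lemma overlap:
  assumes "c \<in> A" "d \<in> A"
  shows "openin (top_of_set half_plane) (overlap c d)" "overlap c d \<subseteq> chart_image c"
    "C1_on (overlap c d) (trans c d) (partial_u (trans c d)) (partial_v (trans c d))"
    "\<And>x. x \<in> overlap c d \<Longrightarrow> trans c d x \<in> overlap d c"
    "\<And>x f. x \<in> overlap c d \<Longrightarrow> local_rep c f x = local_rep d f (trans c d x)"
    "\<And>x. x \<in> overlap c d \<Longrightarrow> param d (trans c d x) = param c x"
    "\<And>x. x \<in> overlap c d \<Longrightarrow> fst (partial_u (trans c d) x) * snd (partial_v (trans c d) x)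
         - snd (partial_u (trans c d) x) * fst (partial_v (trans c d) x) > 0"
proof -
  show o: "openin (top_of_set half_plane) (overlap c d)"
    unfolding overlap_def by (rule openin_coord_image[OF assms(1) chart_facts(1)[OF assms(2)]])
  show "overlap c d \<subseteq> chart_image c" by (auto simp: overlap_def chart_image_def)
  have "smooth_map_on (overlap c d) (trans c d)"
    using atlas assms unfolding smooth_atlas_def overlap_def trans_def by blast
  from smooth_C1[OF o this] show "C1_on (overlap c d) (trans c d) (partial_u (trans c d)) (partial_v (trans c d))" .
  show "\<And>x. x \<in> overlap c d \<Longrightarrow> trans c d x \<in> overlap d c"
    using assms by (auto simp: overlap_def trans_def local_rep_def)
  show "\<And>x f. x \<in> overlap c d \<Longrightarrow> local_rep c f x = local_rep d f (trans c d x)"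
    using assms by (auto simp: overlap_def trans_def local_rep_def)
  show "\<And>x. x \<in> overlap c d \<Longrightarrow> param d (trans c d x) = param c x"
    using assms by (auto simp: overlap_def trans_def local_rep_def)
  show "\<And>x. x \<in> overlap c d \<Longrightarrow> fst (partial_u (trans c d) x) * snd (partial_v (trans c d) x)
         - snd (partial_u (trans c d) x) * fst (partial_v (trans c d) x) > 0"
    using oriented assms unfolding oriented_atlas_def overlap_def trans_def Let_def by blast
qed

lemma C1_funD:
  assumes "C1_fun A f" "c \<in> A"
  shows "C1_on (chart_image c) (local_rep c f) (partial_u (local_rep c f)) (partial_v (local_rep c f))"
  using assms by (auto simp: C1_fun_def)

lemma C1_funI:
  assumes "\<And>c. c \<in> A \<Longrightarrow> \<exists>fu fv. C1_on (chart_image c) (local_rep c f) fu fv"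
  shows "C1_fun A f"
  unfolding C1_fun_def
proof
  fix c assume c: "c \<in> A"
  then obtain fu fv where f: "C1_on (chart_image c) (local_rep c f) fu fv" using assms by blast
  show "C1_on (chart_image c) (local_rep c f) (partial_u (local_rep c f)) (partial_v (local_rep c f))"
    by (rule C1_on_cong[OF f refl]) (use partial_eqI[OF chart_facts(2)[OF c] f] in auto)
qed

lemma smooth_fun_C1: "smooth_fun A f \<Longrightarrow> C1_fun A f"
  unfolding smooth_fun_def C1_fun_def using chart_facts(2) smooth_C1 by blast

lemma C1_X: "C1_fun A X"
  using immersed smooth_fun_C1 by (auto simp: immersion_def)

lemma partial_trans:
  assumes f: "C1_fun A f" and cd: "c \<in> A" "d \<in> A" and x: "x \<in> overlap c d"
  shows "partial_u (local_rep c f) x = fst (partial_u (trans c d) x) *\<^sub>R partial_u (local_rep d f) (trans c d x)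
           + snd (partial_u (trans c d) x) *\<^sub>R partial_v (local_rep d f) (trans c d x)"
    "partial_v (local_rep c f) x = fst (partial_v (trans c d) x) *\<^sub>R partial_u (local_rep d f) (trans c d x)
           + snd (partial_v (trans c d) x) *\<^sub>R partial_v (local_rep d f) (trans c d x)"
proof -
  have img: "trans c d ` overlap c d \<subseteq> chart_image d" using overlap(2,4) cd by blast
  have 1: "C1_on (overlap c d) (local_rep c f)
     (\<lambda>x. fst (partial_u (trans c d) x) *\<^sub>R partial_u (local_rep d f) (trans c d x) + snd (partial_u (trans c d) x) *\<^sub>R partial_v (local_rep d f) (trans c d x))
     (\<lambda>x. fst (partial_v (trans c d) x) *\<^sub>R partial_u (local_rep d f) (trans c d x) + snd (partial_v (trans c d) x) *\<^sub>R partial_v (local_rep d f) (trans c d x))"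
    by (rule C1_on_cong[OF C1_on_chain[OF overlap(3)[OF cd] C1_funD[OF f cd(2)] img]]) (use overlap(5)[OF cd] in auto)
  show "partial_u (local_rep c f) x = fst (partial_u (trans c d) x) *\<^sub>R partial_u (local_rep d f) (trans c d x)
           + snd (partial_u (trans c d) x) *\<^sub>R partial_v (local_rep d f) (trans c d x)"
    "partial_v (local_rep c f) x = fst (partial_v (trans c d) x) *\<^sub>R partial_u (local_rep d f) (trans c d x)
           + snd (partial_v (trans c d) x) *\<^sub>R partial_v (local_rep d f) (trans c d x)"
    using partial_eqI(1,2)[OF overlap(1)[OF cd] 1 x] by auto
qed

lemma coord_diff_eq:
  assumes "C1_fun A f"
  shows "coord_diff A f p = (\<lambda>h. fst h *\<^sub>R partial_u (local_rep (chart_at A p) f) (snd (chart_at A p) p)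
     + snd h *\<^sub>R partial_v (local_rep (chart_at A p) f) (snd (chart_at A p) p))"
  unfolding coord_diff_def Let_def
  by (rule partial_eqI(3)[OF chart_facts(2)[OF chart_at(1)] C1_funD[OF assms chart_at(1)] coord_in[OF chart_at]])

definition Xu where "Xu c = partial_u (local_rep c X)"
definition Xv where "Xv c = partial_v (local_rep c X)"
definition nrm where "nrm c x = cross3 (Xu c x) (Xv c x)"
definition jac where "jac c d x = fst (partial_u (trans c d) x) * snd (partial_v (trans c d) x)
         - snd (partial_u (trans c d) x) * fst (partial_v (trans c d) x)"

lemma C1_Xu: "c \<in> A \<Longrightarrow> C1_on (chart_image c) (Xu c) (partial_u (Xu c)) (partial_v (Xu c))"
  and C1_Xv: "c \<in> A \<Longrightarrow> C1_on (chart_image c) (Xv c) (partial_u (Xv c)) (partial_v (Xv c))"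
  using immersed chart_facts(2) smooth_partial smooth_C1
  unfolding immersion_def smooth_fun_def Xu_def Xv_def by blast+

lemma C1_Xc: "c \<in> A \<Longrightarrow> C1_on (chart_image c) (local_rep c X) (Xu c) (Xv c)"
  unfolding Xu_def Xv_def by (rule C1_funD[OF C1_X])

text \<open>In an oriented atlas the factor is positive: the direction of the vector is the same in
  all charts, while its norm transforms as a density for area.\<close>

lemma nrm_trans:
  assumes cd: "c \<in> A" "d \<in> A" and x: "x \<in> overlap c d"
  shows "nrm c x = jac c d x *\<^sub>R nrm d (trans c d x)"
  unfolding nrm_def Xu_def Xv_def partial_trans[OF C1_X cd x] jac_def
  by (simp add: cross_add_left cross_add_right cross_mult_left cross_mult_right algebra_simps
      cross_skew[of "partial_v (local_rep d X) (trans c d x)" "partial_u (local_rep d X) (trans c d x)"])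

text \<open>\<open>immersion\<close> speaks about the chosen chart only, where injectivity of the
  differential excludes parallel partials. Other charts follow from the transformation rule, in
  \<open>nrm_nonzero\<close>.\<close>

lemma nrm_chart_at_nonzero: "nrm (chart_at A p) (snd (chart_at A p) p) \<noteq> 0"
proof
  let ?a = "Xu (chart_at A p) (snd (chart_at A p) p)" and ?b = "Xv (chart_at A p) (snd (chart_at A p) p)"
  assume "nrm (chart_at A p) (snd (chart_at A p) p) = 0"
  then have "collinear {0, ?a, ?b}" by (simp add: nrm_def cross_eq_0)
  then obtain k where k: "?a = 0 \<or> ?b = 0 \<or> ?b = k *\<^sub>R ?a" unfolding collinear_lemma by blast
  have eq: "coord_diff A X p = (\<lambda>h. fst h *\<^sub>R ?a + snd h *\<^sub>R ?b)"
    unfolding coord_diff_eq[OF C1_X] Xu_def Xv_def ..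
  have inj: "inj (coord_diff A X p)" using immersed by (auto simp: immersion_def)
  have "coord_diff A X p (1,0) = coord_diff A X p (0,0) \<or> coord_diff A X p (0,1) = coord_diff A X p (0,0) \<or> coord_diff A X p (0,1) = coord_diff A X p (k,0)"
    using k unfolding eq by auto
  then show False using inj unfolding inj_def by fastforce
qed

lemma nrm_nonzero:
  assumes c: "c \<in> A" and x: "x \<in> chart_image c"
  shows "nrm c x \<noteq> 0"
proof -
  define p where "p = param c x"
  have p: "p \<in> fst c" "snd c p = x" using param_in[OF c x] c x by (auto simp: p_def)
  have xo: "x \<in> overlap c (chart_at A p)" unfolding overlap_def using p chart_at(2)[of p] by blast
  have "trans c (chart_at A p) x = snd (chart_at A p) p" by (simp add: trans_def local_rep_def p_def)
  then have "nrm c x = jac c (chart_at A p) x *\<^sub>R nrm (chart_at A p) (snd (chart_at A p) p)"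
    using nrm_trans[OF c chart_at(1) xo] by simp
  moreover have "jac c (chart_at A p) x > 0" using overlap(7)[OF c chart_at(1) xo] by (simp add: jac_def)
  ultimately show ?thesis using nrm_chart_at_nonzero by simp
qed

lemma unit_normal_chart:
  assumes c: "c \<in> A" and x: "x \<in> chart_image c"
  shows "unit_normal A X (param c x) = sgn (nrm c x)"
proof -
  define p where "p = param c x"
  have p: "p \<in> fst c" "snd c p = x" using param_in[OF c x] c x by (auto simp: p_def)
  have xo: "x \<in> overlap c (chart_at A p)" unfolding overlap_def using p chart_at(2)[of p] by blast
  have "trans c (chart_at A p) x = snd (chart_at A p) p" by (simp add: trans_def local_rep_def p_def)
  then have "nrm c x = jac c (chart_at A p) x *\<^sub>R nrm (chart_at A p) (snd (chart_at A p) p)"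
    using nrm_trans[OF c chart_at(1) xo] by simp
  moreover have "jac c (chart_at A p) x > 0" using overlap(7)[OF c chart_at(1) xo] by (simp add: jac_def)
  ultimately have "sgn (nrm c x) = sgn (nrm (chart_at A p) (snd (chart_at A p) p))" by (simp add: sgn_scaleR)
  then show ?thesis
    unfolding unit_normal_def p_def[symmetric] coord_diff_eq[OF C1_X] by (simp add: nrm_def Xu_def Xv_def)
qed

abbreviation N where "N \<equiv> unit_normal A X"

lemma norm_N: "N p \<bullet> N p = 1"
proof -
  have "N p = sgn (nrm (chart_at A p) (snd (chart_at A p) p))"
    using unit_normal_chart[OF chart_at(1) coord_in[OF chart_at]] chart_at by simp
  then show ?thesis using nrm_chart_at_nonzero by (simp add: norm_sgn flip: power2_norm_eq_inner)
qed

lemma C1_nrm: "c \<in> A \<Longrightarrow> \<exists>u v. C1_on (chart_image c) (nrm c) u v"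
  unfolding nrm_def[abs_def] using C1_on_bilinear[OF bounded_bilinear_cross3 C1_Xu C1_Xv] by blast

lemma C1_N: "C1_fun A N"
proof (rule C1_funI)
  fix c assume c: "c \<in> A"
  obtain u v where "C1_on (chart_image c) (nrm c) u v" using C1_nrm[OF c] by blast
  from C1_on_sgn[OF this nrm_nonzero[OF c]] obtain gu gv where "C1_on (chart_image c) (\<lambda>x. sgn (nrm c x)) gu gv" by blast
  then have "C1_on (chart_image c) (local_rep c N) gu gv"
    by (rule C1_on_cong) (auto simp: local_rep_def unit_normal_chart[OF c])
  then show "\<exists>fu fv. C1_on (chart_image c) (local_rep c N) fu fv" by blast
qed

definition Nu where "Nu c = partial_u (local_rep c N)"
definition Nv where "Nv c = partial_v (local_rep c N)"

lemma C1_Nc: "c \<in> A \<Longrightarrow> C1_on (chart_image c) (local_rep c N) (Nu c) (Nv c)"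
  unfolding Nu_def Nv_def by (rule C1_funD[OF C1_N])

lemma N_orthogonal:
  assumes c: "c \<in> A" and x: "x \<in> chart_image c"
  shows "local_rep c N x \<bullet> Xu c x = 0" "local_rep c N x \<bullet> Xv c x = 0"
    "local_rep c N x \<bullet> Nu c x = 0" "local_rep c N x \<bullet> Nv c x = 0"
proof -
  have "local_rep c N x = sgn (nrm c x)" using unit_normal_chart[OF c x] by (simp add: local_rep_def)
  then show "local_rep c N x \<bullet> Xu c x = 0" "local_rep c N x \<bullet> Xv c x = 0"
    by (simp_all add: sgn_div_norm nrm_def dot_cross_self)
  \<comment> \<open>The function N . N has its partials computed twice, by the product rule and as
    the constant 1; uniqueness equates the results.\<close>
  have 1: "C1_on (chart_image c) (\<lambda>x. local_rep c N x \<bullet> local_rep c N x)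
     (\<lambda>x. local_rep c N x \<bullet> Nu c x + Nu c x \<bullet> local_rep c N x) (\<lambda>x. local_rep c N x \<bullet> Nv c x + Nv c x \<bullet> local_rep c N x)"
    by (rule C1_on_bilinear[OF bounded_bilinear_inner C1_Nc[OF c] C1_Nc[OF c]])
  have 2: "C1_on (chart_image c) (\<lambda>x. local_rep c N x \<bullet> local_rep c N x) (\<lambda>x. 0) (\<lambda>x. 0)"
    by (rule C1_on_cong[OF C1_on_const[of _ 1]]) (auto simp: local_rep_def norm_N)
  show "local_rep c N x \<bullet> Nu c x = 0" "local_rep c N x \<bullet> Nv c x = 0"
    using partial_eqI(1,2)[OF chart_facts(2)[OF c] 1 x] partial_eqI(1,2)[OF chart_facts(2)[OF c] 2 x]
    by (simp_all add: inner_commute)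
qed

text \<open>\<open>dir_deriv\<close> goes through the inverse of the differential, so the
  coordinates of the two frame vectors are needed explicitly. Because \<open>frame1\<close> points
  along the first coordinate vector, they solve a triangular system.\<close>

lemma tangent_frame:
  fixes p
  defines "a \<equiv> coord_diff A X p (1,0)" and "b \<equiv> coord_diff A X p (0,1)"
    and "f1 \<equiv> frame1 A X p" and "f2 \<equiv> frame2 A X p"
  shows "f1 \<bullet> f1 = 1" "f2 \<bullet> f2 = 1" "f1 \<bullet> f2 = 0" "cross3 f1 f2 = N p"
    "a = norm a *\<^sub>R f1" "b = (b \<bullet> f1) *\<^sub>R f1 + (b \<bullet> f2) *\<^sub>R f2" "norm a > 0" "b \<bullet> f2 \<noteq> 0"
    "inv (coord_diff A X p) f1 = (1 / norm a, 0)"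
    "inv (coord_diff A X p) f2 = (- (b \<bullet> f1) / (norm a * (b \<bullet> f2)), 1 / (b \<bullet> f2))"
    "coord_diff A X p = (\<lambda>h. fst h *\<^sub>R a + snd h *\<^sub>R b)"
proof -
  let ?c = "chart_at A p" let ?x = "snd (chart_at A p) p"
  have eq: "coord_diff A X p = (\<lambda>h. fst h *\<^sub>R Xu ?c ?x + snd h *\<^sub>R Xv ?c ?x)"
    unfolding coord_diff_eq[OF C1_X] Xu_def Xv_def ..
  then have ab: "a = Xu ?c ?x" "b = Xv ?c ?x" by (simp_all add: a_def b_def)
  show eq': "coord_diff A X p = (\<lambda>h. fst h *\<^sub>R a + snd h *\<^sub>R b)" unfolding ab by (rule eq)
  have nz: "cross3 a b \<noteq> 0" using nrm_chart_at_nonzero[of p] by (simp add: nrm_def ab)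
  then have a0: "a \<noteq> 0" by auto
  then show na: "norm a > 0" by simp
  have f1: "f1 = sgn a" by (simp add: f1_def frame1_def a_def)
  have f2: "f2 = cross3 (N p) f1" by (simp add: f2_def frame2_def star_def f1_def)
  have N: "N p = sgn (cross3 a b)" by (simp add: unit_normal_def a_def b_def)
  show 1: "f1 \<bullet> f1 = 1" using a0 by (simp add: f1 norm_sgn flip: power2_norm_eq_inner)
  have Nf: "N p \<bullet> f1 = 0" "N p \<bullet> b = 0" by (simp_all add: N f1 sgn_div_norm dot_cross_self)
  show 2: "f2 \<bullet> f2 = 1"
    using norm_cross_dot[of "N p" f1] 1 norm_N[of p] Nf by (simp add: f2 power2_norm_eq_inner power_mult_distrib)
  show 3: "f1 \<bullet> f2 = 0" by (simp add: f2 dot_cross_self)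
  show cr: "cross3 f1 f2 = N p"
    unfolding f2 using 1 Nf by (simp add: Lagrange inner_commute)
  show a: "a = norm a *\<^sub>R f1" using a0 by (simp add: f1 sgn_div_norm)
  show b: "b = (b \<bullet> f1) *\<^sub>R f1 + (b \<bullet> f2) *\<^sub>R f2"
    using orthonormal_cross_expansion(5)[OF 1 2 3, of b] Nf(2) unfolding cr by (simp add: inner_commute)
  show bf: "b \<bullet> f2 \<noteq> 0"
  proof
    assume "b \<bullet> f2 = 0"
    then have "b = (b \<bullet> f1) *\<^sub>R f1" using b by simp
    then have "cross3 a b = 0" using a by (metis cross_mult_left cross_mult_right cross_refl scaleR_zero_right)
    then show False using nz by simp
  qed
  have inj: "inj (coord_diff A X p)" using immersed by (auto simp: immersion_def)
  have "coord_diff A X p (1 / norm a, 0) = f1" unfolding eq' using a na by (metis (no_types, lifting) fst_conv snd_conv add.right_neutral scaleR_zero_left scaleR_scaleR divide_self_if less_irrefl scaleR_one mult.commute times_divide_eq_right mult_1)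
  then show "inv (coord_diff A X p) f1 = (1 / norm a, 0)" by (metis inv_f_f inj)
  have "coord_diff A X p (- (b \<bullet> f1) / (norm a * (b \<bullet> f2)), 1 / (b \<bullet> f2))
     = (- (b \<bullet> f1) / (norm a * (b \<bullet> f2))) *\<^sub>R (norm a *\<^sub>R f1) + (1 / (b \<bullet> f2)) *\<^sub>R ((b \<bullet> f1) *\<^sub>R f1 + (b \<bullet> f2) *\<^sub>R f2)"
    unfolding eq' using a b by simp
  also have "\<dots> = f2" using na bf by (simp add: scaleR_right_distrib)
  finally show "inv (coord_diff A X p) f2 = (- (b \<bullet> f1) / (norm a * (b \<bullet> f2)), 1 / (b \<bullet> f2))" by (metis inv_f_f inj)
qed

text \<open>The gradient of a coordinate function is the tangential part of the basis vector, and
  the normal part it omits would be killed by the cross product with the normal.\<close>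

lemma gradient_coordinate:
  "star A X (gradient A X (\<lambda>p. X p $ i)) p = cross3 (N p) (axis i 1)"
proof -
  let ?f1 = "frame1 A X p" let ?f2 = "frame2 A X p"
  note fr = tangent_frame[of p]
  have C: "C1_fun A (\<lambda>p. X p $ i)"
  proof (rule C1_funI)
    fix c assume c: "c \<in> A"
    show "\<exists>fu fv. C1_on (chart_image c) (local_rep c (\<lambda>p. X p $ i)) fu fv"
      using C1_on_linear[OF bounded_linear_vec_nth C1_Xc[OF c]] by (auto simp: local_rep_def o_def)
  qed
  let ?c = "chart_at A p" let ?x = "snd (chart_at A p) p"
  have "partial_u (local_rep ?c (\<lambda>p. X p $ i)) ?x = Xu ?c ?x $ i" "partial_v (local_rep ?c (\<lambda>p. X p $ i)) ?x = Xv ?c ?x $ i"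
  proof -
    have "C1_on (chart_image ?c) (local_rep ?c (\<lambda>p. X p $ i)) (\<lambda>x. Xu ?c x $ i) (\<lambda>x. Xv ?c x $ i)"
      using C1_on_linear[OF bounded_linear_vec_nth[of i] C1_Xc[OF chart_at(1)]] by (simp add: local_rep_def o_def)
    from partial_eqI(1,2)[OF chart_facts(2)[OF chart_at(1)] this coord_in[OF chart_at]]
    show "partial_u (local_rep ?c (\<lambda>p. X p $ i)) ?x = Xu ?c ?x $ i" "partial_v (local_rep ?c (\<lambda>p. X p $ i)) ?x = Xv ?c ?x $ i" by auto
  qed
  then have cd: "coord_diff A (\<lambda>p. X p $ i) p h = coord_diff A X p h $ i" for h
    unfolding coord_diff_eq[OF C] coord_diff_eq[OF C1_X] by (simp add: Xu_def Xv_def)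
  have inv: "coord_diff A X p (inv (coord_diff A X p) ?f1) = ?f1" "coord_diff A X p (inv (coord_diff A X p) ?f2) = ?f2"
  proof -
    let ?a = "coord_diff A X p (1,0)" let ?b = "coord_diff A X p (0,1)"
    show "coord_diff A X p (inv (coord_diff A X p) ?f1) = ?f1"
    proof -
      have "coord_diff A X p (1 / norm ?a, 0) = (1 / norm ?a) *\<^sub>R ?a" by (subst fr(11)) simp
      also have "\<dots> = (1 / norm ?a) *\<^sub>R (norm ?a *\<^sub>R ?f1)" using fr(5) by simp
      also have "\<dots> = ?f1" using fr(7) by simp
      finally show ?thesis using fr(9) by simp
    qed
    show "coord_diff A X p (inv (coord_diff A X p) ?f2) = ?f2"
    proof -
      have "coord_diff A X p (- (?b \<bullet> ?f1) / (norm ?a * (?b \<bullet> ?f2)), 1 / (?b \<bullet> ?f2))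
         = (- (?b \<bullet> ?f1) / (norm ?a * (?b \<bullet> ?f2))) *\<^sub>R ?a + (1 / (?b \<bullet> ?f2)) *\<^sub>R ?b" by (subst fr(11)) simp
      also have "\<dots> = (- (?b \<bullet> ?f1) / (norm ?a * (?b \<bullet> ?f2))) *\<^sub>R (norm ?a *\<^sub>R ?f1) + (1 / (?b \<bullet> ?f2)) *\<^sub>R ((?b \<bullet> ?f1) *\<^sub>R ?f1 + (?b \<bullet> ?f2) *\<^sub>R ?f2)"
        using fr(5,6) by simp
      also have "\<dots> = ?f2" using fr(7,8) by (simp add: scaleR_right_distrib)
      finally show ?thesis using fr(10) by simp
    qed
  qed
  have "gradient A X (\<lambda>p. X p $ i) p = (?f1 $ i) *\<^sub>R ?f1 + (?f2 $ i) *\<^sub>R ?f2"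
    unfolding gradient_def dir_deriv_def cd inv ..
  then have "star A X (gradient A X (\<lambda>p. X p $ i)) p = (?f1 $ i) *\<^sub>R cross3 (N p) ?f1 + (?f2 $ i) *\<^sub>R cross3 (N p) ?f2"
    by (simp add: star_def cross_add_right cross_mult_right)
  also have "\<dots> = (?f1 $ i) *\<^sub>R ?f2 - (?f2 $ i) *\<^sub>R ?f1"
    using orthonormal_cross_expansion(1)[OF fr(1-3)] fr(1-3) unfolding fr(4) by (simp add: inner_commute)
  also have "\<dots> = cross3 (N p) (axis i 1)"
    using orthonormal_cross_expansion(1)[OF fr(1-3), of "axis i 1"] unfolding fr(4) by (simp add: inner_axis)
  finally show ?thesis .
qed

lemma L_star_eq: "L_star A X = range (\<lambda>v p. cross3 (N p) v)"
proof -
  have lin: "linear (\<lambda>v p. cross3 (N p) v)"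
    by (rule linearI) (auto simp: fun_eq_iff cross_add_right cross_mult_right scaleR_fun_def plus_fun_def)
  have g: "range (\<lambda>i::3. star A X (gradient A X (\<lambda>p. X p $ i))) = (\<lambda>v p. cross3 (N p) v) ` (range (\<lambda>i. axis i 1))"
    by (auto simp: gradient_coordinate[abs_def] fun_eq_iff image_iff gradient_coordinate)
  have "range (\<lambda>i. axis i (1::real)) = (Basis :: (real^3) set)" by (auto simp: Basis_vec_def)
  then show ?thesis unfolding L_star_def g by (simp only: linear_span_image[OF lin] span_Basis)
qed

text \<open>The vanishing trace, written in the frame, becomes an equation between partial
  derivatives after multiplication by the area \<open>s * \<sigma>\<close> of the coordinate
  parallelogram. In this form neither frame nor inverse metric appears, so it can be moved to other
  charts and combined with second derivatives of \<open>X\<close>.\<close>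

lemma minimal_chart_at:
  assumes "minimal A X"
  defines "c \<equiv> \<lambda>p. chart_at A p" and "x \<equiv> \<lambda>p. snd (chart_at A p) p"
  shows "cross3 (Nu (c p) (x p)) (Xv (c p) (x p)) + cross3 (Xu (c p) (x p)) (Nv (c p) (x p)) = 0"
proof -
  let ?f1 = "frame1 A X p" let ?f2 = "frame2 A X p"
  let ?a = "Xu (c p) (x p)" let ?b = "Xv (c p) (x p)" let ?m = "Nu (c p) (x p)" let ?n = "Nv (c p) (x p)"
  note fr = tangent_frame[of p]
  have ab: "coord_diff A X p (1,0) = ?a" "coord_diff A X p (0,1) = ?b"
    by (simp_all add: coord_diff_eq[OF C1_X] Xu_def Xv_def c_def x_def)
  have cN: "coord_diff A N p = (\<lambda>h. fst h *\<^sub>R ?m + snd h *\<^sub>R ?n)"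
    by (simp add: coord_diff_eq[OF C1_N] Nu_def Nv_def c_def x_def)
  define \<sigma> where "\<sigma> = ?b \<bullet> ?f2" define \<kappa> where "\<kappa> = ?b \<bullet> ?f1" define s where "s = norm ?a"
  have s: "s > 0" "\<sigma> \<noteq> 0" using fr(7,8) by (auto simp: s_def \<sigma>_def ab)
  have "shape_trace A X p = 0" using assms(1) by (auto simp: minimal_def)
  then have t: "((1 / s) *\<^sub>R ?m) \<bullet> ?f1 + ((- \<kappa> / (s * \<sigma>)) *\<^sub>R ?m + (1 / \<sigma>) *\<^sub>R ?n) \<bullet> ?f2 = 0"
    unfolding shape_trace_def shape_op_def dir_deriv_def fr(9,10) cN by (simp add: ab s_def \<kappa>_def \<sigma>_def)
  \<comment> \<open>This clears the denominators that come from inverting the triangular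
    differential.\<close>
  have "(s * \<sigma>) * (((1 / s) *\<^sub>R ?m) \<bullet> ?f1 + ((- \<kappa> / (s * \<sigma>)) *\<^sub>R ?m + (1 / \<sigma>) *\<^sub>R ?n) \<bullet> ?f2)
      = \<sigma> * (?m \<bullet> ?f1) - \<kappa> * (?m \<bullet> ?f2) + s * (?n \<bullet> ?f2)"
    using s by (simp add: inner_add_left inner_diff_left field_simps)
  with t have tr: "\<sigma> * (?m \<bullet> ?f1) - \<kappa> * (?m \<bullet> ?f2) + s * (?n \<bullet> ?f2) = 0" by simp
  have Np: "local_rep (c p) N (x p) = N p" unfolding c_def x_def by (rule local_rep_coord[OF chart_at])
  have o: "?m \<bullet> N p = 0" "?n \<bullet> N p = 0"
    using N_orthogonal(3,4)[of "c p" "x p"] chart_at coord_in[OF chart_at] Np by (simp_all add: c_def x_def inner_commute)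
  have m: "?m = (?m \<bullet> ?f1) *\<^sub>R ?f1 + (?m \<bullet> ?f2) *\<^sub>R ?f2" and n: "?n = (?n \<bullet> ?f1) *\<^sub>R ?f1 + (?n \<bullet> ?f2) *\<^sub>R ?f2"
    using orthonormal_cross_expansion(5)[OF fr(1-3)] o unfolding fr(4) by (metis add.right_neutral scaleR_zero_left)+
  have a: "?a = s *\<^sub>R ?f1" and b: "?b = \<kappa> *\<^sub>R ?f1 + \<sigma> *\<^sub>R ?f2"
    using fr(5,6) unfolding ab s_def \<kappa>_def \<sigma>_def .
  define m1 m2 n1 n2 where "m1 = ?m \<bullet> ?f1" "m2 = ?m \<bullet> ?f2" "n1 = ?n \<bullet> ?f1" "n2 = ?n \<bullet> ?f2"
  have "cross3 ?m ?b + cross3 ?a ?n = cross3 (m1 *\<^sub>R ?f1 + m2 *\<^sub>R ?f2) (\<kappa> *\<^sub>R ?f1 + \<sigma> *\<^sub>R ?f2) + cross3 (s *\<^sub>R ?f1) (n1 *\<^sub>R ?f1 + n2 *\<^sub>R ?f2)"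
    using m n a b by (simp add: m1_m2_n1_n2_def)
  also have "\<dots> = (\<sigma> * m1 - \<kappa> * m2 + s * n2) *\<^sub>R cross3 ?f1 ?f2"
    by (simp add: cross_add_left cross_add_right cross_mult_left cross_mult_right cross_skew[of ?f2 ?f1] algebra_simps)
  also have "\<dots> = 0" using tr by (simp add: m1_m2_n1_n2_def)
  finally show ?thesis .
qed

lemma minimal_chart:
  assumes m: "minimal A X" and c: "c \<in> A" and x: "x \<in> chart_image c"
  shows "cross3 (Nu c x) (Xv c x) + cross3 (Xu c x) (Nv c x) = 0"
proof -
  define p where "p = param c x"
  let ?d = "chart_at A p"
  have p: "p \<in> fst c" "snd c p = x" using param_in[OF c x] c x by (auto simp: p_def)
  have xo: "x \<in> overlap c ?d" unfolding overlap_def using p chart_at(2)[of p] by blast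
  have tr: "trans c ?d x = snd ?d p" by (simp add: trans_def local_rep_def p_def)
  define y where "y = snd ?d p"
  have Q: "cross3 (Nu ?d y) (Xv ?d y) + cross3 (Xu ?d y) (Nv ?d y) = 0"
    unfolding y_def by (rule minimal_chart_at[OF m])
  obtain a1 a2 b1 b2 where e: "Xu c x = a1 *\<^sub>R Xu ?d y + a2 *\<^sub>R Xv ?d y" "Xv c x = b1 *\<^sub>R Xu ?d y + b2 *\<^sub>R Xv ?d y"
    "Nu c x = a1 *\<^sub>R Nu ?d y + a2 *\<^sub>R Nv ?d y" "Nv c x = b1 *\<^sub>R Nu ?d y + b2 *\<^sub>R Nv ?d y"
    using partial_trans[OF C1_X c chart_at(1) xo] partial_trans[OF C1_N c chart_at(1) xo]
    unfolding Xu_def Xv_def Nu_def Nv_def tr y_def by blast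
  have "cross3 (Nu c x) (Xv c x) + cross3 (Xu c x) (Nv c x) = (a1 * b2 - a2 * b1) *\<^sub>R (cross3 (Nu ?d y) (Xv ?d y) + cross3 (Xu ?d y) (Nv ?d y))"
    unfolding e by (rule cross_sum_change_basis)
  then show ?thesis using Q by simp
qed

end

section \<open>The area measure\<close>

lemma suminf_swap_ennreal:
  fixes f :: "nat \<Rightarrow> nat \<Rightarrow> ennreal"
  shows "(\<Sum>n. \<Sum>i. f n i) = (\<Sum>i. \<Sum>n. f n i)"
proof -
  have "(\<Sum>n. \<Sum>i. f n i) = (\<integral>\<^sup>+n. (\<Sum>i. f n i) \<partial>count_space UNIV)"
    by (simp add: nn_integral_count_space_nat)
  also have "\<dots> = (\<Sum>i. \<integral>\<^sup>+n. f n i \<partial>count_space UNIV)"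
    by (rule nn_integral_suminf) simp
  finally show ?thesis by (simp add: nn_integral_count_space_nat)
qed

context surface
begin

lemma chart_image_borel [measurable]: "c \<in> A \<Longrightarrow> chart_image c \<in> sets borel"
proof -
  assume c: "c \<in> A"
  obtain U where U: "open U" "chart_image c = half_plane \<inter> U" using chart_facts(2)[OF c] openin_open by blast
  note closed_half_plane
  then show ?thesis using U by auto
qed

text \<open>Push-forwards ask for a Borel map on the whole plane, so \<open>param\<close> receives a
  fixed dummy value off the chart image; the density \<open>w\<close> is 0 there.\<close>

definition param' :: "'a chart \<Rightarrow> real \<times> real \<Rightarrow> 'a" where
  "param' c x = (if x \<in> chart_image c then param c x else undefined)"

lemma param'_measurable [measurable]:
  assumes c: "c \<in> A" shows "param' c \<in> borel_measurable borel"
proof (rule borel_measurableI)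
  fix U :: "'a set" assume U: "open U"
  have 1: "{x \<in> chart_image c. param c x \<in> U} = snd c ` (fst c \<inter> U)"
  proof (intro equalityI subsetI)
    fix x assume "x \<in> {x \<in> chart_image c. param c x \<in> U}"
    then show "x \<in> snd c ` (fst c \<inter> U)" using c param_in[OF c, of x] by (intro image_eqI[of x _ "param c x"]) auto
  next
    fix x assume "x \<in> snd c ` (fst c \<inter> U)"
    then obtain p where "p \<in> fst c" "p \<in> U" "x = snd c p" by blast
    then show "x \<in> {x \<in> chart_image c. param c x \<in> U}" using c coord_in[OF c] by auto
  qed
  have "openin (top_of_set half_plane) (snd c ` (fst c \<inter> U))" by (rule openin_coord_image[OF c U])
  then obtain V where "open V" "snd c ` (fst c \<inter> U) = half_plane \<inter> V" using openin_open by blast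
  moreover note closed_half_plane
  ultimately have b: "{x \<in> chart_image c. param c x \<in> U} \<in> sets borel" unfolding 1 by auto
  have "param' c -` U \<inter> space borel = {x \<in> chart_image c. param c x \<in> U} \<union> (if undefined \<in> U then - chart_image c else {})"
    by (auto simp: param'_def split: if_splits)
  also have "\<dots> \<in> sets borel" using b chart_image_borel[OF c] by auto
  finally show "param' c -` U \<inter> space borel \<in> sets borel" .
qed

lemma coord_image_eq:
  assumes "c \<in> A" "B \<subseteq> fst c"
  shows "snd c ` B = chart_image c \<inter> param' c -` B"
proof (intro equalityI subsetI)
  fix x assume "x \<in> snd c ` B"
  then obtain p where "p \<in> B" "x = snd c p" by blast
  then show "x \<in> chart_image c \<inter> param' c -` B" using assms coord_in[OF assms(1)] by (auto simp: param'_def)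
next
  fix x assume "x \<in> chart_image c \<inter> param' c -` B"
  then show "x \<in> snd c ` B" using assms by (intro image_eqI[of x _ "param c x"]) (auto simp: param'_def)
qed

lemma coord_image_borel:
  assumes "c \<in> A" "B \<in> sets borel" "B \<subseteq> fst c"
  shows "snd c ` B \<in> sets borel"
  unfolding coord_image_eq[OF assms(1,3)]
  using chart_image_borel[OF assms(1)] measurable_sets_borel[OF param'_measurable[OF assms(1)] assms(2)] by auto

definition w :: "'a chart \<Rightarrow> real \<times> real \<Rightarrow> real" where
  "w c x = indicator (chart_image c) x * norm (nrm c x)"

lemma w_nonneg [simp]: "0 \<le> w c x" by (simp add: w_def)

lemma nrm_continuous: "c \<in> A \<Longrightarrow> continuous_on (chart_image c) (nrm c)"
  using C1_nrm C1_on_continuous by blast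

lemma w_measurable [measurable]: "c \<in> A \<Longrightarrow> w c \<in> borel_measurable borel"
proof -
  assume c: "c \<in> A"
  have "(\<lambda>x. indicator (chart_image c) x *\<^sub>R norm (nrm c x)) \<in> borel_measurable borel"
    using nrm_continuous[OF c] chart_image_borel[OF c]
    by (intro borel_measurable_continuous_on_indicator continuous_intros) auto
  then show ?thesis by (simp add: w_def[abs_def])
qed

text \<open>The value that \<open>area_measure\<close> is required to have on a Borel subset of the
  chart, written with the globally measurable density \<open>w\<close>.\<close>

definition \<kappa> :: "'a chart \<Rightarrow> 'a set \<Rightarrow> ennreal" where
  "\<kappa> c B = emeasure (density lborel (\<lambda>x. ennreal (w c x))) (snd c ` B)"

lemma \<kappa>_eq:
  assumes "c \<in> A" "B \<in> sets borel" "B \<subseteq> fst c"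
  shows "\<kappa> c B = (\<integral>\<^sup>+x\<in>snd c ` B. ennreal (area_density X c x) \<partial>lborel)"
proof -
  have m [measurable]: "snd c ` B \<in> sets borel" by (rule coord_image_borel[OF assms])
  note w_measurable[OF assms(1), measurable]
  have "\<kappa> c B = (\<integral>\<^sup>+x\<in>snd c ` B. ennreal (w c x) \<partial>lborel)"
    unfolding \<kappa>_def by (subst emeasure_density) auto
  also have "\<dots> = (\<integral>\<^sup>+x\<in>snd c ` B. ennreal (area_density X c x) \<partial>lborel)"
  proof (intro nn_integral_cong)
    fix x
    have "snd c ` B \<subseteq> chart_image c" using assms coord_in by blast
    then show "ennreal (w c x) * indicator (snd c ` B) x = ennreal (area_density X c x) * indicator (snd c ` B) x"
      by (auto simp: w_def area_density_def nrm_def Xu_def Xv_def indicator_def)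
  qed
  finally show ?thesis .
qed

lemma \<kappa>_suminf:
  assumes c: "c \<in> A" and B: "\<And>i. B i \<in> sets borel" "\<And>i. B i \<subseteq> fst c" and d: "disjoint_family (B :: nat \<Rightarrow> 'a set)"
  shows "(\<Sum>i. \<kappa> c (B i)) = \<kappa> c (\<Union>i. B i)"
proof -
  have "inj_on (snd c) (fst c)" using c by (metis inj_onI param_coord)
  then have "disjoint_family (\<lambda>i. snd c ` B i)"
    using d B(2) unfolding disjoint_family_on_def by (metis inj_on_image_Int image_empty)
  then have "(\<Sum>i. emeasure (density lborel (\<lambda>x. ennreal (w c x))) (snd c ` B i))
     = emeasure (density lborel (\<lambda>x. ennreal (w c x))) (\<Union>i. snd c ` B i)"
    by (intro suminf_emeasure) (use coord_image_borel[OF c B(1) B(2)] in auto)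
  then show ?thesis by (simp add: \<kappa>_def image_UN)
qed

text \<open>Area does not depend on the chart: the Jacobian in the change of variables along the
  transition map is exactly the factor by which \<open>nrm_trans\<close> relates the two
  densities.\<close>

lemma \<kappa>_indep:
  assumes c: "c \<in> A" and d: "d \<in> A" and B: "B \<in> sets borel" "B \<subseteq> fst c" "B \<subseteq> fst d"
  shows "\<kappa> c B = \<kappa> d B"
proof -
  have So: "snd c ` B \<subseteq> overlap c d" "snd d ` B \<subseteq> overlap d c" using B by (auto simp: overlap_def)
  have hom: "homeomorphism (snd c ` B) (snd d ` B) (trans c d) (trans d c)"
  proof (rule homeomorphismI)
    show "continuous_on (snd c ` B) (trans c d)" "continuous_on (snd d ` B) (trans d c)"
      using C1_on_continuous[OF overlap(3)] c d So continuous_on_subset by blast+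
  qed (use B c d in \<open>auto simp: trans_def local_rep_def subset_iff\<close>)
  have m [measurable]: "snd c ` B \<in> sets borel" "snd d ` B \<in> sets borel" using coord_image_borel c d B by auto
  note w_measurable[OF c, measurable] w_measurable[OF d, measurable]
  have "\<kappa> d B = (\<integral>\<^sup>+y. ennreal (w d y) * indicator (snd d ` B) y \<partial>lborel)"
    unfolding \<kappa>_def by (subst emeasure_density) auto
  also have "\<dots> = (\<integral>\<^sup>+x. ennreal (w d (trans c d x)) * ennreal \<bar>det2 (\<lambda>h. fst h *\<^sub>R partial_u (trans c d) x + snd h *\<^sub>R partial_v (trans c d) x)\<bar> * indicator (snd c ` B) x \<partial>lborel)"
  proof (rule nn_integral_change_of_variables[OF hom m])
    show "(trans c d has_derivative (\<lambda>h. fst h *\<^sub>R partial_u (trans c d) x + snd h *\<^sub>R partial_v (trans c d) x)) (at x within snd c ` B)"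
      if "x \<in> snd c ` B" for x
      using has_derivative_subset[OF C1_onD(3)[OF overlap(3)[OF c d]] So(1)] that So(1) by blast
    show "continuous_on (snd c ` B) (\<lambda>x. det2 (\<lambda>h. fst h *\<^sub>R partial_u (trans c d) x + snd h *\<^sub>R partial_v (trans c d) x))"
      using continuous_on_subset[OF C1_onD(1)[OF overlap(3)[OF c d]] So(1)] continuous_on_subset[OF C1_onD(2)[OF overlap(3)[OF c d]] So(1)]
      unfolding det2_def by (auto intro!: continuous_intros)
    show "(\<lambda>y. ennreal (w d y)) \<in> borel_measurable borel" by measurable
  qed
  also have "\<dots> = (\<integral>\<^sup>+x. ennreal (w c x) * indicator (snd c ` B) x \<partial>lborel)"
  proof (intro nn_integral_cong)
    fix x
    show "ennreal (w d (trans c d x)) * ennreal \<bar>det2 (\<lambda>h. fst h *\<^sub>R partial_u (trans c d) x + snd h *\<^sub>R partial_v (trans c d) x)\<bar> * indicator (snd c ` B) x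
      = ennreal (w c x) * indicator (snd c ` B) x"
    proof (cases "x \<in> snd c ` B")
      case True
      then have x: "x \<in> overlap c d" using So by blast
      have j: "jac c d x > 0" using overlap(7)[OF c d x] by (simp add: jac_def)
      have e: "det2 (\<lambda>h. fst h *\<^sub>R partial_u (trans c d) x + snd h *\<^sub>R partial_v (trans c d) x) = jac c d x"
        by (simp add: det2_def jac_def)
      have "x \<in> chart_image c" "trans c d x \<in> chart_image d" using overlap(2,4) c d x by blast+
      then have "w c x = w d (trans c d x) * jac c d x"
        using nrm_trans[OF c d x] j by (simp add: w_def)
      then show ?thesis unfolding e using j by (simp add: ennreal_mult)
    qed simp
  qed
  also have "\<dots> = \<kappa> c B" unfolding \<kappa>_def by (subst emeasure_density) auto
  finally show ?thesis ..
qed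

text \<open>Second countability enters here. Countably many charts suffice, so that area can be
  assembled as a series.\<close>

lemma countable_charts:
  obtains ch :: "nat \<Rightarrow> 'a chart" where "\<And>n. ch n \<in> A" "(\<Union>n. fst (ch n)) = UNIV"
proof -
  have cov: "(\<Union>c\<in>A. fst c) = UNIV" using atlas by (simp add: smooth_atlas_def)
  obtain F where F: "F \<subseteq> fst ` A" "countable F" "\<Union>F = \<Union>(fst ` A)"
    using Lindelof[of "fst ` A"] chart_facts(1) by blast
  then have "F \<noteq> {}" using cov by auto
  then have r: "range (from_nat_into F) = F" by (intro range_from_nat_into F(2))
  define ch where "ch n = (SOME c. c \<in> A \<and> fst c = from_nat_into F n)" for n
  have "ch n \<in> A \<and> fst (ch n) = from_nat_into F n" for n
  proof -
    have "from_nat_into F n \<in> fst ` A" using F(1) r by blast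
    then have "\<exists>c. c \<in> A \<and> fst c = from_nat_into F n" by (metis imageE)
    from someI_ex[OF this] show ?thesis by (simp add: ch_def)
  qed
  then have a: "\<And>n. ch n \<in> A" and f: "\<And>n. fst (ch n) = from_nat_into F n" by simp_all
  have "(\<Union>n. fst (ch n)) = UNIV" unfolding f r using F(3) cov by simp
  with a show thesis by (rule that)
qed

lemma disjoint_chart_pieces:
  obtains ch :: "nat \<Rightarrow> 'a chart" and D where "\<And>n. ch n \<in> A" "\<And>n. D n \<in> sets borel" "\<And>n. D n \<subseteq> fst (ch n)"
    "disjoint_family D" "(\<Union>n. D n) = UNIV"
proof -
  obtain ch :: "nat \<Rightarrow> 'a chart" where ch: "\<And>n. ch n \<in> A" "(\<Union>n. fst (ch n)) = UNIV" using countable_charts by blast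
  define D where "D = disjointed (\<lambda>n. fst (ch n))"
  have "range (\<lambda>n. fst (ch n)) \<subseteq> sets borel" using chart_facts(1)[OF ch(1)] by auto
  then have "range D \<subseteq> sets borel" unfolding D_def by (rule sets.range_disjointed_sets)
  moreover have "D n \<subseteq> fst (ch n)" for n unfolding D_def by (rule disjointed_subset)
  moreover have "(\<Union>n. D n) = UNIV" unfolding D_def using UN_disjointed_eq ch(2) by metis
  ultimately show thesis using that[of ch D] ch(1) by (auto simp: D_def disjoint_family_disjointed)
qed

abbreviation \<mu> where "\<mu> \<equiv> area_measure A X"

text \<open>\<open>area_measure\<close> is a definite description, which carries information only
  after existence and uniqueness are proved. The measure is assembled on disjoint pieces, each
  inside one chart; \<open>\<kappa>_indep\<close> then gives the required value on every chart and
  not only on the selected ones.\<close>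

lemma area_measure_exists:
  "\<exists>\<mu>. sets \<mu> = sets borel \<and> (\<forall>c\<in>A. \<forall>B\<in>sets borel. B \<subseteq> fst c \<longrightarrow> emeasure \<mu> B = \<kappa> c B)"
proof -
  obtain ch :: "nat \<Rightarrow> 'a chart" and D where ch: "\<And>n. ch n \<in> A" and D: "\<And>n. D n \<in> sets borel" "\<And>n. D n \<subseteq> fst (ch n)"
    "disjoint_family D" "(\<Union>n. D n) = UNIV" using disjoint_chart_pieces by blast
  define m where "m B = (\<Sum>n. \<kappa> (ch n) (B \<inter> D n))" for B
  define M where "M = measure_of UNIV (sets borel) m"
  have "emeasure M B = m B" if "B \<in> sets borel" for B
    unfolding M_def
  proof (rule emeasure_measure_of_sigma)
    show "sigma_algebra UNIV (sets (borel :: 'a measure))" using sets.sigma_algebra_axioms[of borel] by simp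
    show "positive (sets borel) m" by (simp add: positive_def m_def \<kappa>_def)
    show "countably_additive (sets borel) m"
    proof (rule countably_additiveI)
      fix B :: "nat \<Rightarrow> 'a set" assume B: "range B \<subseteq> sets borel" "disjoint_family B"
      have "(\<Sum>i. m (B i)) = (\<Sum>n. \<Sum>i. \<kappa> (ch n) (B i \<inter> D n))"
        unfolding m_def by (rule suminf_swap_ennreal)
      also have "\<dots> = (\<Sum>n. \<kappa> (ch n) (\<Union>i. B i \<inter> D n))"
      proof (intro suminf_cong \<kappa>_suminf ch)
        show "B i \<inter> D n \<in> sets borel" "B i \<inter> D n \<subseteq> fst (ch n)" for i n using B D by auto
        show "disjoint_family (\<lambda>i. B i \<inter> D n)" for n using B(2) by (auto simp: disjoint_family_on_def)
      qed
      finally show "(\<Sum>i. m (B i)) = m (\<Union>i. B i)" by (simp add: m_def)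
    qed
  qed (use that in auto)
  moreover have "m B = \<kappa> c B" if c: "c \<in> A" and B: "B \<in> sets borel" "B \<subseteq> fst c" for c B
  proof -
    have "m B = (\<Sum>n. \<kappa> c (B \<inter> D n))"
      unfolding m_def by (intro suminf_cong \<kappa>_indep ch c) (use B D in auto)
    also have "\<dots> = \<kappa> c (\<Union>n. B \<inter> D n)"
      using B D by (intro \<kappa>_suminf[OF c] disjoint_family_subset[OF D(3)]) auto
    also have "(\<Union>n. B \<inter> D n) = B" using D(4) by auto
    finally show ?thesis .
  qed
  moreover have "sets M = sets borel"
    unfolding M_def using sets.sigma_sets_eq[of borel] by (simp add: sets_measure_of_conv)
  ultimately show ?thesis by (intro exI[of _ M]) auto
qed

lemma area_measure_unique:
  assumes "sets \<mu>1 = sets borel" "\<And>c B. c \<in> A \<Longrightarrow> B \<in> sets borel \<Longrightarrow> B \<subseteq> fst c \<Longrightarrow> emeasure \<mu>1 B = \<kappa> c B"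
    and "sets \<mu>2 = sets borel" "\<And>c B. c \<in> A \<Longrightarrow> B \<in> sets borel \<Longrightarrow> B \<subseteq> fst c \<Longrightarrow> emeasure \<mu>2 B = \<kappa> c B"
  shows "\<mu>1 = \<mu>2"
proof (rule measure_eqI)
  obtain ch :: "nat \<Rightarrow> 'a chart" and D where ch: "\<And>n. ch n \<in> A" and D: "\<And>n. D n \<in> sets borel" "\<And>n. D n \<subseteq> fst (ch n)"
    "disjoint_family D" "(\<Union>n. D n) = UNIV" using disjoint_chart_pieces by blast
  fix B assume "B \<in> sets \<mu>1"
  then have B: "B \<in> sets borel" using assms by simp
  have *: "emeasure M B = (\<Sum>n. \<kappa> (ch n) (B \<inter> D n))"
    if "sets M = sets borel" "\<And>c B. c \<in> A \<Longrightarrow> B \<in> sets borel \<Longrightarrow> B \<subseteq> fst c \<Longrightarrow> emeasure M B = \<kappa> c B" for M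
  proof -
    have "(\<Sum>n. emeasure M (B \<inter> D n)) = emeasure M (\<Union>n. B \<inter> D n)"
      using B D that(1) by (intro suminf_emeasure disjoint_family_subset[OF D(3)]) auto
    moreover have "(\<Union>n. B \<inter> D n) = B" using D(4) by auto
    moreover have "emeasure M (B \<inter> D n) = \<kappa> (ch n) (B \<inter> D n)" for n
      by (rule that(2)[OF ch]) (use B D in auto)
    ultimately show ?thesis by simp
  qed
  have "emeasure \<mu>1 B = (\<Sum>n. \<kappa> (ch n) (B \<inter> D n))" by (rule *[OF assms(1)]) (rule assms(2))
  moreover have "emeasure \<mu>2 B = (\<Sum>n. \<kappa> (ch n) (B \<inter> D n))" by (rule *[OF assms(3)]) (rule assms(4))
  ultimately show "emeasure \<mu>1 B = emeasure \<mu>2 B" by (simp only:)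
qed (simp add: assms(1,3))

lemma area_measure:
  shows "sets \<mu> = sets borel" "c \<in> A \<Longrightarrow> B \<in> sets borel \<Longrightarrow> B \<subseteq> fst c \<Longrightarrow> emeasure \<mu> B = \<kappa> c B"
proof -
  let ?P = "\<lambda>\<mu>. sets \<mu> = sets borel \<and>
     (\<forall>c\<in>A. \<forall>B\<in>sets borel. B \<subseteq> fst c \<longrightarrow>
        emeasure \<mu> B = (\<integral>\<^sup>+x\<in>snd c ` B. ennreal (area_density X c x) \<partial>lborel))"
  have eq: "?P M \<longleftrightarrow> sets M = sets borel \<and> (\<forall>c\<in>A. \<forall>B\<in>sets borel. B \<subseteq> fst c \<longrightarrow> emeasure M B = \<kappa> c B)" for M
    using \<kappa>_eq by auto
  have "\<exists>!M. ?P M"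
  proof (rule ex_ex1I)
    show "\<exists>M. ?P M" unfolding eq by (rule area_measure_exists)
    show "M1 = M2" if "?P M1" "?P M2" for M1 M2
      using that unfolding eq by (intro area_measure_unique) blast+
  qed
  then have "?P \<mu>" unfolding area_measure_def by (rule theI')
  then show "sets \<mu> = sets borel" "c \<in> A \<Longrightarrow> B \<in> sets borel \<Longrightarrow> B \<subseteq> fst c \<Longrightarrow> emeasure \<mu> B = \<kappa> c B"
    unfolding eq by simp_all
qed

lemma measurable_area [simp]: "measurable \<mu> M = measurable borel M"
  by (rule measurable_cong_sets[OF area_measure(1) refl])

lemma finite_area: "emeasure \<mu> UNIV < \<infinity> \<Longrightarrow> finite_measure \<mu>"
  by (intro finite_measureI) (simp add: less_top area_measure sets_eq_imp_space_eq[OF area_measure(1)])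

lemma density_area_chart:
  assumes c: "c \<in> A"
  shows "density \<mu> (indicator (fst c)) = distr (density lborel (\<lambda>x. ennreal (w c x))) borel (param' c)"
proof (rule measure_eqI)
  fix B assume "B \<in> sets (density \<mu> (indicator (fst c)))"
  then have B: "B \<in> sets borel" by (simp add: area_measure)
  have fc: "fst c \<in> sets borel" using chart_facts(1)[OF c] by simp
  have "emeasure (density \<mu> (indicator (fst c))) B = emeasure \<mu> (fst c \<inter> B)"
    using B fc by (subst emeasure_density) (auto simp: area_measure simp flip: indicator_inter_arith)
  also have "\<dots> = \<kappa> c (fst c \<inter> B)" by (rule area_measure(2)[OF c]) (use B fc in auto)
  also have "\<dots> = emeasure (density lborel (\<lambda>x. ennreal (w c x))) (param' c -` B)"
  proof -
    have 1: "snd c ` (fst c \<inter> B) = chart_image c \<inter> param' c -` B"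
      unfolding coord_image_eq[OF c Int_lower1] using param_in[OF c] by (auto simp: param'_def)
    note w_measurable[OF c, measurable] param'_measurable[OF c, measurable] chart_image_borel[OF c, measurable] B[measurable]
    have [measurable]: "param' c -` B \<in> sets borel" using measurable_sets_borel[OF param'_measurable[OF c] B] .
    show ?thesis unfolding \<kappa>_def 1
      by (subst (1 2) emeasure_density, simp_all, intro nn_integral_cong) (auto simp: w_def indicator_def)
  qed
  also have "\<dots> = emeasure (distr (density lborel (\<lambda>x. ennreal (w c x))) borel (param' c)) B"
    using B param'_measurable[OF c] by (subst emeasure_distr) auto
  finally show "emeasure (density \<mu> (indicator (fst c))) B = emeasure (distr (density lborel (\<lambda>x. ennreal (w c x))) borel (param' c)) B" .
qed (simp add: area_measure)

text \<open>\<open>K\<close> lets an integrand supported in a compact part of the chart be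
  integrated over that part alone, which is the form in which the divergence inequality of the plane
  is available.\<close>

lemma area_integral_chart:
  fixes g :: "'a \<Rightarrow> real"
  assumes c: "c \<in> A" and g: "g \<in> borel_measurable borel" and g0: "\<And>p. p \<notin> fst c \<Longrightarrow> g p = 0"
    and K: "K \<subseteq> chart_image c" "\<And>x. x \<in> chart_image c \<Longrightarrow> x \<notin> K \<Longrightarrow> g (param c x) = 0"
  shows "(LINT p|\<mu>. g p) = (LINT x:K|lborel. norm (nrm c x) * g (param c x))"
proof -
  have fc: "fst c \<in> sets \<mu>" using chart_facts(1)[OF c] by (simp add: area_measure)
  have "(LINT p|\<mu>. g p) = (LINT p|\<mu>. indicator (fst c) p *\<^sub>R g p)"
    by (intro Bochner_Integration.integral_cong) (use g0 in \<open>auto simp: indicator_def\<close>)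
  also have "\<dots> = (LINT p|density \<mu> (\<lambda>x. ennreal (indicator (fst c) x)). g p)"
    using g chart_facts(1)[OF c] by (subst integral_density) auto
  also have "(\<lambda>x. ennreal (indicator (fst c) x)) = indicator (fst c)" by (auto simp: indicator_def)
  also have "(LINT p|density \<mu> (indicator (fst c)). g p) = (LINT x|density lborel (\<lambda>x. ennreal (w c x)). g (param' c x))"
    unfolding density_area_chart[OF c] using g param'_measurable[OF c] by (subst integral_distr) auto
  also have "\<dots> = (LINT x|lborel. w c x *\<^sub>R g (param' c x))"
    using w_measurable[OF c] measurable_compose[OF param'_measurable[OF c] g] by (subst integral_density) auto
  also have "\<dots> = (LINT x:K|lborel. norm (nrm c x) * g (param c x))"
    unfolding set_lebesgue_integral_def
    by (intro Bochner_Integration.integral_cong) (use K in \<open>auto simp: w_def param'_def indicator_def\<close>)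
  finally show ?thesis .
qed

end

section \<open>Lengths of curves\<close>

lemma vector_derivative_cong_open:
  assumes "open U" "x \<in> U" "\<And>y. y \<in> U \<Longrightarrow> f y = g y"
  shows "vector_derivative f (at x) = vector_derivative g (at x)"
proof -
  have "(f has_vector_derivative D) (at x) \<longleftrightarrow> (g has_vector_derivative D) (at x)" for D
    using has_vector_derivative_transform_within_open[OF _ assms(1,2), of f D g]
      has_vector_derivative_transform_within_open[OF _ assms(1,2), of g D f] assms(3) by metis
  then show ?thesis by (simp add: vector_derivative_def)
qed

definition speed :: "(real \<Rightarrow> 'b::real_normed_vector) \<Rightarrow> real \<Rightarrow> real" where
  "speed f t = norm (vector_derivative f (at t))"

lemma speed_nonneg [simp]: "0 \<le> speed f t" by (simp add: speed_def)

lemma valid_path_differentiable: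
  assumes "valid_path f"
  obtains S where "finite S" "\<And>t. t \<in> {0..1} - S \<Longrightarrow> (f has_vector_derivative vector_derivative f (at t)) (at t)"
proof -
  obtain S where S: "finite S" "f C1_differentiable_on ({0..1} - S)"
    using assms by (auto simp: valid_path_def piecewise_C1_differentiable_on_def)
  have "(f has_vector_derivative vector_derivative f (at t)) (at t)" if "t \<in> {0..1} - S" for t
    using S(2) that unfolding C1_differentiable_on_eq by (simp add: vector_derivative_works)
  with S(1) show thesis by (rule that)
qed

text \<open>The fundamental theorem of calculus tolerates the finitely many parameters at which a
  valid path may fail to be differentiable.\<close>

lemma chord_le_arclength:
  fixes f :: "real \<Rightarrow> 'b::euclidean_space"
  assumes f: "valid_path f" and i: "speed f integrable_on {0..1}" and ab: "0 \<le> a" "a \<le> b" "b \<le> 1"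
  shows "norm (f b - f a) \<le> integral {a..b} (speed f)"
proof -
  obtain S where S: "finite S" "\<And>t. t \<in> {0..1} - S \<Longrightarrow> (f has_vector_derivative vector_derivative f (at t)) (at t)"
    using valid_path_differentiable[OF f] by metis
  have cont: "continuous_on {a..b} f"
    using ab by (intro continuous_on_subset[OF valid_path_imp_path[OF f, unfolded path_def]]) auto
  have h: "((\<lambda>t. vector_derivative f (at t)) has_integral (f b - f a)) {a..b}"
    by (rule fundamental_theorem_of_calculus_interior_strong[OF S(1) ab(2) _ cont]) (use S(2) ab in auto)
  have "norm (integral {a..b} (\<lambda>t. vector_derivative f (at t))) \<le> integral {a..b} (speed f)"
  proof (rule integral_norm_bound_integral)
    show "speed f integrable_on {a..b}" by (rule integrable_on_subinterval[OF i]) (use ab in auto)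
    show "(\<lambda>t. vector_derivative f (at t)) integrable_on {a..b}" using h by blast
  qed (simp add: speed_def)
  then show ?thesis using h by (simp add: integral_unique)
qed

text \<open>Joins, reversals and subpaths are all affine changes of parameter. \<open>m\<close> may
  be negative, hence the image of the interval instead of explicit end points. The chain rule is
  applied off finitely many parameters, which do not affect the integral.\<close>

lemma speed_affine:
  fixes f :: "real \<Rightarrow> 'b::euclidean_space"
  assumes S: "finite S" "\<And>t. t \<in> {a..b} - S \<Longrightarrow> (f has_vector_derivative vector_derivative f (at t)) (at t)"
    and h: "(speed f has_integral i) {a..b}" and m: "m \<noteq> 0" 
  shows "(speed (\<lambda>x. f (m * x + c)) has_integral i) ((\<lambda>x. (x - c) / m) ` {a..b})"
proof -
  have "((\<lambda>x. speed f (m *\<^sub>R x + c)) has_integral (1 / \<bar>m\<bar> ^ DIM(real)) *\<^sub>R i) ((\<lambda>x. (1 / m) *\<^sub>R x + -((1 / m) *\<^sub>R c)) ` cbox a b)"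
    by (rule has_integral_affinity) (use h m in auto)
  moreover have "(\<lambda>x. (1 / m) *\<^sub>R x + -((1 / m) *\<^sub>R c)) = (\<lambda>x. (x - c) / m)" by (auto simp: diff_divide_distrib)
  ultimately have "((\<lambda>x. speed f (m * x + c)) has_integral i / \<bar>m\<bar>) ((\<lambda>x. (x - c) / m) ` {a..b})"
    by (simp del: diff_divide_distrib add: diff_divide_distrib[symmetric])
  then have "((\<lambda>x. \<bar>m\<bar> * speed f (m * x + c)) has_integral \<bar>m\<bar> * (i / \<bar>m\<bar>)) ((\<lambda>x. (x - c) / m) ` {a..b})"
    by (rule has_integral_mult_right)
  then have *: "((\<lambda>x. \<bar>m\<bar> * speed f (m * x + c)) has_integral i) ((\<lambda>x. (x - c) / m) ` {a..b})" using m by simp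
  show ?thesis
  proof (rule has_integral_spike_finite[OF _ _ *])
    show "finite ((\<lambda>x. (x - c) / m) ` S)" using S by simp
    fix x assume x: "x \<in> (\<lambda>x. (x - c) / m) ` {a..b} - (\<lambda>x. (x - c) / m) ` S"
    then obtain t where t: "t \<in> {a..b}" "x = (t - c) / m" by blast
    then have t': "t = m * x + c" using m by simp
    have "t \<notin> S" using x t by blast
    then have "(f has_vector_derivative vector_derivative f (at t)) (at t)" using S(2)[of t] t(1) by blast
    then have d: "(f has_vector_derivative vector_derivative f (at t)) (at (m * x + c))" unfolding t'[symmetric] .
    have "((\<lambda>x. m * x + c) has_vector_derivative m) (at x)"
      unfolding has_real_derivative_iff_has_vector_derivative[symmetric] by (auto intro!: derivative_eq_intros)
    from vector_diff_chain_at[OF this d]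
    have "((\<lambda>x. f (m * x + c)) has_vector_derivative m *\<^sub>R vector_derivative f (at t)) (at x)"
      unfolding o_def .
    then show "speed (\<lambda>x. f (m * x + c)) x = \<bar>m\<bar> * speed f (m * x + c)"
      unfolding speed_def t'[symmetric] by (simp only: vector_derivative_at norm_scaleR)
  qed
qed

text \<open>Existence of the integral is part of the notion, so that lengths can be added and cut
  without separate integrability conditions.\<close>

definition has_length :: "(real \<Rightarrow> 'b::euclidean_space) \<Rightarrow> real \<Rightarrow> bool" where
  "has_length f l \<longleftrightarrow> valid_path f \<and> (speed f has_integral l) {0..1}"

lemma has_length_join:
  assumes f: "has_length f l1" and g: "has_length g l2" and fg: "pathfinish f = pathstart g"
  shows "has_length (f +++ g) (l1 + l2)"
proof -
  obtain S where S: "finite S" "\<And>t. t \<in> {0..1} - S \<Longrightarrow> (f has_vector_derivative vector_derivative f (at t)) (at t)"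
    using valid_path_differentiable f unfolding has_length_def by metis
  obtain T where T: "finite T" "\<And>t. t \<in> {0..1} - T \<Longrightarrow> (g has_vector_derivative vector_derivative g (at t)) (at t)"
    using valid_path_differentiable g unfolding has_length_def by metis
  have "(speed (\<lambda>x. f (2 * x + 0)) has_integral l1) ((\<lambda>x. (x - 0) / 2) ` {0..1})"
    by (rule speed_affine[OF S]) (use f in \<open>auto simp: has_length_def\<close>)
  moreover have "(\<lambda>x::real. (x - 0) / 2) ` {0..1} = {0..1/2}" 
    using image_divide_atLeastAtMost[of 2 0 "1::real"] by simp
  ultimately have 1: "(speed (\<lambda>x. f (2 * x + 0)) has_integral l1) {0..1/2}" by simp
  have "(speed (\<lambda>x. g (2 * x + (-1))) has_integral l2) ((\<lambda>x. (x - (-1)) / 2) ` {0..1})"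
    by (rule speed_affine[OF T]) (use g in \<open>auto simp: has_length_def\<close>)
  moreover have "(\<lambda>x::real. (x - (-1)) / 2) ` {0..1} = {1/2..1}"
  proof -
    have "x \<in> (\<lambda>x::real. (x - (-1)) / 2) ` {0..1}" if "x \<in> {1/2..1}" for x
      using that by (intro image_eqI[of _ _ "2 * x - 1"]) auto
    then show ?thesis by auto
  qed
  ultimately have 2: "(speed (\<lambda>x. g (2 * x + (-1))) has_integral l2) {1/2..1}" by simp
  have "(speed (f +++ g) has_integral l1) {0..1/2}"
  proof (rule has_integral_spike_finite[OF _ _ 1])
    show "finite {1/2::real}" by simp
    fix x :: real assume "x \<in> {0..1/2} - {1/2}"
    then show "speed (f +++ g) x = speed (\<lambda>x. f (2 * x + 0)) x"
      unfolding speed_def by (subst vector_derivative_cong_open[of "{..<1/2}" x "f +++ g" "\<lambda>x. f (2 * x + 0)"]) (auto simp: joinpaths_def)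
  qed
  moreover have "(speed (f +++ g) has_integral l2) {1/2..1}"
  proof (rule has_integral_spike_finite[OF _ _ 2])
    show "finite {1/2::real}" by simp
    fix x :: real assume "x \<in> {1/2..1} - {1/2}"
    then show "speed (f +++ g) x = speed (\<lambda>x. g (2 * x + (-1))) x"
      unfolding speed_def by (subst vector_derivative_cong_open[of "{1/2<..}" x "f +++ g" "\<lambda>x. g (2 * x + (-1))"]) (auto simp: joinpaths_def)
  qed
  ultimately have "(speed (f +++ g) has_integral (l1 + l2)) {0..1}"
    by (intro has_integral_combine[of 0 "1/2" 1]) auto
  moreover have "valid_path (f +++ g)" using f g fg by (auto simp: has_length_def intro: valid_path_join)
  ultimately show ?thesis by (simp add: has_length_def)
qed

lemma has_length_reverse:
  assumes f: "has_length f l"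
  shows "has_length (reversepath f) l"
proof -
  obtain S where S: "finite S" "\<And>t. t \<in> {0..1} - S \<Longrightarrow> (f has_vector_derivative vector_derivative f (at t)) (at t)"
    using valid_path_differentiable f unfolding has_length_def by metis
  have "(speed (\<lambda>x. f ((-1) * x + 1)) has_integral l) ((\<lambda>x. (x - 1) / (-1)) ` {0..1})"
    by (rule speed_affine[OF S]) (use f in \<open>auto simp: has_length_def\<close>)
  moreover have "(\<lambda>x::real. (x - 1) / (-1)) ` {0..1} = {0..1}"
    using image_diff_atLeastAtMost[of "1::real" 0 1] by (simp add: minus_diff_eq)
  moreover have "(\<lambda>x. f ((-1) * x + 1)) = reversepath f" by (auto simp: reversepath_def)
  ultimately show ?thesis using f by (simp add: has_length_def)
qed

lemma has_length_subpath:
  assumes f: "has_length f l" and uv: "0 \<le> u" "u \<le> v" "v \<le> 1"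
  shows "has_length (subpath u v f) (integral {u..v} (speed f))"
proof (cases "u = v")
  case True
  \<comment> \<open>The affine substitution degenerates for u = v, where the subpath is
    constant.\<close>
  then have "subpath u v f = (\<lambda>x. f u)" by (auto simp: subpath_def)
  moreover have "speed (\<lambda>x. f u) = (\<lambda>x. 0)" by (auto simp: speed_def)
  moreover have "valid_path (\<lambda>x::real. f u)" using valid_path_subpath[of f u v] f uv True calculation(1) by (simp add: has_length_def)
  ultimately show ?thesis using True by (simp add: has_length_def)
next
  case False
  obtain S where S: "finite S" "\<And>t. t \<in> {0..1} - S \<Longrightarrow> (f has_vector_derivative vector_derivative f (at t)) (at t)"
    using valid_path_differentiable f unfolding has_length_def by metis
  have "speed f integrable_on {0..1}" using f by (auto simp: has_length_def)
  then have "speed f integrable_on {u..v}" by (rule integrable_on_subinterval) (use uv in auto)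
  then have h: "(speed f has_integral integral {u..v} (speed f)) {u..v}" by (rule integrable_integral)
  have "(speed (\<lambda>x. f ((v - u) * x + u)) has_integral integral {u..v} (speed f)) ((\<lambda>x. (x - u) / (v - u)) ` {u..v})"
    by (rule speed_affine[OF S(1) _ h]) (use S(2) False uv in auto)
  moreover have "(\<lambda>x. (x - u) / (v - u)) ` {u..v} = {0..1}"
  proof -
    have a: "x \<in> (\<lambda>x. (x - u) / (v - u)) ` {u..v}" if "x \<in> {0..1}" for x
    proof (intro image_eqI[of _ _ "(v - u) * x + u"])
      show "(v - u) * x + u \<in> {u..v}" using that uv mult_left_le[of x "v - u"] by auto
    qed (use False in auto)
    have b: "(x - u) / (v - u) \<in> {0..1}" if "x \<in> {u..v}" for x
      using that uv False by (auto simp: divide_le_eq)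
    show ?thesis by (intro equalityI image_subsetI subsetI) (rule b, assumption, rule a, assumption)
  qed
  moreover have "valid_path (subpath u v f)" using f uv by (auto simp: has_length_def intro!: valid_path_subpath)
  ultimately show ?thesis by (simp add: has_length_def subpath_def)
qed

definition curve :: "('a::topological_space \<Rightarrow> real^3) \<Rightarrow> (real \<Rightarrow> 'a) \<Rightarrow> 'a \<Rightarrow> 'a \<Rightarrow> real \<Rightarrow> bool" where
  "curve X g p q l \<longleftrightarrow> path g \<and> pathstart g = p \<and> pathfinish g = q \<and> has_length (X \<circ> g) l"

lemma curve_lengths_eq: "curve_lengths X p q = {l. \<exists>g. curve X g p q l}"
proof -
  have "(speed (X \<circ> g) has_integral l) {0..1} \<longleftrightarrow> speed (X \<circ> g) integrable_on {0..1} \<and> integral {0..1} (speed (X \<circ> g)) = l" for g l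
    by (simp add: has_integral_iff)
  then show ?thesis unfolding curve_lengths_def curve_def has_length_def speed_def[abs_def] by auto
qed

lemma curve_join: "curve X f p q l1 \<Longrightarrow> curve X g q r l2 \<Longrightarrow> curve X (f +++ g) p r (l1 + l2)"
  unfolding curve_def by (auto simp: path_compose_join pathstart_compose pathfinish_compose intro: has_length_join)

lemma curve_reverse: "curve X f p q l \<Longrightarrow> curve X (reversepath f) q p l"
  unfolding curve_def by (auto simp: path_compose_reversepath intro: has_length_reverse)

lemma curve_subpath:
  assumes "curve X g p q l" "0 \<le> u" "u \<le> v" "v \<le> 1"
  shows "curve X (\<lambda>t. g ((v - u) * t + u)) (g u) (g v) (integral {u..v} (speed (X \<circ> g)))"
proof -
  have "X \<circ> (\<lambda>t. g ((v - u) * t + u)) = subpath u v (X \<circ> g)" by (auto simp: subpath_def)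
  moreover have "path (\<lambda>t. g ((v - u) * t + u))"
    unfolding path_def
  proof (rule continuous_on_compose2[of "{0..1}" g])
    show "continuous_on {0..1} g" using assms by (auto simp: curve_def path_def)
    show "continuous_on {0..1} (\<lambda>t. (v - u) * t + u)" by (intro continuous_intros)
    have "(v - u) * t + u \<le> 1" if "t \<in> {0..1}" for t
      using that assms mult_left_le[of t "v - u"] by auto
    then show "(\<lambda>t. (v - u) * t + u) ` {0..1} \<subseteq> {0..1}" using assms by auto
  qed
  ultimately show ?thesis using assms has_length_subpath[of "X \<circ> g" l u v]
    by (auto simp: curve_def pathstart_def pathfinish_def)
qed

lemma curve_length_ge:
  assumes "curve X g p q l" "0 \<le> t" "t \<le> 1"
  shows "norm (X (g t) - X p) \<le> l" "0 \<le> l"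
proof -
  have v: "valid_path (X \<circ> g)" and h: "(speed (X \<circ> g) has_integral l) {0..1}" using assms by (auto simp: curve_def has_length_def)
  then have i: "speed (X \<circ> g) integrable_on {0..1}" by blast
  have "norm ((X \<circ> g) t - (X \<circ> g) 0) \<le> integral {0..t} (speed (X \<circ> g))"
    by (rule chord_le_arclength[OF v i]) (use assms in auto)
  also have "\<dots> \<le> integral {0..1} (speed (X \<circ> g))"
    by (rule integral_subset_le) (use assms i in \<open>auto intro: integrable_on_subinterval\<close>)
  also have "\<dots> = l" using h by (rule integral_unique)
  finally show "norm (X (g t) - X p) \<le> l" using assms by (auto simp: curve_def pathstart_def)
  then show "0 \<le> l" using norm_ge_zero order_trans by blast
qed

section \<open>Comparison of coordinate lengths and lengths of curves in a chart\<close>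

context surface
begin

definition dX where "dX c z h = fst h *\<^sub>R Xu c z + snd h *\<^sub>R Xv c z"

lemma Xc_derivative:
  assumes "c \<in> A" "B \<subseteq> chart_image c" "x \<in> B"
  shows "(local_rep c X has_derivative dX c x) (at x within B)"
  unfolding dX_def[abs_def] using C1_onD(3)[OF C1_on_subset[OF C1_Xc[OF assms(1)] assms(2)] assms(3)] .

lemma linear_dX: "linear (dX c x)"
  by (rule linearI) (auto simp: dX_def algebra_simps)

lemma norm_dX_diff: "norm (dX c y h - dX c x h) \<le> (norm (Xu c y - Xu c x) + norm (Xv c y - Xv c x)) * norm h"
proof -
  have "dX c y h - dX c x h = fst h *\<^sub>R (Xu c y - Xu c x) + snd h *\<^sub>R (Xv c y - Xv c x)"
    by (simp add: dX_def algebra_simps)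
  also have "norm \<dots> \<le> \<bar>fst h\<bar> * norm (Xu c y - Xu c x) + \<bar>snd h\<bar> * norm (Xv c y - Xv c x)"
    by (metis norm_triangle_ineq norm_scaleR)
  also have "\<dots> \<le> norm h * norm (Xu c y - Xu c x) + norm h * norm (Xv c y - Xv c x)"
    using norm_fst_le[of "fst h" "snd h"] norm_snd_le[of "snd h" "fst h"] by (intro add_mono mult_right_mono) auto
  finally show ?thesis by (simp add: algebra_simps)
qed

text \<open>Crossing the image of \<open>h\<close> with one partial of \<open>X\<close> isolates the
  coefficient of the other, so the nonvanishing normal gives injectivity, and in finite dimension
  injectivity gives a lower bound.\<close>

lemma dX_bounded_below:
  assumes "c \<in> A" "x \<in> chart_image c"
  obtains m where "m > 0" "\<And>h. m * norm h \<le> norm (dX c x h)"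
proof -
  have "inj (dX c x)"
    unfolding linear_injective_0[OF linear_dX]
  proof (intro allI impI)
    fix h assume h: "dX c x h = 0"
    have "cross3 (Xu c x) (dX c x h) = snd h *\<^sub>R nrm c x" "cross3 (dX c x h) (Xv c x) = fst h *\<^sub>R nrm c x"
      by (simp_all add: dX_def nrm_def cross_add_left cross_add_right cross_mult_left cross_mult_right)
    then have "snd h = 0" "fst h = 0" using h nrm_nonzero[OF assms] by auto
    then show "h = 0" by (simp add: prod_eq_iff)
  qed
  from linear_inj_bounded_below_pos[OF linear_dX this] obtain m where "m > 0" "\<And>h. m * norm h \<le> norm (dX c x h)" by blast
  then show thesis by (rule that)
qed

text \<open>On a small half disc the differential can be frozen at its centre up to an error \<eta>.
  The half disc, and not the disc, covers interior and edge points alike.\<close>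

lemma chart_nbhd:
  assumes c: "c \<in> A" and x0: "x0 \<in> chart_image c" and \<eta>: "\<eta> > 0"
  obtains r where "r > 0" "cball x0 r \<inter> half_plane \<subseteq> chart_image c"
    "\<And>y h. y \<in> cball x0 r \<inter> half_plane \<Longrightarrow> norm (dX c y h - dX c x0 h) \<le> \<eta> * norm (h :: real \<times> real)"
proof -
  obtain U where U: "open U" "chart_image c = half_plane \<inter> U" using chart_facts(2)[OF c] openin_open by blast
  obtain r1 where r1: "r1 > 0" "cball x0 r1 \<subseteq> U" using U x0 open_contains_cball by blast
  have e2: "\<eta> / 2 > 0" using \<eta> by simp
  obtain r2 where r2: "r2 > 0" "\<And>y. y \<in> chart_image c \<Longrightarrow> dist y x0 < r2 \<Longrightarrow> dist (Xu c y) (Xu c x0) < \<eta> / 2"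
    using C1_onD(1)[OF C1_Xc[OF c]] x0 e2 unfolding continuous_on_iff by meson
  obtain r3 where r3: "r3 > 0" "\<And>y. y \<in> chart_image c \<Longrightarrow> dist y x0 < r3 \<Longrightarrow> dist (Xv c y) (Xv c x0) < \<eta> / 2"
    using C1_onD(2)[OF C1_Xc[OF c]] x0 e2 unfolding continuous_on_iff by meson
  define r where "r = min r1 (min r2 r3) / 2"
  have r: "r > 0" "r \<le> r1" "r < r2" "r < r3" using r1 r2 r3 by (auto simp: r_def)
  have sub: "cball x0 r \<inter> half_plane \<subseteq> chart_image c" using U r1 r by auto
  show thesis
  proof (rule that[OF r(1) sub])
    fix y h :: "real \<times> real" assume y: "y \<in> cball x0 r \<inter> half_plane"
    then have d: "dist y x0 < r2" "dist y x0 < r3" "y \<in> chart_image c" using r sub by (auto simp: dist_commute)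
    have "norm (Xu c y - Xu c x0) + norm (Xv c y - Xv c x0) \<le> \<eta>"
      using r2(2)[OF d(3,1)] r3(2)[OF d(3,2)] by (simp add: dist_norm)
    then have "(norm (Xu c y - Xu c x0) + norm (Xv c y - Xv c x0)) * norm h \<le> \<eta> * norm h" by (rule mult_right_mono) simp
    then show "norm (dX c y h - dX c x0 h) \<le> \<eta> * norm h" using norm_dX_diff order_trans by blast
  qed
qed

lemma convex_half_ball: "convex (cball x r \<inter> half_plane)"
proof -
  have "half_plane = {y. (0, 1) \<bullet> y \<ge> 0}" by (auto simp: half_plane_def)
  then have "convex half_plane" using convex_halfspace_ge[of 0 "(0, 1) :: real \<times> real"] by simp
  then show ?thesis by (intro convex_Int convex_cball)
qed

lemma chart_expansion:
  assumes c: "c \<in> A" and x0: "x0 \<in> chart_image c"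
  obtains r m where "r > 0" "m > 0" "cball x0 r \<inter> half_plane \<subseteq> chart_image c"
    "\<And>x y. x \<in> cball x0 r \<inter> half_plane \<Longrightarrow> y \<in> cball x0 r \<inter> half_plane \<Longrightarrow> m * norm (x - y) \<le> norm (local_rep c X x - local_rep c X y)"
proof -
  obtain m where m: "m > 0" "\<And>h. m * norm h \<le> norm (dX c x0 h)" using dX_bounded_below[OF c x0] by blast
  have m2: "m / 2 > 0" using m by simp
  from chart_nbhd[OF c x0 m2] obtain r where r: "r > 0" "cball x0 r \<inter> half_plane \<subseteq> chart_image c"
    "\<And>y h. y \<in> cball x0 r \<inter> half_plane \<Longrightarrow> norm (dX c y h - dX c x0 h) \<le> m / 2 * norm h" by blast
  interpret L: linear "dX c x0" by (rule linear_dX)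
  have bl: "bounded_linear (dX c x0)" using linear_dX linear_conv_bounded_linear by blast
  show thesis
  proof (rule that[OF r(1) m2 r(2)])
    fix x y assume xy: "x \<in> cball x0 r \<inter> half_plane" "y \<in> cball x0 r \<inter> half_plane"
    have 1: "norm ((local_rep c X x - dX c x0 x) - (local_rep c X y - dX c x0 y)) \<le> m / 2 * norm (x - y)"
    proof (rule differentiable_bound[OF convex_half_ball[of x0 r] _ _ xy])
      fix z assume z: "z \<in> cball x0 r \<inter> half_plane"
      show "((\<lambda>x. local_rep c X x - dX c x0 x) has_derivative (\<lambda>h. dX c z h - dX c x0 h)) (at z within cball x0 r \<inter> half_plane)"
        by (intro has_derivative_diff Xc_derivative[OF c r(2) z] bounded_linear_imp_has_derivative bl)
      show "onorm (\<lambda>h. dX c z h - dX c x0 h) \<le> m / 2"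
        by (rule onorm_bound) (use m2 r(3)[OF z] in auto)
    qed
    have eq: "(local_rep c X x - dX c x0 x) - (local_rep c X y - dX c x0 y) = (local_rep c X x - local_rep c X y) - dX c x0 (x - y)"
      by (simp add: L.diff)
    have "norm (dX c x0 (x - y)) \<le> norm (local_rep c X x - local_rep c X y) + norm ((local_rep c X x - local_rep c X y) - dX c x0 (x - y))"
      by (metis norm_triangle_sub norm_minus_commute)
    then show "m / 2 * norm (x - y) \<le> norm (local_rep c X x - local_rep c X y)"
      using m(2)[of "x - y"] 1 unfolding eq by linarith
  qed
qed

text \<open>Upper bounds for the distance need admissible curves, and line segments in a convex part
  of a chart are enough for all of them.\<close>

lemma segment_curve:
  assumes c: "c \<in> A" and B: "convex B" "B \<subseteq> chart_image c" and xy: "x \<in> B" "y \<in> B"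
  shows "curve X (\<lambda>t. param c (x + t *\<^sub>R (y - x))) (param c x) (param c y)
    (integral {0..1} (\<lambda>t. norm (dX c (x + t *\<^sub>R (y - x)) (y - x))))"
    "(\<lambda>t. norm (dX c (x + t *\<^sub>R (y - x)) (y - x))) integrable_on {0..1}"
proof -
  let ?l = "\<lambda>t. x + t *\<^sub>R (y - x)"
  have lB: "?l t \<in> B" if "t \<in> {0..1}" for t
  proof -
    have "?l t = (1 - t) *\<^sub>R x + t *\<^sub>R y" by (simp add: algebra_simps)
    then show ?thesis using convexD[OF B(1) xy, of "1 - t" t] that by simp
  qed
  have lc: "continuous_on {0..1} ?l" by (intro continuous_intros)
  have img: "?l ` {0..1} \<subseteq> B" using lB by blast
  have contX: "continuous_on {0..1} (\<lambda>t. Xu c (?l t))" "continuous_on {0..1} (\<lambda>t. Xv c (?l t))"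
    using img B(2) by (auto intro!: continuous_on_compose2[OF C1_onD(1)[OF C1_Xc[OF c]] lc] continuous_on_compose2[OF C1_onD(2)[OF C1_Xc[OF c]] lc])
  have contd: "continuous_on {0..1} (\<lambda>t. dX c (?l t) (y - x))"
    unfolding dX_def by (intro continuous_intros contX)
  show int: "(\<lambda>t. norm (dX c (?l t) (y - x))) integrable_on {0..1}"
    by (intro integrable_continuous_interval continuous_on_norm contd)
  have vd: "((X \<circ> (\<lambda>t. param c (?l t))) has_vector_derivative dX c (?l t) (y - x)) (at t)" if t: "t \<in> {0<..<1}" for t
  proof -
    have 1: "(?l has_derivative (\<lambda>h. h *\<^sub>R (y - x))) (at t within {0<..<1})" by (auto intro!: derivative_eq_intros)
    have "(local_rep c X has_derivative dX c (?l t)) (at (?l t) within ?l ` {0<..<1})"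
      by (rule Xc_derivative[OF c]) (use lB B(2) t in auto)
    from has_derivative_in_compose[OF 1 this]
    have "((\<lambda>t. local_rep c X (?l t)) has_derivative (\<lambda>h. dX c (?l t) (h *\<^sub>R (y - x)))) (at t)"
      using at_within_open[OF t open_greaterThanLessThan] by simp
    moreover have "(\<lambda>h. dX c (?l t) (h *\<^sub>R (y - x))) = (\<lambda>h. h *\<^sub>R dX c (?l t) (y - x))"
      using linear_scale[OF linear_dX] by blast
    ultimately show ?thesis by (simp add: has_vector_derivative_def local_rep_def o_def)
  qed
  have pc: "path (\<lambda>t. param c (?l t))"
    unfolding path_def using img B(2) chart_facts(3)[OF c]
    by (intro continuous_on_compose2[OF _ lc, of "chart_image c" "param c"]) (auto simp: homeomorphism_def)
  have Xcont: "continuous_on {0..1} (X \<circ> (\<lambda>t. param c (?l t)))"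
    using continuous_on_compose2[OF C1_on_continuous[OF C1_Xc[OF c]] lc] img B(2)
    by (auto simp: local_rep_def o_def)
  \<comment> \<open>The two-sided derivative is available only for 0 < t < 1, so the end points go
    into the finite exceptional set that \<open>valid_path\<close> allows.\<close>
  have "(X \<circ> (\<lambda>t. param c (?l t))) C1_differentiable_on ({0..1} - {0, 1})"
    unfolding C1_differentiable_on_def
    by (rule exI[of _ "\<lambda>t. dX c (?l t) (y - x)"]) (use vd in \<open>auto intro: continuous_on_subset[OF contd]\<close>)
  then have v: "valid_path (X \<circ> (\<lambda>t. param c (?l t)))"
    unfolding valid_path_def piecewise_C1_differentiable_on_def using Xcont by (intro conjI exI[of _ "{0, 1}"]) auto
  have "(speed (X \<circ> (\<lambda>t. param c (?l t))) has_integral integral {0..1} (\<lambda>t. norm (dX c (?l t) (y - x)))) {0..1}"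
  proof (rule has_integral_spike_finite[OF _ _ integrable_integral[OF int]])
    show "finite {0, 1::real}" by simp
    fix t :: real assume "t \<in> {0..1} - {0, 1}"
    then have "t \<in> {0<..<1}" by auto
    from vector_derivative_at[OF vd[OF this]]
    show "speed (X \<circ> (\<lambda>t. param c (?l t))) t = norm (dX c (?l t) (y - x))" by (simp add: speed_def)
  qed
  then show "curve X (\<lambda>t. param c (?l t)) (param c x) (param c y) (integral {0..1} (\<lambda>t. norm (dX c (?l t) (y - x))))"
    using pc v by (simp add: curve_def has_length_def pathstart_def pathfinish_def)
qed

text \<open>A curve is bounded from below by chords of \<open>X\<close>, since nothing is known about the differentiability of its
  coordinate representation.\<close>

lemma exit_length:
  assumes c: "c \<in> A" and p: "p \<in> fst c" and m: "m > 0" and sub: "cball (snd c p) r \<inter> half_plane \<subseteq> chart_image c"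
    and ex: "\<And>x y. x \<in> cball (snd c p) r \<inter> half_plane \<Longrightarrow> y \<in> cball (snd c p) r \<inter> half_plane \<Longrightarrow> m * norm (x - y) \<le> norm (local_rep c X x - local_rep c X y)"
    and s: "0 < s" "s \<le> r" and q: "q \<notin> param c ` (chart_image c \<inter> ball (snd c p) s)" and g: "curve X g p q l"
  shows "m * s \<le> l"
proof -
  let ?x0 = "snd c p"
  define O' where "O' = param c ` (chart_image c \<inter> ball ?x0 s)"
  define K where "K = param c ` (cball ?x0 s \<inter> half_plane)"
  have opn: "open O'" unfolding O'_def by (rule open_param_image[OF c open_ball])
  have sub': "cball ?x0 s \<inter> half_plane \<subseteq> chart_image c" using sub s by (auto simp: subset_iff)
  have "compact (cball ?x0 s \<inter> half_plane)" using closed_half_plane by (simp add: compact_Int_closed)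
  then have "compact K" unfolding K_def
    using chart_facts(3)[OF c] sub' by (intro compact_continuous_image) (auto simp: homeomorphism_def intro: continuous_on_subset)
  then have clK: "closed K" by (rule compact_imp_closed)
  have "O' \<subseteq> K" unfolding O'_def K_def using chart_facts(4)[OF c] by auto
  then have "closure O' \<subseteq> K" using clK closure_minimal by blast
  \<comment> \<open>A connected set that meets \<open>O'\<close> and leaves it crosses the frontier.
    Since \<open>K\<close> is compact and hence closed, frontier points stay in the chart, at
    coordinate distance exactly \<open>s\<close> from the centre.\<close>
  moreover have "path_image g \<inter> frontier O' \<noteq> {}"
  proof (rule connected_Int_frontier)
    show "connected (path_image g)" using g by (auto simp: curve_def intro: connected_path_image)
    have "p \<in> O'" unfolding O'_def using coord_in[OF c p] s c p by (intro image_eqI[of _ _ ?x0]) auto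
    moreover have "p \<in> path_image g" "q \<in> path_image g" using g by (auto simp: curve_def)
    ultimately show "path_image g \<inter> O' \<noteq> {}" "path_image g - O' \<noteq> {}" using q by (auto simp: O'_def)
  qed
  ultimately obtain z where z: "z \<in> path_image g" "z \<in> K" "z \<notin> O'"
    using interior_open[OF opn] by (auto simp: frontier_def)
  then obtain t where t: "0 \<le> t" "t \<le> 1" "z = g t" by (auto simp: path_image_def)
  obtain x where x: "x \<in> cball ?x0 s \<inter> half_plane" "z = param c x" using z(2) by (auto simp: K_def)
  have "x \<in> chart_image c" using x(1) sub' by blast
  then have "x \<notin> ball ?x0 s" using z(3) x(2) unfolding O'_def by blast
  then have "norm (x - ?x0) = s" using x by (auto simp: dist_norm norm_minus_commute)
  moreover have "?x0 \<in> cball ?x0 r \<inter> half_plane" using coord_in[OF c p] chart_facts(4)[OF c] s by auto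
  moreover have "x \<in> cball ?x0 r \<inter> half_plane" using x s by auto
  ultimately have "m * s \<le> norm (local_rep c X x - local_rep c X ?x0)" using ex[of x ?x0] by simp
  also have "\<dots> = norm (X (g t) - X p)" using x(2) t(3) by (simp add: local_rep_def c p)
  also have "\<dots> \<le> l" by (rule curve_length_ge(1)[OF g t(1,2)])
  finally show ?thesis .
qed

end

section \<open>The intrinsic distance\<close>

locale connected_surface = surface +
  assumes conn: "connected (UNIV :: 'a set)"
begin

abbreviation d where "d \<equiv> intrinsic_dist X"

text \<open>Being joined by a curve with a length is an equivalence relation with open classes, by
  the segments in small half discs, and connectedness leaves one class. The infimum defining the
  distance is therefore taken over a nonempty set.\<close>

lemma curve_exists: "\<exists>g l. curve X g p q l"
proof (rule connected_equivalence_relation[OF conn, of p q "\<lambda>p q. \<exists>g l. curve X g p q l"])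
  show "\<exists>g l. curve X g y x l" if "\<exists>g l. curve X g x y l" for x y using that curve_reverse by blast
  show "\<exists>g l. curve X g x z l" if "\<exists>g l. curve X g x y l" "\<exists>g l. curve X g y z l" for x y z using that curve_join by blast
  fix a
  let ?c = "chart_at A a" let ?x = "snd (chart_at A a) a"
  have c: "?c \<in> A" and a: "a \<in> fst ?c" by (rule chart_at)+
  obtain r where r: "r > 0" "cball ?x r \<inter> half_plane \<subseteq> chart_image ?c" using chart_nbhd[OF c coord_in[OF c a], of 1] by (metis zero_less_one)
  let ?T = "param ?c ` (chart_image ?c \<inter> ball ?x r)"
  have "open ?T" by (rule open_param_image[OF c open_ball])
  moreover have "a \<in> ?T" using r coord_in[OF c a] c a by (intro image_eqI[of _ _ ?x]) auto
  moreover have "\<exists>g l. curve X g a b l" if "b \<in> ?T" for b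
  proof -
    from that obtain y where y: "y \<in> chart_image ?c" "y \<in> ball ?x r" "b = param ?c y" by blast
    have "?x \<in> cball ?x r \<inter> half_plane" "y \<in> cball ?x r \<inter> half_plane" using y r coord_in[OF c a] chart_facts(4)[OF c] by auto
    from segment_curve(1)[OF c convex_half_ball r(2) this] show ?thesis using y(3) param_coord[OF c a] by metis
  qed
  ultimately show "\<exists>T. openin (top_of_set UNIV) T \<and> a \<in> T \<and> (\<forall>x\<in>T. \<exists>g l. curve X g a x l)" by auto
qed auto

lemma d_le: "curve X g p q l \<Longrightarrow> d p q \<le> l"
  unfolding intrinsic_dist_def curve_lengths_eq
  by (rule cInf_lower) (auto intro!: bdd_belowI[of _ 0] dest: curve_length_ge(2)[OF _ order_refl zero_le_one])

lemma d_segment: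
  assumes c: "c \<in> A" and B: "convex B" "B \<subseteq> chart_image c" and xy: "x \<in> B" "y \<in> B"
    and k: "\<And>z. z \<in> B \<Longrightarrow> norm (dX c z (y - x)) \<le> k"
  shows "d (param c x) (param c y) \<le> k"
proof -
  note sc = segment_curve[OF c B xy]
  have "integral {0..1} (\<lambda>t. norm (dX c (x + t *\<^sub>R (y - x)) (y - x))) \<le> integral {0..1} (\<lambda>t::real. k)"
  proof (rule integral_le[OF sc(2)])
    fix t :: real assume t: "t \<in> {0..1}"
    have "x + t *\<^sub>R (y - x) = (1 - t) *\<^sub>R x + t *\<^sub>R y" by (simp add: algebra_simps)
    then have "x + t *\<^sub>R (y - x) \<in> B" using convexD[OF B(1) xy, of "1 - t" t] t by simp
    then show "norm (dX c (x + t *\<^sub>R (y - x)) (y - x)) \<le> k" by (rule k)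
  qed (rule integrable_const_ivl)
  then show ?thesis using d_le[OF sc(1)] by simp
qed

lemma d_less: "d p q < a \<Longrightarrow> \<exists>g l. curve X g p q l \<and> l < a"
  unfolding intrinsic_dist_def curve_lengths_eq
  using cInf_lessD[of "{l. \<exists>g. curve X g p q l}" a] curve_exists[of p q] by blast

lemma d_ge: "(\<And>g l. curve X g p q l \<Longrightarrow> a \<le> l) \<Longrightarrow> a \<le> d p q"
  unfolding intrinsic_dist_def curve_lengths_eq using curve_exists[of p q] by (intro cInf_greatest) auto

lemma d_nonneg: "0 \<le> d p q"
  by (rule d_ge) (rule curve_length_ge(2)[OF _ order_refl zero_le_one])

lemma d_commute: "d p q = d q p"
  by (rule antisym) (rule d_ge, rule d_le, erule curve_reverse)+

lemma d_triangle: "d p r \<le> d p q + d q r"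
proof (rule field_le_epsilon)
  fix e :: real assume e: "e > 0"
  obtain f k where f: "curve X f p q k" "k < d p q + e / 2" using d_less[of p q "d p q + e / 2"] e by auto
  obtain g l where g: "curve X g q r l" "l < d q r + e / 2" using d_less[of q r "d q r + e / 2"] e by auto
  show "d p r \<le> d p q + d q r + e" using d_le[OF curve_join[OF f(1) g(1)]] f(2) g(2) by linarith
qed

lemma chord_le_d: "norm (X q - X p) \<le> d p q"
proof (rule d_ge)
  fix g l assume g: "curve X g p q l"
  have "X q = X (g 1)" using g by (auto simp: curve_def pathfinish_def)
  then show "norm (X q - X p) \<le> l" using curve_length_ge(1)[OF g, of 1] by simp
qed

text \<open>One half of the fact that \<open>d\<close> induces the given topology: leaving a
  coordinate disc of radius \<open>s\<close> costs a length of at least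
  \<open>m * s\<close>.\<close>

lemma d_small_imp_near:
  assumes U: "open U" "p \<in> U"
  shows "\<exists>e>0. \<forall>q. d p q < e \<longrightarrow> q \<in> U"
proof -
  let ?c = "chart_at A p" let ?x = "snd (chart_at A p) p"
  have c: "?c \<in> A" and p: "p \<in> fst ?c" by (rule chart_at)+
  from chart_expansion[OF c coord_in[OF c p]] obtain r m where r: "r > 0" "m > 0" "cball ?x r \<inter> half_plane \<subseteq> chart_image ?c"
    "\<And>x y. x \<in> cball ?x r \<inter> half_plane \<Longrightarrow> y \<in> cball ?x r \<inter> half_plane \<Longrightarrow> m * norm (x - y) \<le> norm (local_rep ?c X x - local_rep ?c X y)" by metis
  have "openin (top_of_set half_plane) (snd ?c ` (fst ?c \<inter> U))" by (rule openin_coord_image[OF c U(1)])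
  then obtain V where V: "open V" "snd ?c ` (fst ?c \<inter> U) = half_plane \<inter> V" using openin_open by blast
  have "?x \<in> V" using V(2) p U(2) by blast
  then obtain s' where s': "s' > 0" "ball ?x s' \<subseteq> V" using V(1) open_contains_ball by blast
  define s where "s = min s' r"
  have s: "0 < s" "s \<le> r" "s \<le> s'" using s' r by (auto simp: s_def)
  have sub: "param ?c ` (chart_image ?c \<inter> ball ?x s) \<subseteq> U"
  proof (rule image_subsetI)
    fix y assume y: "y \<in> chart_image ?c \<inter> ball ?x s"
    then have "y \<in> half_plane \<inter> V" using chart_facts(4)[OF c] s s' by auto
    then obtain q where "q \<in> fst ?c" "q \<in> U" "y = snd ?c q" unfolding V(2)[symmetric] by blast
    then show "param ?c y \<in> U" using c by simp
  qed
  have "q \<in> U" if q: "d p q < m * s" for q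
  proof (rule ccontr)
    assume "q \<notin> U"
    then have "q \<notin> param ?c ` (chart_image ?c \<inter> ball ?x s)" using sub by blast
    then have "m * s \<le> d p q" by (intro d_ge exit_length[OF c p r(2,3,4) s(1,2)])
    then show False using q by simp
  qed
  then show ?thesis using r(2) s(1) by (intro exI[of _ "m * s"]) auto
qed

text \<open>The other half: nearby points are joined by coordinate segments, and these are
  short.\<close>

lemma near_imp_d_small:
  assumes "e > 0"
  shows "\<exists>U. open U \<and> p \<in> U \<and> (\<forall>q\<in>U. d p q < e)"
proof -
  let ?c = "chart_at A p" let ?x = "snd (chart_at A p) p"
  have c: "?c \<in> A" and p: "p \<in> fst ?c" by (rule chart_at)+
  obtain r where r: "r > 0" "cball ?x r \<inter> half_plane \<subseteq> chart_image ?c"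
   "\<And>y h. y \<in> cball ?x r \<inter> half_plane \<Longrightarrow> norm (dX ?c y h - dX ?c ?x h) \<le> 1 * norm h"
    using chart_nbhd[OF c coord_in[OF c p], of 1] by (metis zero_less_one)
  obtain M where M: "M > 0" "\<And>h. norm (dX ?c ?x h) \<le> M * norm h"
    using linear_bounded_pos[OF linear_dX] by metis
  \<comment> \<open>On the half disc all differentials are bounded by M + 1, so segments of
    coordinate length below \<open>s\<close> have length at most e/2.\<close>
  define s where "s = min r (e / (2 * (M + 1)))"
  have s: "0 < s" "s \<le> r" using r assms M(1) by (auto simp: s_def)
  have "s * (M + 1) \<le> e / (2 * (M + 1)) * (M + 1)" using M(1) by (intro mult_right_mono) (auto simp: s_def)
  moreover have "e / (2 * k) * k = e / 2" if "k \<noteq> 0" for k :: real using that by simp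
  ultimately have s2: "s * (M + 1) \<le> e / 2" using M(1) by (metis add_pos_pos less_irrefl zero_less_one)
  let ?T = "param ?c ` (chart_image ?c \<inter> ball ?x s)"
  have "d p q < e" if "q \<in> ?T" for q
  proof -
    from that obtain y where y: "y \<in> chart_image ?c" "y \<in> ball ?x s" "q = param ?c y" by blast
    have xy: "?x \<in> cball ?x r \<inter> half_plane" "y \<in> cball ?x r \<inter> half_plane" using y r s coord_in[OF c p] chart_facts(4)[OF c] by auto
    have "d (param ?c ?x) (param ?c y) \<le> s * (M + 1)"
    proof (rule d_segment[OF c convex_half_ball r(2) xy])
      fix z assume z: "z \<in> cball ?x r \<inter> half_plane"
      have "norm (dX ?c z (y - ?x)) \<le> norm (dX ?c ?x (y - ?x)) + norm (dX ?c z (y - ?x) - dX ?c ?x (y - ?x))"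
        by (metis norm_triangle_sub)
      also have "\<dots> \<le> M * norm (y - ?x) + 1 * norm (y - ?x)" by (intro add_mono M r(3) z)
      also have "\<dots> = norm (y - ?x) * (M + 1)" by (simp add: algebra_simps)
      also have "\<dots> \<le> s * (M + 1)" using y(2) M by (intro mult_right_mono) (auto simp: dist_norm norm_minus_commute)
      finally show "norm (dX ?c z (y - ?x)) \<le> s * (M + 1)" .
    qed
    then show ?thesis using s2 assms y(3) param_coord[OF c p] by simp
  qed
  moreover have "open ?T" by (rule open_param_image[OF c open_ball])
  moreover have "p \<in> ?T" using s coord_in[OF c p] c p by (intro image_eqI[of _ _ ?x]) auto
  ultimately show ?thesis by blast
qed

sublocale M: Metric_space UNIV d
proof
  show "d x y = 0 \<longleftrightarrow> x = y" for x y
  proof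
    assume xy: "d x y = 0"
    show "x = y"
    proof (rule ccontr)
      assume "x \<noteq> y"
      then obtain U where "open U" "x \<in> U" "y \<notin> U" using t1_space by metis
      then show False using d_small_imp_near[of U x] xy by force
    qed
  next
    assume "x = y"
    have "d x x \<le> 0"
    proof (rule field_le_epsilon)
      fix e :: real assume "e > 0"
      then show "d x x \<le> 0 + e" using near_imp_d_small[of e x] by force
    qed
    then show "d x y = 0" using d_nonneg[of x x] \<open>x = y\<close> by simp
  qed
  show "0 \<le> d x y" for x y by (rule d_nonneg)
  show "d x y = d y x" for x y by (rule d_commute)
  show "d x z \<le> d x y + d y z" for x y z by (rule d_triangle)
qed

lemma continuous_d: "continuous_on UNIV (d p)"
  unfolding continuous_on_eq_continuous_at[OF open_UNIV] continuous_at tendsto_iff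
proof (intro ballI allI impI)
  fix x and e :: real assume "0 < e"
  then obtain U where U: "open U" "x \<in> U" "\<And>q. q \<in> U \<Longrightarrow> d x q < e" using near_imp_d_small[of e x] by blast
  have "dist (d p q) (d p x) < e" if "q \<in> U" for q
    using U(3)[OF that] d_triangle[of p q x] d_triangle[of p x q] d_commute[of x q] by (auto simp: dist_real_def)
  then show "\<forall>\<^sub>F q in at x. dist (d p q) (d p x) < e"
    using U(1,2) by (auto simp: eventually_at_topological)
qed

section \<open>Compactness of closed intrinsic balls\<close>

definition dball :: "'a \<Rightarrow> real \<Rightarrow> 'a set" where "dball p r = {q. d p q \<le> r}"

lemma closed_dball: "closed (dball p r)"
  unfolding dball_def using continuous_d by (intro closed_Collect_le continuous_intros)

lemma open_d_ball: "open {q. d p q < r}"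
  using continuous_d by (intro open_Collect_less continuous_intros)

lemma compact_dball_subset: "compact (dball p r) \<Longrightarrow> dball q s \<subseteq> dball p r \<Longrightarrow> compact (dball q s)"
  by (metis closed_dball compact_Int_closed inf.absorb_iff2)

text \<open>Arc length along a nearly shortest curve is continuous in the parameter, so some point
  splits the curve at length \<open>a\<close>; if the whole curve is no longer than
  \<open>a\<close>, its end point serves. This property of length spaces takes the place of
  minimizing geodesics.\<close>

lemma d_intermediate:
  assumes "d p q < a + b" "0 < a" "0 < b"
  shows "\<exists>z. d p z \<le> a \<and> d z q < b"
proof -
  obtain g l where g: "curve X g p q l" "l < a + b" using d_less[OF assms(1)] by blast
  show ?thesis
  proof (cases "l \<le> a")
    case True
    then show ?thesis using d_le[OF g(1)] assms by (intro exI[of _ q]) auto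
  next
    case False
    let ?s = "speed (X \<circ> g)"
    have h: "(?s has_integral l) {0..1}" using g by (simp add: curve_def has_length_def)
    then have int: "?s integrable_on {0..1}" by blast
    have "\<exists>t\<ge>0. t \<le> 1 \<and> integral {0..t} ?s = a"
    proof (rule IVT')
      show "integral {0..0} ?s \<le> a" using assms by simp
      show "a \<le> integral {0..1} ?s" using False h by (simp add: integral_unique)
      show "continuous_on {0..1} (\<lambda>t. integral {0..t} ?s)" by (rule indefinite_integral_continuous_1[OF int])
    qed simp
    then obtain t where t: "0 \<le> t" "t \<le> 1" "integral {0..t} ?s = a" by blast
    have "integral {0..t} ?s + integral {t..1} ?s = l"
      using Henstock_Kurzweil_Integration.integral_combine[OF t(1,2) int] h by (simp add: integral_unique)
    then have l: "integral {t..1} ?s = l - a" using t by simp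
    have e: "g 0 = p" "g 1 = q" using g(1) by (auto simp: curve_def pathstart_def pathfinish_def)
    have "d p (g t) \<le> a" using d_le[OF curve_subpath[OF g(1), of 0 t]] e t by simp
    moreover have "d (g t) q \<le> l - a" using d_le[OF curve_subpath[OF g(1), of t 1]] e l t by simp
    ultimately show ?thesis using g(2) by (intro exI[of _ "g t"]) auto
  qed
qed

text \<open>Finitely many balls of radius s/4 cover the compact ball. By
  \<open>d_intermediate\<close> a point at distance up to r + s/2 is within 3 s/4 of that ball,
  hence within \<open>s\<close> of one of finitely many centres.\<close>

lemma compact_dball_extend:
  assumes r: "0 < r" and s: "0 < s" and K: "compact (dball p r)" and Kq: "\<And>q. q \<in> dball p r \<Longrightarrow> compact (dball q s)"
  shows "compact (dball p (r + s / 2))"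
proof -
  have "dball p r \<subseteq> (\<Union>q\<in>dball p r. {z. d q z < s / 4})" using s by auto
  then obtain D where D: "D \<subseteq> dball p r" "finite D" "dball p r \<subseteq> (\<Union>q\<in>D. {z. d q z < s / 4})"
    using compactE_image[OF K, of "dball p r" "\<lambda>q. {z. d q z < s / 4}"] open_d_ball by blast
  have "dball p (r + s / 2) \<subseteq> (\<Union>q\<in>D. dball q s)"
  proof
    fix z assume "z \<in> dball p (r + s / 2)"
    then have "d p z < r + 3 * s / 4" using s by (simp add: dball_def)
    then obtain y where y: "d p y \<le> r" "d y z < 3 * s / 4" using d_intermediate[of p z r "3 * s / 4"] r s by auto
    then obtain q where q: "q \<in> D" "d q y < s / 4" using D(3) by (auto simp: dball_def)
    have "d q z \<le> s" using d_triangle[of q z y] q y by simp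
    then show "z \<in> (\<Union>q\<in>D. dball q s)" using q by (auto simp: dball_def)
  qed
  moreover have "compact (\<Union>q\<in>D. dball q s)" using D Kq by (intro compact_UN) auto
  ultimately show ?thesis by (metis closed_dball compact_Int_closed inf.absorb_iff2)
qed

text \<open>Otherwise compactness would spread from radius r/2 to 3 r/4 and then to
  \<open>r\<close>, by two extensions with s = r/2. The centres used stay within distance
  \<open>r\<close>.\<close>

lemma noncompact_dball_halve:
  assumes r: "0 < r" and nc: "\<not> compact (dball p r)"
  shows "\<exists>q. d p q \<le> r \<and> \<not> compact (dball q (r / 2))"
proof (rule ccontr)
  assume "\<nexists>q. d p q \<le> r \<and> \<not> compact (dball q (r / 2))"
  then have K: "compact (dball q (r / 2))" if "d p q \<le> r" for q using that by blast
  have "compact (dball p (r / 2))" using K[of p] r by simp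
  then have "compact (dball p (r / 2 + (r / 2) / 2))"
    by (rule compact_dball_extend[rotated 2]) (use r K in \<open>auto simp: dball_def\<close>)
  then have "compact (dball p ((r / 2 + (r / 2) / 2) + (r / 2) / 2))"
    by (rule compact_dball_extend[rotated 2]) (use r K in \<open>auto simp: dball_def\<close>)
  then show False using nc by simp
qed

lemma locally_compact_dball: "\<exists>e>0. compact (dball p e)"
proof -
  let ?c = "chart_at A p" let ?x = "snd (chart_at A p) p"
  have c: "?c \<in> A" and p: "p \<in> fst ?c" by (rule chart_at)+
  obtain r where r: "r > 0" "cball ?x r \<inter> half_plane \<subseteq> chart_image ?c"
    using chart_nbhd[OF c coord_in[OF c p], of 1] by (metis zero_less_one)
  let ?T = "param ?c ` (chart_image ?c \<inter> ball ?x r)" let ?K = "param ?c ` (cball ?x r \<inter> half_plane)"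
  have "open ?T" by (rule open_param_image[OF c open_ball])
  moreover have "p \<in> ?T" using r coord_in[OF c p] c p by (intro image_eqI[of _ _ ?x]) auto
  ultimately have "\<exists>e>0. \<forall>q. d p q < e \<longrightarrow> q \<in> ?T" by (rule d_small_imp_near)
  then obtain e where e: "e > 0" "\<And>q. d p q < e \<Longrightarrow> q \<in> ?T" by blast
  have "?T \<subseteq> ?K" using chart_facts(4)[OF c] by auto
  have "dball p (e / 2) \<subseteq> ?K"
  proof
    fix q assume "q \<in> dball p (e / 2)"
    then have "d p q < e" using e(1) by (simp add: dball_def)
    from \<open>?T \<subseteq> ?K\<close> e(2)[OF this] show "q \<in> ?K" by (rule subsetD)
  qed
  moreover have "compact ?K"
  proof (rule compact_continuous_image)
    show "continuous_on (cball ?x r \<inter> half_plane) (param ?c)"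
      by (rule continuous_on_subset[OF homeomorphism_cont2[OF chart_facts(3)[OF c]] r(2)])
    note closed_half_plane
    then show "compact (cball ?x r \<inter> half_plane)" by (simp add: compact_Int_closed)
  qed
  ultimately have "compact (dball p (e / 2))" by (metis closed_dball compact_Int_closed inf.absorb_iff2)
  then show ?thesis using e(1) by (intro exI[of _ "e / 2"]) simp
qed

text \<open>Repeated halving gives noncompact balls of radii r/2^n whose centres move by at most
  r/2^n, hence a Cauchy sequence. Its limit has a compact ball by local compactness, and that ball
  swallows a late member of the sequence of noncompact ones.\<close>

lemma compact_dball:
  assumes comp: "complete_surface X"
  shows "compact (dball p r)"
proof (rule ccontr)
  assume nc: "\<not> compact (dball p r)"
  have r: "r > 0"
  proof (rule ccontr)
    assume "\<not> r > 0"
    obtain e where "e > 0" "compact (dball p e)" using locally_compact_dball by blast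
    moreover from this have "dball p r \<subseteq> dball p e" using \<open>\<not> r > 0\<close> by (auto simp: dball_def)
    ultimately show False using nc compact_dball_subset by blast
  qed
  have "\<exists>\<sigma>. \<forall>n. \<not> compact (dball (\<sigma> n) (r / 2 ^ n)) \<and> d (\<sigma> n) (\<sigma> (Suc n)) \<le> r / 2 ^ n"
  proof (rule dependent_nat_choice)
    show "\<exists>x. \<not> compact (dball x (r / 2 ^ 0))" using nc by auto
    fix x n assume "\<not> compact (dball x (r / 2 ^ n))"
    then show "\<exists>y. \<not> compact (dball y (r / 2 ^ Suc n)) \<and> d x y \<le> r / 2 ^ n"
      using noncompact_dball_halve[of "r / 2 ^ n" x] r by (auto simp: field_simps)
  qed
  then obtain \<sigma> where \<sigma>: "\<And>n. \<not> compact (dball (\<sigma> n) (r / 2 ^ n))" "\<And>n. d (\<sigma> n) (\<sigma> (Suc n)) \<le> r / 2 ^ n" by blast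
  \<comment> \<open>The subtracted tail makes the induction close; the bound 2 r / 2^n by itself
    would not be inductive.\<close>
  have dist: "d (\<sigma> n) (\<sigma> (n + k)) \<le> 2 * r / 2 ^ n - 2 * r / 2 ^ (n + k)" for n k
  proof (induction k)
    case (Suc k)
    have "d (\<sigma> n) (\<sigma> (n + Suc k)) \<le> d (\<sigma> n) (\<sigma> (n + k)) + d (\<sigma> (n + k)) (\<sigma> (Suc (n + k)))"
      using d_triangle[of "\<sigma> n" "\<sigma> (n + Suc k)" "\<sigma> (n + k)"] by simp
    also have "\<dots> \<le> 2 * r / 2 ^ n - 2 * r / 2 ^ (n + k) + r / 2 ^ (n + k)" by (intro add_mono Suc \<sigma>)
    finally show ?case by (simp add: field_simps)
  qed simp
  have tail: "d (\<sigma> n) (\<sigma> m) \<le> 2 * r / 2 ^ n" if "n \<le> m" for n m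
    using dist[of n "m - n"] that r by (smt (verit) divide_nonneg_pos le_add_diff_inverse zero_less_power)
  have lim0: "(\<lambda>n. 2 * r / 2 ^ n) \<longlonglongrightarrow> 0" by real_asymp
  have "M.MCauchy \<sigma>"
    unfolding M.MCauchy_def
  proof (intro conjI allI impI)
    fix e :: real assume e: "e > 0"
    obtain n0 where n0: "2 * r / 2 ^ n0 < e / 2"
      using order_tendstoD(2)[OF lim0, of "e / 2"] e by (auto simp: eventually_sequentially)
    have "d (\<sigma> n) (\<sigma> m) < e" if "n0 \<le> n" "n0 \<le> m" for n m
      using tail[OF that(1)] tail[OF that(2)] d_triangle[of "\<sigma> n" "\<sigma> m" "\<sigma> n0"] d_commute[of "\<sigma> n" "\<sigma> n0"] n0 by linarith
    then show "\<exists>N. \<forall>n n'. N \<le> n \<longrightarrow> N \<le> n' \<longrightarrow> d (\<sigma> n) (\<sigma> n') < e" by blast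
  qed simp
  then obtain x where x: "limitin M.mtopology \<sigma> x sequentially"
    using comp unfolding complete_surface_def M.mcomplete_def by blast
  obtain e where e: "e > 0" "compact (dball x e)" using locally_compact_dball by blast
  have "\<forall>\<^sub>F n in sequentially. d (\<sigma> n) x < e / 2"
    using x e(1) unfolding M.limit_metric_sequentially eventually_sequentially by (meson half_gt_zero)
  moreover have "\<forall>\<^sub>F n in sequentially. 2 * r / 2 ^ n < e / 2"
    using order_tendstoD(2)[OF lim0, of "e / 2"] e by simp
  ultimately have "\<forall>\<^sub>F n in sequentially. d (\<sigma> n) x < e / 2 \<and> 2 * r / 2 ^ n < e / 2" by (rule eventually_conj)
  then obtain n where n: "d (\<sigma> n) x < e / 2" "2 * r / 2 ^ n < e / 2" by (auto simp: eventually_sequentially)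
  have "dball (\<sigma> n) (r / 2 ^ n) \<subseteq> dball x e"
  proof
    fix z assume "z \<in> dball (\<sigma> n) (r / 2 ^ n)"
    then have "d (\<sigma> n) z \<le> r / 2 ^ n" by (simp add: dball_def)
    moreover have "0 \<le> r / 2 ^ n" "2 * r / 2 ^ n = 2 * (r / 2 ^ n)" using r by auto
    ultimately show "z \<in> dball x e" using n d_triangle[of x z "\<sigma> n"] d_commute[of x "\<sigma> n"] by (simp add: dball_def)
  qed
  then show False using compact_dball_subset[OF e(2)] \<sigma>(1) by blast
qed

text \<open>\<open>B\<close> lies in some ball of radius \<open>R0\<close> around a base point. The
  ball with radius larger by \<open>R\<close> is compact, so it is not the whole surface, and the
  triangle inequality separates any point outside it from \<open>B\<close>.\<close>

lemma far_point:
  assumes comp: "complete_surface X" and nc: "\<not> compact (UNIV :: 'a set)" and B: "compact (B :: 'a set)"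
  shows "\<exists>p. \<forall>q\<in>B. R < d p q"
proof -
  fix p0 :: 'a
  have "compact (d p0 ` B)" by (intro compact_continuous_image B continuous_on_subset[OF continuous_d]) auto
  then obtain R0 where R0: "\<And>q. q \<in> B \<Longrightarrow> d p0 q \<le> R0"
    using compact_imp_bounded bounded_real by (metis abs_le_D1 imageI)
  have "dball p0 (R0 + R) \<noteq> UNIV" using nc compact_dball[OF comp] by metis
  then have "\<exists>p. p \<notin> dball p0 (R0 + R)" by blast
  then obtain p where "d p0 p > R0 + R" unfolding dball_def by (auto simp: not_le)
  then have "R < d p q" if "q \<in> B" for q using R0[OF that] d_triangle[of p0 p q] d_commute[of p q] by linarith
  then show ?thesis by blast
qed

end

section \<open>The first variation in a chart\<close>

text \<open>With n = a x b, the vectors b x n and n x a are dual to \<open>a\<close> and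
  \<open>b\<close> up to the factor |n|^2, so both sides are |n|^2 times the projection of
  \<open>y\<close> to their plane.\<close>

lemma tangential_identity:
  "(y \<bullet> cross3 b (cross3 a b)) *\<^sub>R a + (y \<bullet> cross3 (cross3 a b) a) *\<^sub>R b
     = (cross3 a b \<bullet> cross3 a b) *\<^sub>R y - (y \<bullet> cross3 a b) *\<^sub>R cross3 a b"
  by (simp add: cross3_simps forall_3)

lemma norm_orthogonal_part_le:
  fixes y n :: "'b::real_inner"
  assumes "n \<bullet> n = 1"
  shows "norm (y - (y \<bullet> n) *\<^sub>R n) \<le> norm y"
proof -
  have "(norm (y - (y \<bullet> n) *\<^sub>R n))\<^sup>2 = (norm y)\<^sup>2 - (y \<bullet> n)\<^sup>2"
    unfolding power2_norm_eq_inner using assms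
    by (simp add: inner_diff_left inner_diff_right inner_commute[of n y] power2_eq_square)
  then have "(norm (y - (y \<bullet> n) *\<^sub>R n))\<^sup>2 \<le> (norm y)\<^sup>2" by simp
  then show ?thesis by (rule power2_le_imp_le) simp
qed

section \<open>Minimality in divergence form and the radial field\<close>

context surface
begin

text \<open>Away from the edge the chart image is open in the plane, so that fields supported there
  can be extended by zero and second derivatives commute.\<close>

definition int_image where "int_image c = chart_image c \<inter> {x. 0 < snd x}"

lemma open_int_image: "c \<in> A \<Longrightarrow> open (int_image c)"
  unfolding int_image_def by (rule openin_half_plane_interior[OF chart_facts(2)])

lemma C1_fun_localI:
  assumes "\<And>c x. c \<in> A \<Longrightarrow> x \<in> chart_image c \<Longrightarrow> \<exists>T gu gv. openin (top_of_set half_plane) T \<and> x \<in> T \<and> T \<subseteq> chart_image c \<and> C1_on T (local_rep c f) gu gv"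
  shows "C1_fun A f"
  unfolding C1_fun_def
proof
  fix c assume c: "c \<in> A"
  show "C1_on (chart_image c) (local_rep c f) (partial_u (local_rep c f)) (partial_v (local_rep c f))"
  proof (rule C1_on_local)
    fix x assume "x \<in> chart_image c"
    from assms[OF c this] obtain T gu gv where T: "openin (top_of_set half_plane) T" "x \<in> T" "T \<subseteq> chart_image c" "C1_on T (local_rep c f) gu gv" by blast
    have "C1_on T (local_rep c f) (partial_u (local_rep c f)) (partial_v (local_rep c f))"
      by (rule C1_on_cong[OF T(4) refl]) (use partial_eqI[OF T(1,4)] in auto)
    moreover have "openin (top_of_set (chart_image c)) T"
      using T(1,3) chart_facts(4)[OF c] by (meson openin_subset_trans)
    ultimately show "\<exists>T. openin (top_of_set (chart_image c)) T \<and> x \<in> T \<and> C1_on T (local_rep c f) (partial_u (local_rep c f)) (partial_v (local_rep c f))"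
      using T(2) by blast
  qed
qed

lemma local_rep_apply: "local_rep c f x = f (param c x)"
  by (simp add: local_rep_def)

lemma C1_fun_const: "C1_fun A (\<lambda>p. k)"
  by (rule C1_funI) (auto simp: local_rep_def o_def intro!: exI C1_on_const)

lemma C1_fun_mult:
  fixes f g :: "'a \<Rightarrow> real"
  assumes "C1_fun A f" "C1_fun A g" shows "C1_fun A (\<lambda>p. f p * g p)"
proof (rule C1_funI)
  fix c assume c: "c \<in> A"
  show "\<exists>u v. C1_on (chart_image c) (local_rep c (\<lambda>p. f p * g p)) u v"
    using C1_on_bilinear[OF bounded_bilinear_mult C1_funD[OF assms(1) c] C1_funD[OF assms(2) c]]
    unfolding local_rep_def o_def by blast
qed

lemma C1_fun_diff:
  fixes f g :: "'a \<Rightarrow> real"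
  assumes "C1_fun A f" "C1_fun A g" shows "C1_fun A (\<lambda>p. f p - g p)"
proof (rule C1_funI)
  fix c assume c: "c \<in> A"
  have "C1_on (chart_image c) (\<lambda>x. local_rep c f x + - local_rep c g x) (\<lambda>x. partial_u (local_rep c f) x + - partial_u (local_rep c g) x)
    (\<lambda>x. partial_v (local_rep c f) x + - partial_v (local_rep c g) x)"
    by (intro C1_on_add C1_on_linear[of uminus] bounded_linear_minus[OF bounded_linear_ident] C1_funD assms c)
  then show "\<exists>u v. C1_on (chart_image c) (local_rep c (\<lambda>p. f p - g p)) u v"
    unfolding local_rep_def o_def by auto
qed

lemma C1_fun_continuous:
  assumes "C1_fun A f" shows "continuous_on UNIV f"
proof -
  have "continuous_on (\<Union>c\<in>A. fst c) f"
  proof (rule continuous_on_open_UN)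
    fix c assume c: "c \<in> A"
    have "continuous_on (fst c) (\<lambda>p. local_rep c f (snd c p))"
      by (rule continuous_on_compose2[OF C1_on_continuous[OF C1_funD[OF assms c]] homeomorphism_cont1[OF chart_facts(3)[OF c]]])
        (use coord_in[OF c] in auto)
    then show "continuous_on (fst c) f" by (rule continuous_on_eq) (simp add: local_rep_def c)
    show "open (fst c)" by (rule chart_facts(1)[OF c])
  qed
  then show ?thesis using atlas by (simp add: smooth_atlas_def)
qed

text \<open>\<open>P\<close> and \<open>Q\<close> are the area density times the dual basis of the
  coordinate vectors: pairing a vector with them gives the coordinates of its tangential part,
  multiplied by the area density. As cross products they can be differentiated without touching the
  inverse metric.\<close>

definition P where "P c x = cross3 (Xv c x) (local_rep c N x)"
definition Q where "Q c x = cross3 (local_rep c N x) (Xu c x)"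

lemma N_chart: "c \<in> A \<Longrightarrow> x \<in> chart_image c \<Longrightarrow> local_rep c N x = (1 / norm (nrm c x)) *\<^sub>R nrm c x"
  using unit_normal_chart by (simp add: local_rep_def sgn_div_norm divide_inverse)

lemma XP: 
  assumes "c \<in> A" "x \<in> chart_image c"
  shows "Xu c x \<bullet> P c x = norm (nrm c x)" "Xv c x \<bullet> Q c x = norm (nrm c x)"
proof -
  have "Xu c x \<bullet> cross3 (Xv c x) (nrm c x) = nrm c x \<bullet> nrm c x" "Xv c x \<bullet> cross3 (nrm c x) (Xu c x) = nrm c x \<bullet> nrm c x"
    unfolding nrm_def by (simp_all add: cross3_simps)
  then show "Xu c x \<bullet> P c x = norm (nrm c x)" "Xv c x \<bullet> Q c x = norm (nrm c x)"
    unfolding P_def Q_def N_chart[OF assms] using nrm_nonzero[OF assms]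
    by (simp_all add: cross_mult_left cross_mult_right dot_square_norm power2_eq_square)
qed

lemma C1_P: "c \<in> A \<Longrightarrow> C1_on (chart_image c) (P c) (\<lambda>x. cross3 (Xv c x) (Nu c x) + cross3 (partial_u (Xv c) x) (local_rep c N x))
     (\<lambda>x. cross3 (Xv c x) (Nv c x) + cross3 (partial_v (Xv c) x) (local_rep c N x))"
  and C1_Q: "c \<in> A \<Longrightarrow> C1_on (chart_image c) (Q c) (\<lambda>x. cross3 (local_rep c N x) (partial_u (Xu c) x) + cross3 (Nu c x) (Xu c x))
     (\<lambda>x. cross3 (local_rep c N x) (partial_v (Xu c) x) + cross3 (Nv c x) (Xu c x))"
  unfolding P_def[abs_def] Q_def[abs_def]
  by (intro C1_on_bilinear bounded_bilinear_cross3 C1_Xu C1_Xv C1_Nc; assumption)+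

text \<open>This is the harmonicity of \<open>X\<close> in coordinates. The mixed second derivatives
  of \<open>X\<close> enter with opposite signs and cancel, and what is left is minus the expression
  that vanishes by \<open>minimal_chart\<close>.\<close>

lemma div_PQ:
  assumes m: "minimal A X" and c: "c \<in> A" and x: "x \<in> int_image c"
  shows "(cross3 (Xv c x) (Nu c x) + cross3 (partial_u (Xv c) x) (local_rep c N x))
     + (cross3 (local_rep c N x) (partial_v (Xu c) x) + cross3 (Nv c x) (Xu c x)) = 0"
proof -
  have sub: "int_image c \<subseteq> chart_image c" by (auto simp: int_image_def)
  have "partial_v (Xu c) x = partial_u (Xv c) x"
    by (rule mixed_partials[OF open_int_image[OF c] C1_on_subset[OF C1_Xc[OF c] sub]
         C1_on_subset[OF C1_Xu[OF c] sub] C1_on_subset[OF C1_Xv[OF c] sub] x])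
  then have z1: "cross3 (partial_u (Xv c) x) (local_rep c N x) + cross3 (local_rep c N x) (partial_v (Xu c) x) = 0"
    by (simp add: cross_skew[of "partial_u (Xv c) x"])
  have "cross3 (Xv c x) (Nu c x) + cross3 (Nv c x) (Xu c x) = - (cross3 (Nu c x) (Xv c x) + cross3 (Xu c x) (Nv c x))"
    unfolding cross_skew[of "Xv c x" "Nu c x"] cross_skew[of "Nv c x" "Xu c x"] by simp
  also have "cross3 (Nu c x) (Xv c x) + cross3 (Xu c x) (Nv c x) = 0"
    by (rule minimal_chart[OF m c]) (use x in \<open>auto simp: int_image_def\<close>)
  finally have z2: "cross3 (Xv c x) (Nu c x) + cross3 (Nv c x) (Xu c x) = 0" by simp
  have comm: "(s + t) + (u + v) = (t + u) + (s + v)" for s t u v :: "real^3" by simp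
  show ?thesis by (rule trans[OF comm]) (simp only: z1 z2 add_0)
qed

text \<open>The coordinate components of the tangential part of X - a, as \<open>dX_wv\<close>
  confirms.\<close>

definition radial_coord where "radial_coord a c x = (1 / norm (nrm c x)) *\<^sub>R ((local_rep c X x - a) \<bullet> P c x, (local_rep c X x - a) \<bullet> Q c x)"

lemma dX_wv:
  assumes "c \<in> A" "x \<in> chart_image c"
  shows "dX c x (radial_coord a c x) = (local_rep c X x - a) - ((local_rep c X x - a) \<bullet> local_rep c N x) *\<^sub>R local_rep c N x"
proof -
  let ?y = "local_rep c X x - a" and ?n = "nrm c x"
  have n0: "norm ?n \<noteq> 0" using nrm_nonzero[OF assms] by simp
  have "dX c x (radial_coord a c x) = (1 / (norm ?n)^2) *\<^sub>R ((?y \<bullet> cross3 (Xv c x) ?n) *\<^sub>R Xu c x + (?y \<bullet> cross3 ?n (Xu c x)) *\<^sub>R Xv c x)"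
    unfolding dX_def radial_coord_def P_def Q_def N_chart[OF assms]
    by (simp add: cross_mult_left cross_mult_right scaleR_add_right power2_eq_square)
  also have "\<dots> = (1 / (norm ?n)^2) *\<^sub>R ((?n \<bullet> ?n) *\<^sub>R ?y - (?y \<bullet> ?n) *\<^sub>R ?n)"
    unfolding nrm_def tangential_identity ..
  also have "\<dots> = ?y - (?y \<bullet> local_rep c N x) *\<^sub>R local_rep c N x"
    unfolding N_chart[OF assms] using n0 by (simp add: scaleR_diff_right dot_square_norm power2_eq_square)
  finally show ?thesis .
qed

lemma norm_dX_wv:
  assumes "c \<in> A" "x \<in> chart_image c"
  shows "norm (dX c x (radial_coord a c x)) \<le> norm (local_rep c X x - a)"
  unfolding dX_wv[OF assms] by (rule norm_orthogonal_part_le) (simp add: local_rep_def norm_N)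

text \<open>The inner product of the gradient of \<open>f\<close> with X - a. It is computed in the
  chosen chart, and only independence of that choice makes it a continuous function on the
  surface.\<close>

definition radial_deriv :: "real^3 \<Rightarrow> ('a \<Rightarrow> real) \<Rightarrow> 'a \<Rightarrow> real" where
  "radial_deriv a f p = (let c = chart_at A p; x = snd c p in
     fst (radial_coord a c x) * partial_u (local_rep c f) x + snd (radial_coord a c x) * partial_v (local_rep c f) x)"

text \<open>By \<open>dX_wv\<close> both charts describe the same tangent vector, and the
  differential is injective, so the two coordinate vectors correspond under the transition map; the
  chain rule does the rest.\<close>

lemma radial_deriv_chart:
  assumes f: "C1_fun A f" and c: "c \<in> A" and x: "x \<in> chart_image c"
  shows "radial_deriv a f (param c x) = fst (radial_coord a c x) * partial_u (local_rep c f) x + snd (radial_coord a c x) * partial_v (local_rep c f) x"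
proof -
  define p where "p = param c x"
  let ?d = "chart_at A p"
  have p: "p \<in> fst c" "snd c p = x" using param_in[OF c x] c x by (auto simp: p_def)
  have xo: "x \<in> overlap c ?d" unfolding overlap_def using p chart_at(2)[of p] by blast
  define y where "y = snd ?d p"
  have tr: "trans c ?d x = y" by (simp add: trans_def local_rep_def p_def y_def)
  have yi: "y \<in> chart_image ?d" unfolding y_def by (rule coord_in[OF chart_at])
  let ?tu = "partial_u (trans c ?d) x" and ?tv = "partial_v (trans c ?d) x"
  define h where "h = fst (radial_coord a c x) *\<^sub>R ?tu + snd (radial_coord a c x) *\<^sub>R ?tv"
  have "dX ?d y h = dX c x (radial_coord a c x)"
    unfolding dX_def Xu_def Xv_def partial_trans[OF C1_X c chart_at(1) xo] tr h_def
    by (simp add: algebra_simps)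
  also have "\<dots> = dX ?d y (radial_coord a ?d y)"
    unfolding dX_wv[OF c x] dX_wv[OF chart_at(1) yi] overlap(5)[OF c chart_at(1) xo, of X] overlap(5)[OF c chart_at(1) xo, of N] tr ..
  finally have "dX ?d y (h - radial_coord a ?d y) = 0" by (simp add: linear_diff[OF linear_dX])
  moreover obtain m where "m > 0" "\<And>h. m * norm h \<le> norm (dX ?d y h)" using dX_bounded_below[OF chart_at(1) yi] by blast
  ultimately have "m * norm (h - radial_coord a ?d y) \<le> 0" "m > 0" by (metis norm_zero)+
  then have h: "radial_coord a ?d y = h" by (simp add: mult_le_0_iff)
  have "radial_deriv a f p = fst h * partial_u (local_rep ?d f) y + snd h * partial_v (local_rep ?d f) y"
    unfolding radial_deriv_def Let_def y_def[symmetric] h ..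
  also have "\<dots> = fst (radial_coord a c x) * partial_u (local_rep c f) x + snd (radial_coord a c x) * partial_v (local_rep c f) x"
    unfolding partial_trans[OF f c chart_at(1) xo] tr h_def by (simp add: algebra_simps)
  finally show ?thesis by (simp add: p_def)
qed

lemma continuous_wv:
  assumes c: "c \<in> A" shows "continuous_on (chart_image c) (radial_coord a c)"
proof -
  have n: "norm (nrm c x) \<noteq> 0" if "x \<in> chart_image c" for x using nrm_nonzero[OF c that] by simp
  show ?thesis
    unfolding radial_coord_def[abs_def] using n
    by (intro continuous_intros continuous_on_inner nrm_continuous[OF c] C1_on_continuous[OF C1_P[OF c]] C1_on_continuous[OF C1_Q[OF c]] C1_on_continuous[OF C1_Xc[OF c]]) auto
qed

lemma continuous_radial_deriv:
  assumes f: "C1_fun A f" shows "continuous_on UNIV (radial_deriv a f)"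
proof -
  have "continuous_on (\<Union>c\<in>A. fst c) (radial_deriv a f)"
  proof (rule continuous_on_open_UN)
    fix c assume c: "c \<in> A"
    have "continuous_on (chart_image c) (\<lambda>x. fst (radial_coord a c x) * partial_u (local_rep c f) x + snd (radial_coord a c x) * partial_v (local_rep c f) x)"
      by (intro continuous_intros continuous_wv[OF c] C1_onD[OF C1_funD[OF f c]])
    from continuous_on_compose2[OF this homeomorphism_cont1[OF chart_facts(3)[OF c]]] coord_in[OF c]
    have "continuous_on (fst c) (\<lambda>p. fst (radial_coord a c (snd c p)) * partial_u (local_rep c f) (snd c p) + snd (radial_coord a c (snd c p)) * partial_v (local_rep c f) (snd c p))" by blast
    then show "continuous_on (fst c) (radial_deriv a f)"
    proof (rule continuous_on_eq)
      fix p assume "p \<in> fst c"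
      then show "fst (radial_coord a c (snd c p)) * partial_u (local_rep c f) (snd c p) + snd (radial_coord a c (snd c p)) * partial_v (local_rep c f) (snd c p) = radial_deriv a f p"
        using radial_deriv_chart[OF f c coord_in[OF c], of p a] c by simp
    qed
    show "open (fst c)" by (rule chart_facts(1)[OF c])
  qed
  then show ?thesis using atlas by (simp add: smooth_atlas_def)
qed

lemma partial_zero:
  assumes c: "c \<in> A" and G: "open G" "\<And>q. q \<in> G \<Longrightarrow> f q = (k::real)" and x: "x \<in> chart_image c" "param c x \<in> G"
  shows "partial_u (local_rep c f) x = 0" "partial_v (local_rep c f) x = 0"
proof -
  define T where "T = snd c ` (fst c \<inter> G)"
  have T: "openin (top_of_set half_plane) T" unfolding T_def by (rule openin_coord_image[OF c G(1)])
  have xT: "x \<in> T" unfolding T_def using param_in[OF c x(1)] x c by (intro image_eqI[of _ _ "param c x"]) auto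
  have "C1_on T (local_rep c f) (\<lambda>x. 0) (\<lambda>x. 0)"
    by (rule C1_on_cong[OF C1_on_const[of _ k]]) (auto simp: T_def local_rep_def c G(2))
  from partial_eqI(1,2)[OF T this xT] show "partial_u (local_rep c f) x = 0" "partial_v (local_rep c f) x = 0" .
qed

lemma radial_deriv_zero:
  assumes "open G" "\<And>q. q \<in> G \<Longrightarrow> f q = (k::real)" "p \<in> G"
  shows "radial_deriv a f p = 0"
proof -
  have "param (chart_at A p) (snd (chart_at A p) p) \<in> G" using assms(3) chart_at[of p] by simp
  from partial_zero[OF chart_at(1) assms(1,2) coord_in[OF chart_at] this]
  show ?thesis unfolding radial_deriv_def Let_def by simp
qed

lemma radial_deriv_add:
  assumes f: "C1_fun A f" and g: "C1_fun A g"
  shows "radial_deriv a (\<lambda>p. f p + g p) p = radial_deriv a f p + radial_deriv a g p"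
proof -
  let ?c = "chart_at A p" and ?x = "snd (chart_at A p) p"
  have "C1_on (chart_image ?c) (\<lambda>x. local_rep ?c f x + local_rep ?c g x) (\<lambda>x. partial_u (local_rep ?c f) x + partial_u (local_rep ?c g) x)
    (\<lambda>x. partial_v (local_rep ?c f) x + partial_v (local_rep ?c g) x)"
    by (intro C1_on_add C1_funD f g chart_at(1))
  moreover have "(\<lambda>x. local_rep ?c f x + local_rep ?c g x) = local_rep ?c (\<lambda>p. f p + g p)" by (auto simp: local_rep_def)
  ultimately have e: "C1_on (chart_image ?c) (local_rep ?c (\<lambda>p. f p + g p)) (\<lambda>x. partial_u (local_rep ?c f) x + partial_u (local_rep ?c g) x)
    (\<lambda>x. partial_v (local_rep ?c f) x + partial_v (local_rep ?c g) x)" by simp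
  show ?thesis
    unfolding radial_deriv_def Let_def partial_eqI(1,2)[OF chart_facts(2)[OF chart_at(1)] e coord_in[OF chart_at]] by (simp add: algebra_simps)
qed

end

section \<open>The first variation inequality in one chart\<close>

context connected_surface
begin

lemma compact_separation:
  fixes K :: "(real \<times> real) set"
  assumes "compact K" "open U" "K \<subseteq> U"
  obtains \<rho> where "\<rho> > 0" "\<And>x. x \<in> K \<Longrightarrow> cball x \<rho> \<subseteq> U" "compact (\<Union>x\<in>K. cball x \<rho>)" "(\<Union>x\<in>K. cball x \<rho>) \<subseteq> U"
proof -
  obtain e where e: "e > 0" "(\<Union>x\<in>K. cball x e) \<subseteq> U"
    using compact_subset_open_imp_cball_epsilon_subset[OF assms] by blast
  moreover have "compact (\<Union>x\<in>K. cball x e)" by (rule compact_minkowski_sum_cball[OF assms(1)])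
  ultimately show thesis using that[of e] by blast
qed

lemma param_image_memD:
  assumes c: "c \<in> A" and K: "K \<subseteq> chart_image c" and x: "x \<in> chart_image c" "param c x \<in> param c ` K"
  shows "x \<in> K"
proof -
  obtain y where y: "y \<in> K" "param c x = param c y" using x(2) by blast
  have "x = snd c (param c x)" using c x(1) by simp
  also have "\<dots> = y" unfolding y(2) using c y(1) K by auto
  finally show ?thesis using y(1) by simp
qed

lemma norm_dX_le: "norm (dX c x h) \<le> (norm (Xu c x) + norm (Xv c x)) * norm h"
proof -
  have "norm (dX c x h) \<le> \<bar>fst h\<bar> * norm (Xu c x) + \<bar>snd h\<bar> * norm (Xv c x)"
    unfolding dX_def by (metis norm_triangle_ineq norm_scaleR)
  also have "\<dots> \<le> norm h * norm (Xu c x) + norm h * norm (Xv c x)"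
    using norm_fst_le[of "fst h" "snd h"] norm_snd_le[of "snd h" "fst h"] by (intro add_mono mult_right_mono) auto
  finally show ?thesis by (simp add: algebra_simps)
qed

text \<open>In coordinates, \<open>F\<close> is the field \<open>\<zeta> (X - a)\<close>, projected to the tangent plane and multiplied by the
  area density; the factor 2 in its divergence is the dimension, and minimality removes the curvature term.\<close>

lemma chart_field:
  assumes m: "minimal A X" and c: "c \<in> A" and \<zeta>: "C1_fun A \<zeta>"
    and K: "compact K" "K \<subseteq> int_image c" and off: "\<And>p. p \<notin> param c ` K \<Longrightarrow> \<zeta> p = 0"
  obtains F Fu Fv where "C1_on UNIV F Fu Fv" "\<And>x. x \<notin> K \<Longrightarrow> F x = 0"
    "\<And>x. x \<in> K \<Longrightarrow> F x = (\<zeta> (param c x) * norm (nrm c x)) *\<^sub>R radial_coord a c x"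
    "\<And>x. x \<in> K \<Longrightarrow> fst (Fu x) + snd (Fv x) = norm (nrm c x) * (2 * \<zeta> (param c x) + radial_deriv a \<zeta> (param c x))"
proof -
  define V where "V = int_image c"
  have sub: "V \<subseteq> chart_image c" by (auto simp: V_def int_image_def)
  have V: "open V" unfolding V_def by (rule open_int_image[OF c])
  define ch where "ch = local_rep c \<zeta>"
  define chu where "chu = partial_u ch"
  define chv where "chv = partial_v ch"
  have ch: "C1_on V ch chu chv" unfolding ch_def chu_def chv_def by (rule C1_on_subset[OF C1_funD[OF \<zeta> c] sub])
  define Y where "Y x = local_rep c X x + - a" for x
  have Y: "C1_on V Y (\<lambda>x. Xu c x + 0) (\<lambda>x. Xv c x + 0)"
    unfolding Y_def[abs_def] by (intro C1_on_add C1_on_const C1_on_subset[OF C1_Xc[OF c] sub])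
  define Pu where "Pu x = cross3 (Xv c x) (Nu c x) + cross3 (partial_u (Xv c) x) (local_rep c N x)" for x
  define Pv where "Pv x = cross3 (Xv c x) (Nv c x) + cross3 (partial_v (Xv c) x) (local_rep c N x)" for x
  define Qu where "Qu x = cross3 (local_rep c N x) (partial_u (Xu c) x) + cross3 (Nu c x) (Xu c x)" for x
  define Qv where "Qv x = cross3 (local_rep c N x) (partial_v (Xu c) x) + cross3 (Nv c x) (Xu c x)" for x
  have P: "C1_on V (P c) Pu Pv" and Q: "C1_on V (Q c) Qu Qv"
    using C1_on_subset[OF C1_P[OF c] sub] C1_on_subset[OF C1_Q[OF c] sub] by (simp_all add: Pu_def[abs_def] Pv_def[abs_def] Qu_def[abs_def] Qv_def[abs_def])
  have PQ: "Pu x + Qv x = 0" if "x \<in> V" for x using div_PQ[OF m c] that by (simp add: V_def Pu_def Qv_def)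
  note 1 = C1_on_bilinear[OF bounded_bilinear_mult ch C1_on_bilinear[OF bounded_bilinear_inner Y P]]
  note 2 = C1_on_bilinear[OF bounded_bilinear_mult ch C1_on_bilinear[OF bounded_bilinear_inner Y Q]]
  have bl1: "bounded_linear (\<lambda>r. r *\<^sub>R (1, 0) :: real \<times> real)" and bl2: "bounded_linear (\<lambda>r. r *\<^sub>R (0, 1) :: real \<times> real)"
    by (rule bounded_linear_scaleR_left)+
  \<comment> \<open>The area density in \<open>F\<close> cancels the denominator of
    \<open>radial_coord\<close>, leaving products whose partials are known from \<open>C1_P\<close>
    and \<open>C1_Q\<close>.\<close>
  define f where "f x = (ch x * (Y x \<bullet> P c x)) *\<^sub>R (1 :: real, 0) + (ch x * (Y x \<bullet> Q c x)) *\<^sub>R (0, 1 :: real)" for x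
  define fu where "fu x = (ch x * (Y x \<bullet> Pu x + (Xu c x + 0) \<bullet> P c x) + chu x * (Y x \<bullet> P c x)) *\<^sub>R (1 :: real, 0)
     + (ch x * (Y x \<bullet> Qu x + (Xu c x + 0) \<bullet> Q c x) + chu x * (Y x \<bullet> Q c x)) *\<^sub>R (0, 1 :: real)" for x
  define fv where "fv x = (ch x * (Y x \<bullet> Pv x + (Xv c x + 0) \<bullet> P c x) + chv x * (Y x \<bullet> P c x)) *\<^sub>R (1 :: real, 0)
     + (ch x * (Y x \<bullet> Qv x + (Xv c x + 0) \<bullet> Q c x) + chv x * (Y x \<bullet> Q c x)) *\<^sub>R (0, 1 :: real)" for x
  have f: "C1_on V f fu fv"
    unfolding f_def[abs_def] fu_def[abs_def] fv_def[abs_def]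
    by (rule C1_on_add[OF C1_on_linear[OF bl1 1] C1_on_linear[OF bl2 2]])
  define F where "F x = (if x \<in> V then f x else 0)" for x
  define Fu where "Fu x = (if x \<in> V then fu x else 0)" for x
  define Fv where "Fv x = (if x \<in> V then fv x else 0)" for x
  have Kc: "closed K" using K compact_imp_closed by blast
  have "compact (param c ` K)"
    using K sub continuous_on_subset[OF homeomorphism_cont2[OF chart_facts(3)[OF c]]]
    by (intro compact_continuous_image) (auto simp: V_def)
  then have G: "open (- param c ` K)" using compact_imp_closed by blast
  have zero: "ch x = 0 \<and> chu x = 0 \<and> chv x = 0" if "x \<in> V" "x \<notin> K" for x
  proof -
    have xc: "x \<in> chart_image c" using that sub by blast
    have "K \<subseteq> chart_image c" using K(2) sub by (auto simp: V_def)
    then have "param c x \<notin> param c ` K" using param_image_memD[OF c _ xc] that(2) by blast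
    then have xG: "param c x \<in> - param c ` K" by simp
    have "\<zeta> q = 0" if "q \<in> - param c ` K" for q using off that by simp
    from partial_zero[OF c G this xc xG] off xG show ?thesis by (simp add: ch_def chu_def chv_def local_rep_def)
  qed
  \<comment> \<open>\<open>V\<close> and the complement of \<open>K\<close> are open and cover the
    plane. On the second set everything vanishes, since \<zeta> is 0 on the open complement of the
    image of \<open>K\<close> and takes its partials along.\<close>
  have FC1: "C1_on UNIV F Fu Fv"
  proof (rule C1_on_local)
    fix x
    show "\<exists>T. openin (top_of_set UNIV) T \<and> x \<in> T \<and> C1_on T F Fu Fv"
    proof (cases "x \<in> V")
      case True
      have "C1_on V F Fu Fv" by (rule C1_on_cong[OF f]) (auto simp: F_def Fu_def Fv_def)
      then show ?thesis using V True by (intro exI[of _ V]) auto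
    next
      case False
      have "C1_on (- K) F Fu Fv"
        by (rule C1_on_cong[OF C1_on_const[of _ 0]]) (use zero in \<open>auto simp: F_def Fu_def Fv_def f_def fu_def fv_def zero_prod_def\<close>)
      then show ?thesis using Kc False K by (intro exI[of _ "- K"]) (auto simp: V_def)
    qed
  qed
  show thesis
  proof (rule that[OF FC1])
    show "F x = 0" if "x \<notin> K" for x using zero[of x] that by (simp add: F_def f_def zero_prod_def)
    fix x assume x: "x \<in> K"
    then have xV: "x \<in> V" and xc: "x \<in> chart_image c" using K sub by (auto simp: V_def)
    have n0: "norm (nrm c x) \<noteq> 0" using nrm_nonzero[OF c xc] by simp
    have chx: "ch x = \<zeta> (param c x)" by (simp add: ch_def local_rep_def)
    show "F x = (\<zeta> (param c x) * norm (nrm c x)) *\<^sub>R radial_coord a c x"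
      using xV n0 by (simp add: F_def f_def radial_coord_def chx Y_def)
    \<comment> \<open>Three groups of terms: the first vanishes by \<open>div_PQ\<close>; the second
      contributes the dimension, each coordinate vector pairing to the area density; the third is
      the derivative of \<zeta>.\<close>
    have "fst (Fu x) + snd (Fv x) = ch x * (Y x \<bullet> (Pu x + Qv x)) + ch x * (Xu c x \<bullet> P c x + Xv c x \<bullet> Q c x)
        + (chu x * (Y x \<bullet> P c x) + chv x * (Y x \<bullet> Q c x))"
      using xV by (simp add: Fu_def Fv_def fu_def fv_def algebra_simps inner_add_right)
    also have "\<dots> = ch x * (2 * norm (nrm c x)) + (chu x * (Y x \<bullet> P c x) + chv x * (Y x \<bullet> Q c x))"
      by (simp add: PQ[OF xV] XP[OF c xc])
    also have "chu x * (Y x \<bullet> P c x) + chv x * (Y x \<bullet> Q c x) = norm (nrm c x) * radial_deriv a \<zeta> (param c x)"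
      unfolding radial_deriv_chart[OF \<zeta> c xc] using n0 by (simp add: radial_coord_def Y_def chu_def chv_def ch_def field_simps)
    finally show "fst (Fu x) + snd (Fv x) = norm (nrm c x) * (2 * \<zeta> (param c x) + radial_deriv a \<zeta> (param c x))"
      by (simp add: chx algebra_simps)
  qed
qed

text \<open>Here \<zeta> localizes to one chart and \<phi> is the Lipschitz cutoff. Off
  \<open>E\<close> the cutoff is locally constant, so its slope along the field is 0. On
  \<open>E\<close> the slope is at most \<Lambda> times the speed of the motion in space, which is
  bounded by |X - a| times \<zeta> and the area density. Feeding these slopes into
  \<open>weak_divergence_le\<close> gives the inequality.\<close>

lemma chart_inequality:
  assumes m: "minimal A X" and c: "c \<in> A" and \<zeta>: "C1_fun A \<zeta>" and \<zeta>0: "\<And>p. 0 \<le> \<zeta> p"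
    and K: "compact K" "K \<subseteq> int_image c" and off: "\<And>p. p \<notin> param c ` K \<Longrightarrow> \<zeta> p = 0"
    and \<phi>: "\<And>p. 0 \<le> \<phi> p" "\<And>p. \<phi> p \<le> 1" and \<Lambda>: "0 \<le> \<Lambda>"
    and lip: "\<And>p q. \<bar>\<phi> p - \<phi> q\<bar> \<le> \<Lambda> * d p q" and E: "closed E"
    and loc: "\<And>p. p \<notin> E \<Longrightarrow> \<exists>U. open U \<and> p \<in> U \<and> (\<forall>q\<in>U. \<phi> q = \<phi> p)"
    and \<phi>m: "\<phi> \<in> borel_measurable borel"
  shows "(LINT p|\<mu>. \<phi> p * (2 * \<zeta> p + radial_deriv a \<zeta> p)) \<le> (LINT p|\<mu>. \<Lambda> * indicator E p * norm (X p - a) * \<zeta> p)"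
proof -
  define V where "V = int_image c"
  have sub: "V \<subseteq> chart_image c" by (auto simp: V_def int_image_def)
  have V: "open V" unfolding V_def by (rule open_int_image[OF c])
  have KV: "K \<subseteq> V" using K by (simp add: V_def)
  obtain F Fu Fv where F: "C1_on UNIV F Fu Fv" "\<And>x. x \<notin> K \<Longrightarrow> F x = 0"
    "\<And>x. x \<in> K \<Longrightarrow> F x = (\<zeta> (param c x) * norm (nrm c x)) *\<^sub>R radial_coord a c x"
    "\<And>x. x \<in> K \<Longrightarrow> fst (Fu x) + snd (Fv x) = norm (nrm c x) * (2 * \<zeta> (param c x) + radial_deriv a \<zeta> (param c x))"
    using chart_field[OF m c \<zeta> K off, where a=a] by blast
  define p' where "p' = param' c"
  have p'm [measurable]: "p' \<in> borel_measurable borel" unfolding p'_def by (rule param'_measurable[OF c])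
  have p'K: "p' x = param c x" if "x \<in> chart_image c" for x using that by (simp add: p'_def param'_def)
  have Xm [measurable]: "X \<in> borel_measurable borel" using C1_fun_continuous[OF C1_X] by (rule borel_measurable_continuous_onI)
  have \<zeta>m [measurable]: "\<zeta> \<in> borel_measurable borel" using C1_fun_continuous[OF \<zeta>] by (rule borel_measurable_continuous_onI)
  have Em [measurable]: "E \<in> sets borel" using E by simp
  note \<phi>m [measurable] w_measurable[OF c, measurable]
  \<comment> \<open>The slope bound for \<open>weak_divergence_le\<close>. The factor
    \<open>w c\<close> is the area density of the field and also the one that turns the plane
    integral into a surface integral.\<close>
  define h where "h x = \<Lambda> * indicator E (p' x) * norm (X (p' x) - a) * \<zeta> (p' x) * w c x" for x
  define \<psi> where "\<psi> x = \<phi> (p' x)" for x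
  have hm: "h \<in> borel_measurable borel" unfolding h_def[abs_def] by measurable
  have \<psi>m: "\<psi> \<in> borel_measurable borel" unfolding \<psi>_def[abs_def] by measurable
  have h0: "0 \<le> h x" for x using \<Lambda> \<zeta>0 by (simp add: h_def)
  define k where "k x = \<Lambda> * norm (local_rep c X x - a) * local_rep c \<zeta> x * norm (nrm c x)" for x
  have "continuous_on K k"
  proof -
    have "K \<subseteq> chart_image c" using KV sub by blast
    then show ?thesis unfolding k_def[abs_def]
      by (intro continuous_intros continuous_on_subset[OF C1_on_continuous[OF C1_Xc[OF c]]]
        continuous_on_subset[OF C1_on_continuous[OF C1_funD[OF \<zeta> c]]] continuous_on_subset[OF nrm_continuous[OF c]]) 
  qed
  then have "bounded (k ` K)" using K(1) compact_continuous_image compact_imp_bounded by blast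
  then obtain M where M: "\<And>x. x \<in> K \<Longrightarrow> \<bar>k x\<bar> \<le> M" unfolding bounded_iff by auto
  have hM: "h x \<le> M" if "x \<in> K" for x
  proof -
    have xc: "x \<in> chart_image c" using that KV sub by blast
    have "h x \<le> k x"
      unfolding h_def k_def w_def p'K[OF xc] local_rep_apply using \<Lambda> \<zeta>0 xc by (auto simp: indicator_def)
    then show ?thesis using M[OF that] by linarith
  qed
  have dF: "norm (dX c x (F x)) \<le> norm (local_rep c X x - a) * \<zeta> (param c x) * norm (nrm c x)" if "x \<in> K" for x
  proof -
    have xc: "x \<in> chart_image c" using that KV sub by blast
    have "dX c x (F x) = (\<zeta> (param c x) * norm (nrm c x)) *\<^sub>R dX c x (radial_coord a c x)"
      unfolding F(3)[OF that] by (rule linear_scale[OF linear_dX])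
    then have "norm (dX c x (F x)) = (\<zeta> (param c x) * norm (nrm c x)) * norm (dX c x (radial_coord a c x))" using \<zeta>0 by (simp add: abs_mult)
    also have "\<dots> \<le> (\<zeta> (param c x) * norm (nrm c x)) * norm (local_rep c X x - a)"
      by (rule mult_left_mono[OF norm_dX_wv[OF c xc]]) (use \<zeta>0 in simp)
    finally show ?thesis by (simp add: algebra_simps)
  qed
  \<comment> \<open>A uniform margin around \<open>K\<close> inside \<open>V\<close>: the moved
    points x + t F(x) stay in a disc of the chart, joined to \<open>x\<close> by a segment, as long
    as t < t0.\<close>
  obtain \<rho> where \<rho>: "\<rho> > 0" "\<And>x. x \<in> K \<Longrightarrow> cball x \<rho> \<subseteq> V" "compact (\<Union>x\<in>K. cball x \<rho>)" "(\<Union>x\<in>K. cball x \<rho>) \<subseteq> V"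
    using compact_separation[OF K(1) V KV] by blast
  have "continuous_on (\<Union>x\<in>K. cball x \<rho>) (\<lambda>x. norm (Xu c x) + norm (Xv c x))"
    by (intro continuous_intros continuous_on_subset[OF C1_onD(1)[OF C1_Xc[OF c]]] continuous_on_subset[OF C1_onD(2)[OF C1_Xc[OF c]]]
      order_trans[OF \<rho>(4) sub])
  then have "bounded ((\<lambda>x. norm (Xu c x) + norm (Xv c x)) ` (\<Union>x\<in>K. cball x \<rho>))"
    using \<rho>(3) compact_continuous_image compact_imp_bounded by blast
  then obtain S where S: "\<And>z. z \<in> (\<Union>x\<in>K. cball x \<rho>) \<Longrightarrow> norm (norm (Xu c z) + norm (Xv c z)) \<le> S" unfolding bounded_iff by blast
  have "continuous_on K F" using C1_on_continuous[OF F(1)] continuous_on_subset by blast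
  then have "bounded (F ` K)" using K(1) compact_continuous_image compact_imp_bounded by blast
  then obtain B where B: "\<And>x. x \<in> K \<Longrightarrow> norm (F x) \<le> B" unfolding bounded_iff by blast
  \<comment> \<open>The maximum with 1 keeps divisions by \<open>B'\<close> legitimate when the
    field is 0.\<close>
  define B' where "B' = max B 1"
  have B': "B' > 0" "\<And>x. x \<in> K \<Longrightarrow> norm (F x) \<le> B'" using B by (auto simp: B'_def le_max_iff_disj)
  define t0 where "t0 = \<rho> / B'"
  have t0: "t0 > 0" using \<rho> B' by (simp add: t0_def)
  have inball: "x + t *\<^sub>R F x \<in> cball x \<rho>" if "x \<in> K" "0 < t" "t < t0" for x t
  proof -
    have "norm (t *\<^sub>R F x) \<le> t0 * B'" using that B'(2)[OF that(1)] by (simp add: mult_mono)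
    then show ?thesis using B'(1) by (simp add: t0_def dist_norm)
  qed
  have "(LINT x:K|lborel. \<psi> x * (fst (Fu x) + snd (Fv x))) \<le> (LINT x:K|lborel. h x)"
  proof (rule weak_divergence_le[OF F(1) K(1) F(2) \<psi>m _ _ hm h0 hM _ t0])
    show "0 \<le> \<psi> x" "\<psi> x \<le> 1" for x using \<phi> by (simp_all add: \<psi>_def)
    show "\<bar>\<psi> (x + t *\<^sub>R F x) - \<psi> x\<bar> \<le> (\<Lambda> * (S * B')) * t" if t: "0 < t" "t < t0" and x: "x \<in> K" for t x
    proof -
      let ?y = "x + t *\<^sub>R F x"
      have b: "cball x \<rho> \<subseteq> chart_image c" using \<rho>(2)[OF x] sub by blast
      have y: "?y \<in> cball x \<rho>" "x \<in> cball x \<rho>" using inball[OF x t] \<rho>(1) by auto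
      have "d (param c x) (param c ?y) \<le> S * (t * B')"
      proof (rule d_segment[OF c convex_cball b y(2,1)])
        fix z assume "z \<in> cball x \<rho>"
        then have Sz: "norm (Xu c z) + norm (Xv c z) \<le> S" using S[of z] x by auto
        have "norm (dX c z (?y - x)) \<le> (norm (Xu c z) + norm (Xv c z)) * norm (?y - x)" by (rule norm_dX_le)
        also have "\<dots> \<le> S * (t * B')" using Sz B'(2)[OF x] t by (intro mult_mono) (auto intro: order_trans[OF _ Sz])
        finally show "norm (dX c z (?y - x)) \<le> S * (t * B')" .
      qed
      then have "\<Lambda> * d (param c x) (param c ?y) \<le> \<Lambda> * (S * (t * B'))" using \<Lambda> by (rule mult_left_mono)
      moreover have "x \<in> chart_image c" "?y \<in> chart_image c" using b y by blast+
      then have "\<psi> x = \<phi> (param c x)" "\<psi> ?y = \<phi> (param c ?y)" by (simp_all add: \<psi>_def p'K)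
      moreover have "\<Lambda> * (S * (t * B')) = \<Lambda> * (S * B') * t" by simp
      ultimately show ?thesis using lip[of "param c x" "param c ?y"] by linarith
    qed
    fix x and \<eta> :: real assume x: "x \<in> K" and \<eta>: "0 < \<eta>"
    have xc: "x \<in> chart_image c" and xV: "x \<in> V" using x KV sub by auto
    show "\<exists>t1>0. \<forall>t. 0 < t \<and> t < t1 \<longrightarrow> \<psi> x - \<psi> (x + t *\<^sub>R F x) \<le> t * (h x + \<eta>)"
    proof (cases "param c x \<in> E")
      case False
      from loc[OF this] obtain U where U: "open U" "param c x \<in> U" "\<And>q. q \<in> U \<Longrightarrow> \<phi> q = \<phi> (param c x)" by blast
      have "openin (top_of_set half_plane) (snd c ` (fst c \<inter> U))" by (rule openin_coord_image[OF c U(1)])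
      then obtain T where T: "open T" "snd c ` (fst c \<inter> U) = half_plane \<inter> T" using openin_open by blast
      have "x \<in> snd c ` (fst c \<inter> U)" using param_in[OF c xc] U(2) xc c by (intro image_eqI[of _ _ "param c x"]) auto
      then have "x \<in> T \<inter> V" using T xV by blast
      then obtain e where e: "e > 0" "cball x e \<subseteq> T \<inter> V" using T(1) V open_Int open_contains_cball by metis
      have "\<psi> x - \<psi> (x + t *\<^sub>R F x) \<le> t * (h x + \<eta>)" if t: "0 < t" "t < e / B'" for t
      proof -
        let ?y = "x + t *\<^sub>R F x"
        have "norm (t *\<^sub>R F x) \<le> e / B' * B'" using t B'(2)[OF x] by (simp add: mult_mono del: times_divide_eq_left)
        then have "?y \<in> cball x e" using B'(1) by (simp add: dist_norm)
        then have y: "?y \<in> T" "?y \<in> chart_image c" using e sub by auto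
        then have "?y \<in> snd c ` (fst c \<inter> U)" using T(2) chart_facts(4)[OF c] by blast
        then obtain q where "q \<in> fst c" "q \<in> U" "?y = snd c q" by blast
        then have "param c ?y \<in> U" using c by simp
        then have "\<psi> ?y = \<psi> x" using U(3) y(2) xc by (simp add: \<psi>_def p'K)
        then show ?thesis using t h0[of x] \<eta> by simp
      qed
      moreover have "e / B' > 0" using e B' by simp
      ultimately show ?thesis by blast
    next
      case True
      \<comment> \<open>Freezing the differential at \<open>x\<close> costs \<Lambda> \<eta>' B' per
        unit of \<open>t\<close>, and this choice keeps the cost below \<eta>; the summand 1 covers
        the case \<Lambda> = 0.\<close>
      define \<eta>' where "\<eta>' = \<eta> / (\<Lambda> * B' + 1)"
      have p1: "\<Lambda> * B' + 1 > 0" using \<Lambda> B'(1) by (intro add_nonneg_pos) auto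
      then have \<eta>': "\<eta>' > 0" using \<eta> by (simp add: \<eta>'_def)
      have \<eta>'': "\<Lambda> * (\<eta>' * B') \<le> \<eta>"
      proof -
        have "\<eta>' * (\<Lambda> * B' + 1) = \<eta>" using p1 by (simp add: \<eta>'_def)
        then have "\<eta>' * (\<Lambda> * B') + \<eta>' = \<eta>" by (simp add: algebra_simps)
        then have "\<eta>' * (\<Lambda> * B') \<le> \<eta>" using \<eta>' by linarith
        then show ?thesis by (simp add: algebra_simps)
      qed
      from chart_nbhd[OF c xc \<eta>'] obtain r where r: "r > 0" "cball x r \<inter> half_plane \<subseteq> chart_image c"
        "\<And>y h. y \<in> cball x r \<inter> half_plane \<Longrightarrow> norm (dX c y h - dX c x h) \<le> \<eta>' * norm h" by blast
      define e where "e = min r \<rho>"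
      have e: "e > 0" "e \<le> r" "e \<le> \<rho>" using r \<rho> by (auto simp: e_def)
      have "\<psi> x - \<psi> (x + t *\<^sub>R F x) \<le> t * (h x + \<eta>)" if t: "0 < t" "t < e / B'" for t
      proof -
        let ?y = "x + t *\<^sub>R F x"
        have "norm (t *\<^sub>R F x) \<le> e / B' * B'" using t B'(2)[OF x] by (simp add: mult_mono del: times_divide_eq_left)
        then have y: "?y \<in> cball x e" "x \<in> cball x e" using B'(1) e by (auto simp: dist_norm)
        have b: "cball x e \<subseteq> chart_image c" using \<rho>(2)[OF x] sub subset_cball[OF e(3), of x] by blast
        have "d (param c x) (param c ?y) \<le> t * (norm (dX c x (F x)) + \<eta>' * B')"
        proof (rule d_segment[OF c convex_cball b y(2,1)])
          fix z assume "z \<in> cball x e"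
          then have z: "z \<in> cball x r \<inter> half_plane" using b chart_facts(4)[OF c] e(2) by auto
          have "norm (dX c z (?y - x)) = norm (t *\<^sub>R dX c z (F x))" by (simp add: linear_scale[OF linear_dX])
          also have "\<dots> = t * norm (dX c z (F x))" using t by simp
          also have "\<dots> \<le> t * (norm (dX c x (F x)) + \<eta>' * B')"
          proof (rule mult_left_mono)
            have "norm (dX c z (F x)) \<le> norm (dX c x (F x)) + norm (dX c z (F x) - dX c x (F x))" by (metis norm_triangle_sub)
            also have "\<dots> \<le> norm (dX c x (F x)) + \<eta>' * norm (F x)" using r(3)[OF z] by simp
            also have "\<dots> \<le> norm (dX c x (F x)) + \<eta>' * B'" using \<eta>' B'(2)[OF x] by simp
            finally show "norm (dX c z (F x)) \<le> norm (dX c x (F x)) + \<eta>' * B'" .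
          qed (use t in simp)
          finally show "norm (dX c z (?y - x)) \<le> t * (norm (dX c x (F x)) + \<eta>' * B')" .
        qed
        then have "\<Lambda> * d (param c x) (param c ?y) \<le> \<Lambda> * (t * (norm (dX c x (F x)) + \<eta>' * B'))" using \<Lambda> by (rule mult_left_mono)
        also have "\<dots> = t * (\<Lambda> * norm (dX c x (F x)) + \<Lambda> * (\<eta>' * B'))" by (simp add: algebra_simps)
        also have "\<dots> \<le> t * (h x + \<eta>)"
        proof (rule mult_left_mono)
          have "\<Lambda> * norm (dX c x (F x)) \<le> \<Lambda> * (norm (local_rep c X x - a) * \<zeta> (param c x) * norm (nrm c x))"
            by (rule mult_left_mono[OF dF[OF x] \<Lambda>])
          also have "\<dots> = h x" using True xc by (simp add: h_def w_def p'K local_rep_apply)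
          finally show "\<Lambda> * norm (dX c x (F x)) + \<Lambda> * (\<eta>' * B') \<le> h x + \<eta>" using \<eta>'' by linarith
        qed (use t in simp)
        finally have "\<Lambda> * d (param c x) (param c ?y) \<le> t * (h x + \<eta>)" .
        moreover have "x \<in> chart_image c" "?y \<in> chart_image c" using b y by blast+
      then have "\<psi> x = \<phi> (param c x)" "\<psi> ?y = \<phi> (param c ?y)" by (simp_all add: \<psi>_def p'K)
        ultimately show ?thesis using lip[of "param c x" "param c ?y"] by linarith
      qed
      moreover have "e / B' > 0" using e B' by simp
      ultimately show ?thesis by blast
    qed
  qed
  moreover have "(LINT p|\<mu>. \<phi> p * (2 * \<zeta> p + radial_deriv a \<zeta> p)) = (LINT x:K|lborel. \<psi> x * (fst (Fu x) + snd (Fv x)))"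
  proof -
    have "compact (param c ` K)"
      using KV sub continuous_on_subset[OF homeomorphism_cont2[OF chart_facts(3)[OF c]]] K(1)
      by (intro compact_continuous_image) auto
    then have G: "open (- param c ` K)" using compact_imp_closed by blast
    have z: "\<phi> p * (2 * \<zeta> p + radial_deriv a \<zeta> p) = 0" if "p \<notin> param c ` K" for p
      using radial_deriv_zero[OF G, of \<zeta> 0 p] off that by simp
    have Kc: "K \<subseteq> chart_image c" using KV sub by blast
    note Kin = param_image_memD[OF c Kc]
    have "(LINT p|\<mu>. \<phi> p * (2 * \<zeta> p + radial_deriv a \<zeta> p)) = (LINT x:K|lborel. norm (nrm c x) * (\<phi> (param c x) * (2 * \<zeta> (param c x) + radial_deriv a \<zeta> (param c x))))"
    proof (rule area_integral_chart[OF c _ _ Kc])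
      have [measurable]: "radial_deriv a \<zeta> \<in> borel_measurable borel" using continuous_radial_deriv[OF \<zeta>] by (rule borel_measurable_continuous_onI)
      show "(\<lambda>p. \<phi> p * (2 * \<zeta> p + radial_deriv a \<zeta> p)) \<in> borel_measurable borel" by measurable
      show "\<phi> p * (2 * \<zeta> p + radial_deriv a \<zeta> p) = 0" if "p \<notin> fst c" for p
      proof (rule z, rule notI)
        assume "p \<in> param c ` K"
        then obtain x where "x \<in> K" "p = param c x" by blast
        then show False using that Kc param_in[OF c, of x] by auto
      qed
      show "\<phi> (param c x) * (2 * \<zeta> (param c x) + radial_deriv a \<zeta> (param c x)) = 0" if "x \<in> chart_image c" "x \<notin> K" for x
        by (rule z) (use that Kin[of x] in auto)
    qed
    also have "\<dots> = (LINT x:K|lborel. \<psi> x * (fst (Fu x) + snd (Fv x)))"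
      unfolding set_lebesgue_integral_def
    proof (intro Bochner_Integration.integral_cong refl)
      fix x
      show "indicator K x *\<^sub>R (norm (nrm c x) * (\<phi> (param c x) * (2 * \<zeta> (param c x) + radial_deriv a \<zeta> (param c x)))) = indicator K x *\<^sub>R (\<psi> x * (fst (Fu x) + snd (Fv x)))"
      proof (cases "x \<in> K")
        case True
        then have "x \<in> chart_image c" using Kc by blast
        then show ?thesis using True by (simp add: F(4) \<psi>_def p'K)
      qed simp
    qed
    finally show ?thesis .
  qed
  moreover have "(LINT p|\<mu>. \<Lambda> * indicator E p * norm (X p - a) * \<zeta> p) = (LINT x:K|lborel. h x)"
  proof -
    have Kc: "K \<subseteq> chart_image c" using KV sub by blast
    note Kin = param_image_memD[OF c Kc]
    have "(LINT p|\<mu>. \<Lambda> * indicator E p * norm (X p - a) * \<zeta> p) = (LINT x:K|lborel. norm (nrm c x) * (\<Lambda> * indicator E (param c x) * norm (X (param c x) - a) * \<zeta> (param c x)))"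
    proof (rule area_integral_chart[OF c _ _ Kc])
      show "(\<lambda>p. \<Lambda> * indicator E p * norm (X p - a) * \<zeta> p) \<in> borel_measurable borel" by measurable
      show "\<Lambda> * indicator E p * norm (X p - a) * \<zeta> p = 0" if "p \<notin> fst c" for p
      proof -
        have "p \<notin> param c ` K"
        proof
          assume "p \<in> param c ` K"
          then obtain x where "x \<in> K" "p = param c x" by blast
          then show False using that Kc param_in[OF c, of x] by auto
        qed
        then show ?thesis using off by simp
      qed
      show "\<Lambda> * indicator E (param c x) * norm (X (param c x) - a) * \<zeta> (param c x) = 0" if "x \<in> chart_image c" "x \<notin> K" for x
        using off[of "param c x"] that Kin[of x] by auto
    qed
    also have "\<dots> = (LINT x:K|lborel. h x)"
      unfolding set_lebesgue_integral_def
      by (intro Bochner_Integration.integral_cong refl) (use Kc p'K in \<open>auto simp: h_def w_def indicator_def\<close>)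
    finally show ?thesis .
  qed
  ultimately show ?thesis by simp
qed

end

section \<open>From charts to the surface\<close>

text \<open>Squaring flattens the kink of the positive part at 0. The result is a C1 cutoff made of
  polynomials, from which the bumps are composed.\<close>

lemma DERIV_max_square: "((\<lambda>t::real. (max 0 t)\<^sup>2) has_real_derivative 2 * max 0 t) (at t)"
proof -
  consider "t > 0" | "t < 0" | "t = 0" by linarith
  then show ?thesis
  proof cases
    case 1
    have "((\<lambda>t::real. t\<^sup>2) has_real_derivative 2 * t) (at t)" by (auto intro!: derivative_eq_intros)
    then have "((\<lambda>t::real. (max 0 t)\<^sup>2) has_real_derivative 2 * t) (at t)"
      by (rule has_field_derivative_transform_within_open[of _ _ _ "{0<..}"]) (use 1 in auto)
    then show ?thesis using 1 by simp
  next
    case 2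
    have "((\<lambda>t::real. 0) has_real_derivative 0) (at t)" by simp
    then have "((\<lambda>t::real. (max 0 t)\<^sup>2) has_real_derivative 0) (at t)"
      by (rule has_field_derivative_transform_within_open[of _ _ _ "{..<0}"]) (use 2 in auto)
    then show ?thesis using 2 by simp
  next
    case 3
    have "((\<lambda>h::real. (max 0 h)\<^sup>2 / h) \<longlongrightarrow> 0) (at 0)"
    proof (rule Lim_null_comparison)
      show "\<forall>\<^sub>F h in at (0::real). norm ((max 0 h)\<^sup>2 / h) \<le> \<bar>h\<bar>"
        by (rule always_eventually) (auto simp: max_def power2_eq_square)
      show "((\<lambda>h::real. \<bar>h\<bar>) \<longlongrightarrow> 0) (at 0)" by (intro tendsto_rabs_zero tendsto_ident_at)
    qed
    then show ?thesis using 3 by (simp add: DERIV_def)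
  qed
qed

text \<open>The bump is 1 - s(1 - s(2 - k |x - x0|^2)), with \<open>s\<close> the squared positive
  part and k = 2 / r^2. From distance \<open>r\<close> on, the inner argument is at most 0 and the
  bump vanishes. Up to distance r/2 the inner argument is at least 3/2, so the outer one is negative
  and the bump is 1.\<close>

lemma C1_bump:
  fixes x0 :: "real \<times> real"
  assumes r: "r > 0"
  obtains \<beta> \<beta>u \<beta>v where "C1_on UNIV \<beta> \<beta>u \<beta>v" "\<And>x. 0 \<le> \<beta> x" "\<And>x. \<beta> x \<le> (1::real)"
    "\<And>x. x \<notin> cball x0 r \<Longrightarrow> \<beta> x = 0" "\<And>x. x \<in> ball x0 (r / 2) \<Longrightarrow> \<beta> x = 1"
proof -
  define s where "s t = (max 0 t)\<^sup>2" for t :: real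
  define k where "k = 2 / r\<^sup>2"
  have k: "k > 0" "k * r\<^sup>2 = 2" using r by (auto simp: k_def)
  have comp: "\<exists>u v. C1_on UNIV (\<lambda>x. s (f x)) u v" if "C1_on UNIV f fu fv" for f fu fv :: "real \<times> real \<Rightarrow> real"
  proof -
    have "continuous_on UNIV (\<lambda>y::real. 2 * max 0 y)" by (intro continuous_intros)
    from C1_on_real_comp[OF that UNIV_I DERIV_max_square this] show ?thesis unfolding s_def by blast
  qed
  have sub: "\<exists>u v. C1_on UNIV (\<lambda>x. a + b * f x) u v" if "C1_on UNIV f fu fv" for f fu fv :: "real \<times> real \<Rightarrow> real" and a b
    using C1_on_add[OF C1_on_const[of UNIV a] C1_on_linear[OF bounded_linear_mult_right[of b] that]] by blast
  have id: "C1_on UNIV (\<lambda>x. x - x0) (\<lambda>x. (1, 0)) (\<lambda>x. (0, 1))"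
  proof (rule C1_onI)
    fix x :: "real \<times> real"
    have "(\<lambda>h::real\<times>real. fst h *\<^sub>R (1, 0) + snd h *\<^sub>R (0, 1)) = (\<lambda>h. h)" by auto
    then show "((\<lambda>x. x - x0) has_derivative (\<lambda>h. fst h *\<^sub>R (1, 0) + snd h *\<^sub>R (0, 1))) (at x within UNIV)"
      by (auto intro!: derivative_eq_intros)
  qed auto
  note q = C1_on_bilinear[OF bounded_bilinear_inner id id]
  obtain u1 v1 where 1: "C1_on UNIV (\<lambda>x. 2 + (-k) * ((x - x0) \<bullet> (x - x0))) u1 v1" using sub[OF q, of 2 "-k"] by blast
  obtain u2 v2 where 2: "C1_on UNIV (\<lambda>x. s (2 + (-k) * ((x - x0) \<bullet> (x - x0)))) u2 v2" using comp[OF 1] by blast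
  obtain u3 v3 where 3: "C1_on UNIV (\<lambda>x. 1 + (-1) * s (2 + (-k) * ((x - x0) \<bullet> (x - x0)))) u3 v3" using sub[OF 2, of 1 "-1"] by blast
  obtain u4 v4 where 4: "C1_on UNIV (\<lambda>x. s (1 + (-1) * s (2 + (-k) * ((x - x0) \<bullet> (x - x0))))) u4 v4" using comp[OF 3] by blast
  obtain u5 v5 where 5: "C1_on UNIV (\<lambda>x. 1 + (-1) * s (1 + (-1) * s (2 + (-k) * ((x - x0) \<bullet> (x - x0))))) u5 v5" using sub[OF 4, of 1 "-1"] by blast
  have s0: "0 \<le> s t" for t by (simp add: s_def)
  have s1: "s t \<le> 1" if "t \<le> 1" for t using that by (auto simp: s_def max_def power_le_one)
  show thesis
  proof (rule that[OF 5])
    fix x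
    show "0 \<le> 1 + (-1) * s (1 + (-1) * s (2 + (-k) * ((x - x0) \<bullet> (x - x0))))" using s1 s0 by simp
    show "1 + (-1) * s (1 + (-1) * s (2 + (-k) * ((x - x0) \<bullet> (x - x0)))) \<le> 1" using s0 by simp
    show "1 + (-1) * s (1 + (-1) * s (2 + (-k) * ((x - x0) \<bullet> (x - x0)))) = 0" if "x \<notin> cball x0 r"
    proof -
      have "r \<le> norm (x - x0)" using that by (simp add: dist_norm norm_minus_commute)
      then have "r\<^sup>2 \<le> (x - x0) \<bullet> (x - x0)" using r by (simp add: power_mono flip: power2_norm_eq_inner)
      then have "k * r\<^sup>2 \<le> k * ((x - x0) \<bullet> (x - x0))" by (rule mult_left_mono) (use k in simp)
      then have "2 + (-k) * ((x - x0) \<bullet> (x - x0)) \<le> 0" using k by simp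
      then have "s (2 + (-k) * ((x - x0) \<bullet> (x - x0))) = 0" by (simp add: s_def max_def)
      then show ?thesis by (simp add: s_def)
    qed
    show "1 + (-1) * s (1 + (-1) * s (2 + (-k) * ((x - x0) \<bullet> (x - x0)))) = 1" if "x \<in> ball x0 (r / 2)"
    proof -
      have "norm (x - x0) \<le> r / 2" using that by (simp add: dist_norm norm_minus_commute)
      then have "(x - x0) \<bullet> (x - x0) \<le> (r / 2)\<^sup>2" by (simp add: power_mono flip: power2_norm_eq_inner)
      then have "k * ((x - x0) \<bullet> (x - x0)) \<le> k * (r / 2)\<^sup>2" by (rule mult_left_mono) (use k in simp)
      also have "\<dots> = 1 / 2" using k(2) by (simp add: power_divide)
      finally have "1 \<le> 2 + (-k) * ((x - x0) \<bullet> (x - x0))" by simp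
      then have "1 \<le> s (2 + (-k) * ((x - x0) \<bullet> (x - x0)))" by (simp add: s_def one_le_power)
      then show ?thesis by (simp add: s_def max_def)
    qed
  qed
qed

context surface
begin

definition chart_bump :: "('a \<Rightarrow> real) \<Rightarrow> bool" where
  "chart_bump b \<longleftrightarrow> C1_fun A b \<and> (\<forall>q. 0 \<le> b q \<and> b q \<le> 1) \<and>
     (\<exists>c\<in>A. \<exists>K. compact K \<and> K \<subseteq> int_image c \<and> (\<forall>q. q \<notin> param c ` K \<longrightarrow> b q = 0))"

lemma interior_coord:
  assumes "p \<notin> bdry A" "c \<in> A" "p \<in> fst c"
  shows "snd c p \<in> int_image c"
  using assms coord_in[OF assms(2,3)] chart_facts(4)[OF assms(2)]
  by (auto simp: bdry_def int_image_def half_plane_def order_less_le)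

lemma chart_bump_exists:
  assumes p: "p \<notin> bdry A"
  obtains b G where "chart_bump b" "open G" "p \<in> G" "\<And>q. q \<in> G \<Longrightarrow> b q = 1"
proof -
  let ?c = "chart_at A p" and ?x = "snd (chart_at A p) p"
  have c: "?c \<in> A" and pc: "p \<in> fst ?c" by (rule chart_at)+
  have "?x \<in> int_image ?c" by (rule interior_coord[OF p c pc])
  then obtain r where r: "r > 0" "cball ?x r \<subseteq> int_image ?c" using open_int_image[OF c] open_contains_cball by blast
  have sub: "int_image ?c \<subseteq> chart_image ?c" by (auto simp: int_image_def)
  obtain \<beta> \<beta>u \<beta>v where \<beta>: "C1_on UNIV \<beta> \<beta>u \<beta>v" "\<And>x. 0 \<le> \<beta> x" "\<And>x. \<beta> x \<le> (1::real)"
    "\<And>x. x \<notin> cball ?x r \<Longrightarrow> \<beta> x = 0" "\<And>x. x \<in> ball ?x (r / 2) \<Longrightarrow> \<beta> x = 1" using C1_bump[OF r(1)] by metis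
  define b where "b q = (if q \<in> fst ?c then \<beta> (snd ?c q) else 0)" for q
  define K where "K = cball ?x r"
  have "compact (param ?c ` K)"
    using r(2) sub continuous_on_subset[OF homeomorphism_cont2[OF chart_facts(3)[OF c]]]
    by (intro compact_continuous_image) (auto simp: K_def)
  then have G: "open (- param ?c ` K)" using compact_imp_closed by blast
  have b0: "b q = 0" if "q \<notin> param ?c ` K" for q
  proof (cases "q \<in> fst ?c")
    case True
    then have "snd ?c q \<notin> K" using that c by (metis imageI param_coord)
    then show ?thesis using \<beta>(4) by (simp add: b_def K_def)
  qed (simp add: b_def)
  \<comment> \<open>In another chart the bump is a composition with the transition map where the two
    charts overlap, and 0 near every other point, because the compact image of \<open>K\<close> is
    closed.\<close>
  have "C1_fun A b"
  proof (rule C1_fun_localI)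
    fix e y assume e: "e \<in> A" and y: "y \<in> chart_image e"
    show "\<exists>T gu gv. openin (top_of_set half_plane) T \<and> y \<in> T \<and> T \<subseteq> chart_image e \<and> C1_on T (local_rep e b) gu gv"
    proof (cases "param e y \<in> fst ?c")
      case True
      have yT: "y \<in> overlap e ?c" unfolding overlap_def using True param_in[OF e y] e y by (intro image_eqI[of _ _ "param e y"]) auto
      have "C1_on (overlap e ?c) (local_rep e b) (\<lambda>x. fst (partial_u (trans e ?c) x) *\<^sub>R \<beta>u (trans e ?c x) + snd (partial_u (trans e ?c) x) *\<^sub>R \<beta>v (trans e ?c x))
        (\<lambda>x. fst (partial_v (trans e ?c) x) *\<^sub>R \<beta>u (trans e ?c x) + snd (partial_v (trans e ?c) x) *\<^sub>R \<beta>v (trans e ?c x))"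
        by (rule C1_on_cong[OF C1_on_chain[OF overlap(3)[OF e c] \<beta>(1)]]) (auto simp: overlap_def trans_def local_rep_def b_def e)
      then show ?thesis using overlap(1,2)[OF e c] yT by blast
    next
      case False
      have "param e y \<notin> param ?c ` K"
      proof
        assume "param e y \<in> param ?c ` K"
        then obtain z where "z \<in> K" "param e y = param ?c z" by blast
        moreover from this have "z \<in> chart_image ?c" using r(2) sub unfolding K_def by blast
        ultimately show False using False param_in[OF c, of z] by simp
      qed
      then have yT: "y \<in> snd e ` (fst e \<inter> (- param ?c ` K))" using param_in[OF e y] e y by (intro image_eqI[of _ _ "param e y"]) auto
      have "C1_on (snd e ` (fst e \<inter> (- param ?c ` K))) (local_rep e b) (\<lambda>x. 0) (\<lambda>x. 0)"
        by (rule C1_on_cong[OF C1_on_const[of _ 0]]) (auto simp: local_rep_def e b0)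
      moreover have "snd e ` (fst e \<inter> (- param ?c ` K)) \<subseteq> chart_image e" using coord_in[OF e] by blast
      ultimately show ?thesis using openin_coord_image[OF e G] yT by blast
    qed
  qed
  moreover have "\<exists>c\<in>A. \<exists>K. compact K \<and> K \<subseteq> int_image c \<and> (\<forall>q. q \<notin> param c ` K \<longrightarrow> b q = 0)"
  proof (intro bexI[OF _ c] exI[of _ K] conjI allI impI)
    show "compact K" "K \<subseteq> int_image ?c" using r(2) by (simp_all add: K_def)
  qed (rule b0)
  ultimately have "chart_bump b"
    unfolding chart_bump_def using \<beta>(2,3) by (simp add: b_def)
  moreover have "open (param ?c ` (chart_image ?c \<inter> ball ?x (r / 2)))" by (rule open_param_image[OF c open_ball])
  moreover have "p \<in> param ?c ` (chart_image ?c \<inter> ball ?x (r / 2))"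
    using r coord_in[OF c pc] c pc by (intro image_eqI[of _ _ ?x]) auto
  moreover have "b q = 1" if "q \<in> param ?c ` (chart_image ?c \<inter> ball ?x (r / 2))" for q
    using that \<beta>(5) param_in[OF c] c by (auto simp: b_def)
  ultimately show thesis by (rule that)
qed

lemma radial_deriv_add_one_minus:
  assumes z: "C1_fun A \<zeta>" and b: "C1_fun A b"
  shows "radial_deriv a \<zeta> p = radial_deriv a (\<lambda>p. \<zeta> p * b p) p + radial_deriv a (\<lambda>p. \<zeta> p * (1 - b p)) p"
proof -
  have "radial_deriv a (\<lambda>p. \<zeta> p * b p + \<zeta> p * (1 - b p)) p = radial_deriv a (\<lambda>p. \<zeta> p * b p) p + radial_deriv a (\<lambda>p. \<zeta> p * (1 - b p)) p"
    by (intro radial_deriv_add C1_fun_mult C1_fun_diff C1_fun_const z b)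
  moreover have "(\<lambda>p. \<zeta> p * b p + \<zeta> p * (1 - b p)) = \<zeta>" by (auto simp: algebra_simps)
  ultimately show ?thesis by simp
qed

end

context connected_surface
begin

text \<open>In place of a normalized partition of unity, bumps are split off one at a time: \<zeta>
  = \<zeta> b + \<zeta> (1 - b). The first part lives in one chart, and once finitely many bumps
  equal 1 on a cover of \<open>C\<close>, the last remainder vanishes near \<open>C\<close>. Both
  sides are additive in \<zeta>, and for \<zeta> = 1 the radial derivative disappears.\<close>

lemma global_inequality:
  assumes m: "minimal A X" and fin: "emeasure \<mu> UNIV < \<infinity>" and C: "compact C" "C \<inter> bdry A = {}"
    and \<phi>: "\<And>p. 0 \<le> \<phi> p" "\<And>p. \<phi> p \<le> 1" and \<Lambda>: "0 \<le> \<Lambda>"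
    and lip: "\<And>p q. \<bar>\<phi> p - \<phi> q\<bar> \<le> \<Lambda> * d p q" and E: "closed E"
    and loc: "\<And>p. p \<notin> E \<Longrightarrow> \<exists>U. open U \<and> p \<in> U \<and> (\<forall>q\<in>U. \<phi> q = \<phi> p)"
    and \<phi>m: "\<phi> \<in> borel_measurable borel"
    and \<phi>C: "\<And>p. p \<notin> C \<Longrightarrow> \<phi> p = 0" and EC: "E \<subseteq> C"
  shows "(LINT p|\<mu>. \<phi> p * 2) \<le> (LINT p|\<mu>. \<Lambda> * indicator E p * norm (X p - a))"
proof -
  define I where "I \<zeta> p = \<phi> p * (2 * \<zeta> p + radial_deriv a \<zeta> p)" for \<zeta> p
  define J where "J \<zeta> p = \<Lambda> * indicator E p * norm (X p - a) * \<zeta> p" for \<zeta> :: "'a \<Rightarrow> real" and p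
  have Cb: "C \<in> sets \<mu>" using compact_imp_closed[OF C(1)] by (simp add: area_measure)
  have Eb [measurable]: "E \<in> sets borel" using E by simp
  note \<phi>m [measurable]
  have Xm [measurable]: "X \<in> borel_measurable borel" using C1_fun_continuous[OF C1_X] by (rule borel_measurable_continuous_onI)
  have finC: "emeasure \<mu> C < \<infinity>" using fin emeasure_mono[of C UNIV \<mu>] by (simp add: area_measure order.strict_trans1)
  have intC: "integrable \<mu> f" if "f \<in> borel_measurable borel" "continuous_on C g" "\<And>p. p \<in> C \<Longrightarrow> \<bar>f p\<bar> \<le> \<bar>g p\<bar>" "\<And>p. p \<notin> C \<Longrightarrow> f p = 0" for f g :: "'a \<Rightarrow> real"
  proof -
    have "bounded (g ` C)" using that(2) C(1) compact_continuous_image compact_imp_bounded by blast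
    then obtain M where M: "\<And>p. p \<in> C \<Longrightarrow> \<bar>g p\<bar> \<le> M" unfolding bounded_iff by auto
    have fM: "\<bar>f p\<bar> \<le> M" if "p \<in> C" for p using \<open>\<And>p. p \<in> C \<Longrightarrow> \<bar>f p\<bar> \<le> \<bar>g p\<bar>\<close>[OF that] M[OF that] by linarith
    show ?thesis
    proof (rule integrableI_bounded_set[OF Cb _ finC])
      show "f \<in> borel_measurable \<mu>" using that(1) by simp
      show "AE x in \<mu>. x \<in> C \<longrightarrow> norm (f x) \<le> M" using fM by (intro AE_I2) simp
      show "AE x in \<mu>. x \<notin> C \<longrightarrow> f x = 0" using that(4) by (intro AE_I2) simp
    qed
  qed
  have intI: "integrable \<mu> (I \<zeta>)" if z: "C1_fun A \<zeta>" for \<zeta>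
  proof (rule intC)
    have [measurable]: "\<zeta> \<in> borel_measurable borel" "radial_deriv a \<zeta> \<in> borel_measurable borel"
      using C1_fun_continuous[OF z] continuous_radial_deriv[OF z] by (auto intro: borel_measurable_continuous_onI)
    show "I \<zeta> \<in> borel_measurable borel" unfolding I_def[abs_def] by measurable
    show "continuous_on C (\<lambda>p. 2 * \<zeta> p + radial_deriv a \<zeta> p)"
      using C1_fun_continuous[OF z] continuous_radial_deriv[OF z] by (intro continuous_intros) (auto intro: continuous_on_subset)
    show "\<bar>I \<zeta> p\<bar> \<le> \<bar>2 * \<zeta> p + radial_deriv a \<zeta> p\<bar>" for p
      unfolding I_def using \<phi>[of p] mult_right_mono[of "\<phi> p" 1 "\<bar>2 * \<zeta> p + radial_deriv a \<zeta> p\<bar>"] by (simp add: abs_mult)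
    show "I \<zeta> p = 0" if "p \<notin> C" for p using \<phi>C[OF that] by (simp add: I_def)
  qed
  have intJ: "integrable \<mu> (J \<zeta>)" if z: "C1_fun A \<zeta>" for \<zeta>
  proof (rule intC)
    have [measurable]: "\<zeta> \<in> borel_measurable borel"
      using C1_fun_continuous[OF z] by (auto intro: borel_measurable_continuous_onI)
    show "J \<zeta> \<in> borel_measurable borel" unfolding J_def[abs_def] by measurable
    show "continuous_on C (\<lambda>p. \<Lambda> * norm (X p - a) * \<zeta> p)"
      using C1_fun_continuous[OF z] C1_fun_continuous[OF C1_X] by (intro continuous_intros) (auto intro: continuous_on_subset)
    show "\<bar>J \<zeta> p\<bar> \<le> \<bar>\<Lambda> * norm (X p - a) * \<zeta> p\<bar>" for p by (auto simp: J_def indicator_def)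
    show "J \<zeta> p = 0" if "p \<notin> C" for p using that EC by (auto simp: J_def indicator_def)
  qed
  \<comment> \<open>The induction runs over the bumps still to be used, for arbitrary \<zeta>. The
    remainder is required to vanish on an open \<open>G\<close> around \<open>C\<close> and not just
    on \<open>C\<close>, because its radial derivative must vanish there too.\<close>
  have main: "(LINT p|\<mu>. I \<zeta> p) \<le> (LINT p|\<mu>. J \<zeta> p)"
    if "\<forall>b\<in>set bs. chart_bump b" "C1_fun A \<zeta>" "\<And>p. 0 \<le> \<zeta> p" "open G" "C \<subseteq> G" "\<And>q. q \<in> G \<Longrightarrow> \<zeta> q * (\<Prod>b\<leftarrow>bs. 1 - b q) = 0" for bs \<zeta> G
    using that
  proof (induction bs arbitrary: \<zeta>)
    case Nil
    have "I \<zeta> p = 0" for p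
    proof (cases "p \<in> C")
      case True
      have "\<zeta> q = 0" if "q \<in> G" for q using Nil(6)[OF that] by simp
      from radial_deriv_zero[OF Nil(4) this] this[of p] True Nil(5) show ?thesis by (auto simp: I_def subset_iff)
    next
      case False
      then show ?thesis using \<phi>C by (simp add: I_def)
    qed
    moreover have "0 \<le> (LINT p|\<mu>. J \<zeta> p)" using \<Lambda> Nil(3) by (intro Bochner_Integration.integral_nonneg) (simp add: J_def)
    ultimately show ?case by simp
  next
    case (Cons b bs)
    have b: "chart_bump b" using Cons.prems(1) by simp
    then have bC: "C1_fun A b" and b01: "\<And>q. 0 \<le> b q" "\<And>q. b q \<le> 1" by (auto simp: chart_bump_def)
    obtain c K where cK: "c \<in> A" "compact K" "K \<subseteq> int_image c" "\<And>q. q \<notin> param c ` K \<Longrightarrow> b q = 0"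
      using b unfolding chart_bump_def by blast
    have z1: "C1_fun A (\<lambda>p. \<zeta> p * b p)" by (intro C1_fun_mult Cons.prems bC)
    have z2: "C1_fun A (\<lambda>p. \<zeta> p * (1 - b p))" by (intro C1_fun_mult C1_fun_diff C1_fun_const Cons.prems bC)
    have "(LINT p|\<mu>. I (\<lambda>p. \<zeta> p * b p) p) \<le> (LINT p|\<mu>. J (\<lambda>p. \<zeta> p * b p) p)"
      unfolding I_def J_def
      by (rule chart_inequality[OF m cK(1) z1 _ cK(2,3) _ \<phi> \<Lambda> lip E loc \<phi>m]) (use Cons.prems(3) b01 cK(4) in auto)
    moreover have "(LINT p|\<mu>. I (\<lambda>p. \<zeta> p * (1 - b p)) p) \<le> (LINT p|\<mu>. J (\<lambda>p. \<zeta> p * (1 - b p)) p)"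
    proof (rule Cons.IH[OF _ z2 _ Cons.prems(4,5)])
      show "\<forall>b\<in>set bs. chart_bump b" using Cons.prems(1) by simp
      show "0 \<le> \<zeta> p * (1 - b p)" for p using Cons.prems(3) b01 by simp
      show "\<zeta> q * (1 - b q) * (\<Prod>b\<leftarrow>bs. 1 - b q) = 0" if "q \<in> G" for q using Cons.prems(6)[OF that] by simp
    qed
    moreover have "(LINT p|\<mu>. I \<zeta> p) = (LINT p|\<mu>. I (\<lambda>p. \<zeta> p * b p) p) + (LINT p|\<mu>. I (\<lambda>p. \<zeta> p * (1 - b p)) p)"
    proof -
      have "I \<zeta> p = I (\<lambda>p. \<zeta> p * b p) p + I (\<lambda>p. \<zeta> p * (1 - b p)) p" for p
        unfolding I_def radial_deriv_add_one_minus[OF Cons.prems(2) bC, of a p] by (simp add: algebra_simps)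
      then show ?thesis by (simp add: Bochner_Integration.integral_add[OF intI[OF z1] intI[OF z2], symmetric])
    qed
    moreover have "(LINT p|\<mu>. J \<zeta> p) = (LINT p|\<mu>. J (\<lambda>p. \<zeta> p * b p) p) + (LINT p|\<mu>. J (\<lambda>p. \<zeta> p * (1 - b p)) p)"
    proof -
      have "J \<zeta> p = J (\<lambda>p. \<zeta> p * b p) p + J (\<lambda>p. \<zeta> p * (1 - b p)) p" for p
        unfolding J_def by (simp add: algebra_simps)
      then show ?thesis by (simp add: Bochner_Integration.integral_add[OF intJ[OF z1] intJ[OF z2], symmetric])
    qed
    ultimately show ?case by linarith
  qed
  have "\<exists>b G. chart_bump b \<and> open G \<and> p \<in> G \<and> (\<forall>q\<in>G. b q = 1)" if "p \<in> C" for p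
    using chart_bump_exists[of p] C(2) that by (metis disjoint_iff)
  then obtain bf Gf where bG: "\<And>p. p \<in> C \<Longrightarrow> chart_bump (bf p)" "\<And>p. p \<in> C \<Longrightarrow> open (Gf p)" "\<And>p. p \<in> C \<Longrightarrow> p \<in> Gf p"
     "\<And>p q. p \<in> C \<Longrightarrow> q \<in> Gf p \<Longrightarrow> bf p q = 1" by metis
  obtain D where D: "D \<subseteq> C" "finite D" "C \<subseteq> (\<Union>p\<in>D. Gf p)"
    using compactE_image[OF C(1), of C Gf] bG(2,3) by blast
  obtain ds where ds: "set ds = D" using finite_list[OF D(2)] by blast
  have "(LINT p|\<mu>. I (\<lambda>p. 1) p) \<le> (LINT p|\<mu>. J (\<lambda>p. 1) p)"
  proof (rule main[of "map bf ds" _ "\<Union>p\<in>D. Gf p"])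
    show "\<forall>b\<in>set (map bf ds). chart_bump b" using ds D bG by auto
    show "open (\<Union>p\<in>D. Gf p)" using bG(2) D(1) by blast
    show "1 * (\<Prod>b\<leftarrow>map bf ds. 1 - b q) = 0" if "q \<in> (\<Union>p\<in>D. Gf p)" for q
    proof -
      from that obtain p where "p \<in> D" "q \<in> Gf p" by blast
      then have "bf p q = 1" "p \<in> set ds" using bG(4) D(1) ds by auto
      then show ?thesis by (auto simp: prod_list_zero_iff image_iff intro!: bexI[of _ p])
    qed
  qed (use C1_fun_const D in auto)
  moreover have "radial_deriv a (\<lambda>p. 1) p = 0" for p using radial_deriv_zero[of UNIV "\<lambda>p. 1" 1 p a] by simp
  ultimately show ?thesis by (simp add: I_def J_def)
qed

end

section \<open>Monotonicity and infinite area\<close>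

context connected_surface
begin

definition ball_area :: "'a \<Rightarrow> real \<Rightarrow> real" where "ball_area p r = measure \<mu> {q. d p q < r}"

lemma d_lipschitz: "\<bar>d p x - d p y\<bar> \<le> d x y"
  using d_triangle[of p x y] d_triangle[of p y x] d_commute[of x y] by linarith

lemma d_ball_sets: "{q. d p q < r} \<in> sets \<mu>" "dball p r \<in> sets \<mu>"
  using open_d_ball closed_dball by (simp_all add: area_measure)

text \<open>The cutoff is 1 up to distance r - \<delta> and falls to 0 at \<open>r\<close> with
  slope 1/\<delta>, so it varies only on the shell \<open>E\<close>. There |X - X p| is at most
  \<open>r\<close>, since a chord is no longer than the distance, and the right-hand side turns into
  r/\<delta> times the area of the shell.\<close>

lemma ball_growth_closed:
  assumes m: "minimal A X" and fin: "emeasure \<mu> UNIV < \<infinity>" and K: "compact (dball p r)" "dball p r \<inter> bdry A = {}"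
    and \<delta>: "0 < \<delta>" "\<delta> < r"
  shows "2 * ball_area p (r - \<delta>) \<le> r / \<delta> * (measure \<mu> (dball p r) - ball_area p (r - \<delta>))"
proof -
  define \<phi> where "\<phi> q = max 0 (min 1 ((r - d p q) / \<delta>))" for q
  define E where "E = dball p r - {q. d p q < r - \<delta>}"
  interpret finite_measure \<mu> by (rule finite_area[OF fin])
  have E: "closed E" unfolding E_def using closed_dball open_d_ball by (intro closed_Diff)
  have \<phi>c: "continuous_on UNIV \<phi>" unfolding \<phi>_def[abs_def] using continuous_d by (intro continuous_intros) (use \<delta> in auto)
  have \<phi>m: "\<phi> \<in> borel_measurable borel" using \<phi>c by (rule borel_measurable_continuous_onI)
  have ineq: "(LINT q|\<mu>. \<phi> q * 2) \<le> (LINT q|\<mu>. (1 / \<delta>) * indicator E q * norm (X q - X p))"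
  proof (rule global_inequality[OF m fin K _ _ _ _ E _ \<phi>m])
    show "0 \<le> \<phi> q" "\<phi> q \<le> 1" for q by (auto simp: \<phi>_def)
    show "0 \<le> 1 / \<delta>" using \<delta> by simp
    show "\<bar>\<phi> x - \<phi> y\<bar> \<le> 1 / \<delta> * d x y" for x y
    proof -
      have "\<bar>\<phi> x - \<phi> y\<bar> \<le> \<bar>(r - d p x) / \<delta> - (r - d p y) / \<delta>\<bar>"
        unfolding \<phi>_def max_def min_def by auto
      also have "\<dots> = \<bar>d p x - d p y\<bar> / \<delta>" using \<delta> by (simp add: diff_divide_distrib[symmetric] abs_minus_commute)
      also have "\<dots> \<le> d x y / \<delta>" by (rule divide_right_mono[OF d_lipschitz]) (use \<delta> in simp)
      finally show ?thesis by simp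
    qed
    show "\<exists>U. open U \<and> x \<in> U \<and> (\<forall>q\<in>U. \<phi> q = \<phi> x)" if "x \<notin> E" for x
    proof (cases "d p x < r - \<delta>")
      case True
      have one: "\<phi> q = 1" if "d p q < r - \<delta>" for q using that \<delta> by (simp add: \<phi>_def min_def le_divide_eq)
      show ?thesis by (rule exI[of _ "{q. d p q < r - \<delta>}"]) (use open_d_ball True one in auto)
    next
      case False
      then have x: "r < d p x" using that by (auto simp: E_def dball_def)
      have zero: "\<phi> q = 0" if "r < d p q" for q
      proof -
        have "(r - d p q) / \<delta> \<le> 0" using that \<delta> by (simp add: divide_le_0_iff)
        then show ?thesis by (simp add: \<phi>_def)
      qed
      have "open (- dball p r)" by (rule open_Compl[OF closed_dball])
      then show ?thesis using x zero by (intro exI[of _ "- dball p r"]) (auto simp: dball_def)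
    qed
    show "\<phi> q = 0" if "q \<notin> dball p r" for q
    proof -
      have "(r - d p q) / \<delta> \<le> 0" using that \<delta> by (simp add: dball_def divide_le_0_iff)
      then show ?thesis by (simp add: \<phi>_def)
    qed
    show "E \<subseteq> dball p r" by (auto simp: E_def)
  qed
  have \<phi>int: "integrable \<mu> (\<lambda>q. \<phi> q * 2)"
  proof (rule integrable_const_bound[where B=2])
    show "AE q in \<mu>. norm (\<phi> q * 2) \<le> 2" by (intro AE_I2) (auto simp: \<phi>_def)
    show "(\<lambda>q. \<phi> q * 2) \<in> borel_measurable \<mu>" using \<phi>m by simp
  qed
  have "2 * ball_area p (r - \<delta>) = (LINT q|\<mu>. indicator {q. d p q < r - \<delta>} q * 2)"
    using d_ball_sets(1)[of p "r - \<delta>"] by (simp add: ball_area_def)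
  also have "\<dots> \<le> (LINT q|\<mu>. \<phi> q * 2)"
  proof (rule integral_mono[OF _ \<phi>int])
    show "integrable \<mu> (\<lambda>q. indicator {q. d p q < r - \<delta>} q * (2::real))"
      using d_ball_sets(1)[of p "r - \<delta>"] by (simp add: emeasure_eq_measure)
    show "indicator {q. d p q < r - \<delta>} q * 2 \<le> \<phi> q * 2" for q
      using \<delta> by (auto simp: \<phi>_def indicator_def le_divide_eq)
  qed
  also note ineq
  also have "(LINT q|\<mu>. (1 / \<delta>) * indicator E q * norm (X q - X p)) \<le> (LINT q|\<mu>. r / \<delta> * indicator E q)"
  proof (rule integral_mono')
    have Eb: "E \<in> sets \<mu>" using E by (simp add: area_measure)
    show "integrable \<mu> (\<lambda>q. r / \<delta> * indicator E q)" using Eb by (simp add: emeasure_eq_measure)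
    show "(1 / \<delta>) * indicator E q * norm (X q - X p) \<le> r / \<delta> * indicator E q" for q
    proof (cases "q \<in> E")
      case True
      then have "norm (X q - X p) \<le> r" using chord_le_d[of q p] by (auto simp: E_def dball_def)
      then show ?thesis using True \<delta> by (simp add: divide_right_mono)
    qed simp
    show "0 \<le> r / \<delta> * indicator E q" for q using \<delta> by simp
  qed
  also have "\<dots> = r / \<delta> * measure \<mu> E" using E by (simp add: area_measure)
  also have "measure \<mu> E = measure \<mu> (dball p r) - ball_area p (r - \<delta>)"
    unfolding E_def ball_area_def using d_ball_sets \<delta> by (intro finite_measure_Diff) (auto simp: dball_def)
  finally show ?thesis .
qed

text \<open>An estimate with a closed ball on one side and an open ball on the other cannot be
  iterated. It is therefore applied at radii t < r with the inner radius \<open>s\<close> held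
  fixed: the closed ball of radius \<open>t\<close> lies in the open ball of radius
  \<open>r\<close>, and then \<open>t\<close> tends to \<open>r\<close>.\<close>

lemma ball_growth_step:
  assumes m: "minimal A X" and fin: "emeasure \<mu> UNIV < \<infinity>" and K: "compact (dball p r)" "dball p r \<inter> bdry A = {}"
    and \<delta>: "0 < \<delta>" "\<delta> < r"
  shows "ball_area p (r - \<delta>) * (1 + 2 * \<delta> / r) \<le> ball_area p r"
proof -
  interpret finite_measure \<mu> by (rule finite_area[OF fin])
  define s where "s = r - \<delta>"
  have s: "0 < s" "s < r" using \<delta> by (auto simp: s_def)
  have le: "ball_area p s * (1 + 2 * (t - s) / t) \<le> ball_area p r" if t: "t \<in> {s<..<r}" for t
  proof -
    have sub: "dball p t \<subseteq> dball p r" using t by (auto simp: dball_def)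
    have ts: "0 < t - s" "t - s < t" "0 < t" using t s by auto
    have "2 * ball_area p (t - (t - s)) \<le> t / (t - s) * (measure \<mu> (dball p t) - ball_area p (t - (t - s)))"
      by (rule ball_growth_closed[OF m fin compact_dball_subset[OF K(1) sub] _ ts(1,2)]) (use sub K(2) in auto)
    then have "2 * ball_area p s * ((t - s) / t) \<le> (t / (t - s) * (measure \<mu> (dball p t) - ball_area p s)) * ((t - s) / t)"
      using ts by (intro mult_right_mono) auto
    also have "\<dots> = measure \<mu> (dball p t) - ball_area p s" using ts by simp
    also have "measure \<mu> (dball p t) \<le> ball_area p r"
      unfolding ball_area_def using d_ball_sets t by (intro finite_measure_mono) (auto simp: dball_def)
    finally show ?thesis by (simp add: algebra_simps)
  qed
  have "((\<lambda>t. ball_area p s * (1 + 2 * (t - s) / t)) \<longlongrightarrow> ball_area p s * (1 + 2 * (r - s) / r)) (at_left r)"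
    using s by (intro tendsto_intros) auto
  then have "ball_area p s * (1 + 2 * (r - s) / r) \<le> ball_area p r"
  proof (rule tendsto_upperbound)
    show "\<forall>\<^sub>F t in at_left r. ball_area p s * (1 + 2 * (t - s) / t) \<le> ball_area p r"
      using eventually_at_left_real[OF s(2)] by eventually_elim (rule le)
  qed simp
  then show ?thesis by (simp add: s_def)
qed

text \<open>Each step multiplies \<open>(r + \<delta>) (r + 2 \<delta>)\<close> by exactly the growth factor of \<open>ball_growth_step\<close>; then \<open>\<delta>\<close> tends to 0.\<close>

lemma area_monotonicity:
  assumes m: "minimal A X" and fin: "emeasure \<mu> UNIV < \<infinity>" and K: "compact (dball p R)" "dball p R \<inter> bdry A = {}"
    and \<epsilon>: "0 < \<epsilon>" "\<epsilon> < R"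
  shows "ball_area p \<epsilon> * R\<^sup>2 \<le> ball_area p R * \<epsilon>\<^sup>2"
proof -
  \<comment> \<open>The interval from \<epsilon> to \<open>R\<close> is cut into \<open>n\<close>
    steps of length \<delta>; the product (r + \<delta>) (r + 2 \<delta>) is a discrete substitute
    for r^2.\<close>
  have fin_n: "ball_area p \<epsilon> * ((R + \<delta>) * (R + 2 * \<delta>)) \<le> ball_area p R * ((\<epsilon> + \<delta>) * (\<epsilon> + 2 * \<delta>))" if n: "0 < n" and \<delta>d: "\<delta> = (R - \<epsilon>) / real n" for n \<delta>
  proof -
    have \<delta>: "0 < \<delta>" using n \<epsilon> by (simp add: \<delta>d)
    have "ball_area p \<epsilon> * ((\<epsilon> + k * \<delta> + \<delta>) * (\<epsilon> + k * \<delta> + 2 * \<delta>)) \<le> ball_area p (\<epsilon> + k * \<delta>) * ((\<epsilon> + \<delta>) * (\<epsilon> + 2 * \<delta>))" if "k \<le> n" for k :: nat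
      using that
    proof (induction k)
      case (Suc k)
      define r where "r = \<epsilon> + real (Suc k) * \<delta>"
      have rk: "\<epsilon> + real k * \<delta> = r - \<delta>" by (simp add: r_def algebra_simps)
      have r: "0 < r" "\<delta> < r" using \<epsilon> \<delta> by (auto simp: r_def algebra_simps intro!: add_pos_nonneg)
      have "real (Suc k) * \<delta> \<le> real n * \<delta>" using Suc.prems \<delta> by (intro mult_right_mono) auto
      then have "r \<le> R" using n by (simp add: r_def \<delta>d)
      then have sub: "dball p r \<subseteq> dball p R" by (auto simp: dball_def)
      have IH: "ball_area p \<epsilon> * (r * (r + \<delta>)) \<le> ball_area p (r - \<delta>) * ((\<epsilon> + \<delta>) * (\<epsilon> + 2 * \<delta>))"
        using Suc unfolding rk by (simp add: add.commute)
      have step: "ball_area p (r - \<delta>) * (1 + 2 * \<delta> / r) \<le> ball_area p r"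
        by (rule ball_growth_step[OF m fin compact_dball_subset[OF K(1) sub] _ \<delta> r(2)]) (use sub K(2) in auto)
      have "ball_area p \<epsilon> * ((r + \<delta>) * (r + 2 * \<delta>)) = ball_area p \<epsilon> * (r * (r + \<delta>)) * (1 + 2 * \<delta> / r)"
        using r by (simp add: field_simps)
      also have "\<dots> \<le> ball_area p (r - \<delta>) * ((\<epsilon> + \<delta>) * (\<epsilon> + 2 * \<delta>)) * (1 + 2 * \<delta> / r)"
        by (rule mult_right_mono[OF IH]) (use r \<delta> in simp)
      also have "\<dots> = ball_area p (r - \<delta>) * (1 + 2 * \<delta> / r) * ((\<epsilon> + \<delta>) * (\<epsilon> + 2 * \<delta>))" by simp
      also have "\<dots> \<le> ball_area p r * ((\<epsilon> + \<delta>) * (\<epsilon> + 2 * \<delta>))"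
        by (rule mult_right_mono[OF step]) (use \<epsilon> \<delta> in simp)
      finally show ?case by (simp only: r_def)
    qed simp
    from this[of n] show ?thesis using n by (simp add: \<delta>d)
  qed
  have lim: "(\<lambda>n. (R - \<epsilon>) / real n) \<longlonglongrightarrow> 0" by (rule lim_const_over_n)
  have 1: "(\<lambda>n. ball_area p \<epsilon> * ((R + (R - \<epsilon>) / real n) * (R + 2 * ((R - \<epsilon>) / real n)))) \<longlonglongrightarrow> ball_area p \<epsilon> * ((R + 0) * (R + 2 * 0))"
    by (intro tendsto_intros lim)
  have 2: "(\<lambda>n. ball_area p R * ((\<epsilon> + (R - \<epsilon>) / real n) * (\<epsilon> + 2 * ((R - \<epsilon>) / real n)))) \<longlonglongrightarrow> ball_area p R * ((\<epsilon> + 0) * (\<epsilon> + 2 * 0))"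
    by (intro tendsto_intros lim)
  have "ball_area p \<epsilon> * ((R + 0) * (R + 2 * 0)) \<le> ball_area p R * ((\<epsilon> + 0) * (\<epsilon> + 2 * 0))"
    by (rule LIMSEQ_le[OF 1 2]) (use fin_n in \<open>auto intro!: exI[of _ 1]\<close>)
  then show ?thesis by (simp add: power2_eq_square)
qed

section \<open>A lower area bound for small balls\<close>

lemma parallelogram_area:
  fixes w1 w2 x0 :: "real \<times> real"
  assumes k: "0 \<le> k" and D: "fst w1 * snd w2 - snd w1 * fst w2 = D" "D > 0"
  defines "S \<equiv> (\<lambda>z. x0 + fst z *\<^sub>R w1 + snd z *\<^sub>R w2) ` cbox (-k, -k) (k, k)"
  shows "emeasure lborel S = ennreal (4 * k\<^sup>2 * D)" "compact S"
proof -
  let ?g = "\<lambda>z::real \<times> real. x0 + fst z *\<^sub>R w1 + snd z *\<^sub>R w2"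
  have der: "(?g has_derivative (\<lambda>h. fst h *\<^sub>R w1 + snd h *\<^sub>R w2)) (at z within T)" for z T
    by (auto intro!: derivative_eq_intros)
  show cS: "compact S" unfolding S_def by (intro compact_continuous_image compact_cbox continuous_intros)
  have inj: "inj ?g"
  proof (rule injI)
    fix y z :: "real \<times> real" assume "?g y = ?g z"
    then have e: "(fst y - fst z) *\<^sub>R w1 + (snd y - snd z) *\<^sub>R w2 = 0" by (simp add: algebra_simps)
    define a b where "a = fst y - fst z" "b = snd y - snd z"
    have 1: "a * fst w1 + b * fst w2 = 0" and 2: "a * snd w1 + b * snd w2 = 0"
      using arg_cong[OF e, of fst] arg_cong[OF e, of snd] by (simp_all add: a_b_def)
    have aD: "a * D = snd w2 * (a * fst w1 + b * fst w2) - fst w2 * (a * snd w1 + b * snd w2)"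
      and bD: "b * D = fst w1 * (a * snd w1 + b * snd w2) - snd w1 * (a * fst w1 + b * fst w2)"
      unfolding D(1)[symmetric] by algebra+
    have "a * D = 0" "b * D = 0" unfolding aD bD 1 2 by simp_all
    then have "a = 0" "b = 0" using D(2) by simp_all
    then show "y = z" by (simp add: a_b_def prod_eq_iff)
  qed
  have det: "det2 (\<lambda>h. fst h *\<^sub>R w1 + snd h *\<^sub>R w2) = D" using D by (simp add: det2_def)
  have "emeasure lborel S = (\<integral>\<^sup>+z. ennreal \<bar>D\<bar> * indicator (cbox (-k, -k) (k, k)) z \<partial>lborel)"
    unfolding S_def
  proof (subst emeasure_differentiable_image[OF _ _ der])
    show "?g ` cbox (- k, - k) (k, k) \<in> sets borel" using borel_compact[OF cS] unfolding S_def .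
    show "inj_on ?g (cbox (- k, - k) (k, k))" using inj inj_on_subset by blast
  qed (auto simp: det)
  also have "\<dots> = ennreal D * emeasure lborel (cbox (-k, -k) (k, k))"
    using D by (subst nn_integral_cmult_indicator) auto
  also have "emeasure lborel (cbox (-k, -k) (k, k :: real)) = ennreal ((2 * k) * (2 * k))"
    using k by (subst emeasure_lborel_cbox) (auto simp: Basis_prod_def prod.insert)
  also have "ennreal D * ennreal ((2 * k) * (2 * k)) = ennreal (4 * k\<^sup>2 * D)"
    using D k by (simp add: power2_eq_square algebra_simps flip: ennreal_mult)
  finally show "emeasure lborel S = ennreal (4 * k\<^sup>2 * D)" .
qed

text \<open>Gram-Schmidt on the coordinate vectors: the differential takes \<open>w1\<close> and
  \<open>w2\<close> to an orthonormal pair, so the coordinate parallelogram they span has as its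
  area the reciprocal of the area density.\<close>

lemma orthonormalizing_vectors:
  assumes c: "c \<in> A" and x: "x \<in> chart_image c"
  obtains w1 w2 where "fst w1 * snd w2 - snd w1 * fst w2 = 1 / norm (nrm c x)"
    "\<And>\<alpha> \<beta>. norm (dX c x (\<alpha> *\<^sub>R w1 + \<beta> *\<^sub>R w2)) \<le> \<bar>\<alpha>\<bar> + \<bar>\<beta>\<bar>"
proof -
  let ?a = "Xu c x" and ?b = "Xv c x"
  have n0: "nrm c x \<noteq> 0" by (rule nrm_nonzero[OF c x])
  then have a0: "?a \<noteq> 0" by (auto simp: nrm_def)
  define \<kappa> where "\<kappa> = (?a \<bullet> ?b) / (?a \<bullet> ?a)"
  define e where "e = ?b - \<kappa> *\<^sub>R ?a"
  have ae: "?a \<bullet> e = 0" using a0 by (simp add: e_def \<kappa>_def inner_diff_right)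
  have "cross3 ?a e = nrm c x" by (simp add: e_def nrm_def Cross3.right_diff_distrib cross_mult_right)
  then have ne: "norm ?a * norm e = norm (nrm c x)"
    using norm_cross_dot[of ?a e] ae by (metis add.right_neutral norm_ge_zero mult_nonneg_nonneg power2_eq_imp_eq power_zero_numeral)
  then have e0: "norm e \<noteq> 0" "norm ?a \<noteq> 0" using n0 by auto
  define w1 w2 where "w1 = (1 / norm ?a, 0 :: real)" "w2 = (- \<kappa> / norm e, 1 / norm e)"
  have "dX c x w1 = (1 / norm ?a) *\<^sub>R ?a" "dX c x w2 = (1 / norm e) *\<^sub>R e"
    by (simp_all add: dX_def w1_w2_def e_def scaleR_diff_right)
  then have n1: "norm (dX c x w1) = 1" "norm (dX c x w2) = 1" using e0 by auto
  show thesis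
  proof (rule that)
    show "fst w1 * snd w2 - snd w1 * fst w2 = 1 / norm (nrm c x)" using ne by (simp add: w1_w2_def)
    fix \<alpha> \<beta> :: real
    have "dX c x (\<alpha> *\<^sub>R w1 + \<beta> *\<^sub>R w2) = \<alpha> *\<^sub>R dX c x w1 + \<beta> *\<^sub>R dX c x w2"
      by (simp add: linear_add[OF linear_dX] linear_scale[OF linear_dX])
    also have "norm \<dots> \<le> \<bar>\<alpha>\<bar> + \<bar>\<beta>\<bar>" using norm_triangle_ineq[of "\<alpha> *\<^sub>R dX c x w1" "\<beta> *\<^sub>R dX c x w2"] n1 by simp
    finally show "norm (dX c x (\<alpha> *\<^sub>R w1 + \<beta> *\<^sub>R w2)) \<le> \<bar>\<alpha>\<bar> + \<bar>\<beta>\<bar>" .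
  qed
qed

text \<open>The test set is a coordinate parallelogram around \<open>p\<close> whose image is nearly
  a square of side \<epsilon>/4. It lies in the ball of radius \<epsilon>, and its area is at least
  half of (\<epsilon>/4)^2, the half paying for the variation of the area density. This is the
  constant 1/32.\<close>

lemma area_density_at_point:
  assumes fin: "emeasure \<mu> UNIV < \<infinity>" and p: "p \<notin> bdry A" and \<eta>: "0 < \<eta>"
  shows "\<exists>\<epsilon>. 0 < \<epsilon> \<and> \<epsilon> < \<eta> \<and> \<epsilon>\<^sup>2 / 32 \<le> ball_area p \<epsilon>"
proof -
  let ?c = "chart_at A p" and ?x = "snd (chart_at A p) p"
  have c: "?c \<in> A" and pc: "p \<in> fst ?c" by (rule chart_at)+
  have xc: "?x \<in> chart_image ?c" by (rule coord_in[OF c pc])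
  have xi: "?x \<in> int_image ?c" by (rule interior_coord[OF p c pc])
  define g where "g = norm (nrm ?c ?x)"
  have g: "g > 0" using nrm_nonzero[OF c xc] by (simp add: g_def)
  obtain w1 w2 where w: "fst w1 * snd w2 - snd w1 * fst w2 = 1 / g"
    "\<And>\<alpha> \<beta>. norm (dX ?c ?x (\<alpha> *\<^sub>R w1 + \<beta> *\<^sub>R w2)) \<le> \<bar>\<alpha>\<bar> + \<bar>\<beta>\<bar>"
    using orthonormalizing_vectors[OF c xc] unfolding g_def by blast
  obtain m where mm: "m > 0" "\<And>h. m * norm h \<le> norm (dX ?c ?x h)" using dX_bounded_below[OF c xc] by blast
  obtain r1 where r1: "r1 > 0" "cball ?x r1 \<inter> half_plane \<subseteq> chart_image ?c"
    "\<And>y h. y \<in> cball ?x r1 \<inter> half_plane \<Longrightarrow> norm (dX ?c y h - dX ?c ?x h) \<le> m * norm h"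
    using chart_nbhd[OF c xc mm(1)] by blast
  obtain r2 where r2: "r2 > 0" "\<And>y. y \<in> chart_image ?c \<Longrightarrow> dist y ?x < r2 \<Longrightarrow> dist (nrm ?c y) (nrm ?c ?x) < g / 2"
    using nrm_continuous[OF c] xc half_gt_zero[OF g] unfolding continuous_on_iff by meson
  obtain r3 where r3: "r3 > 0" "cball ?x r3 \<subseteq> int_image ?c" using open_int_image[OF c] xi open_contains_cball by blast
  \<comment> \<open>\<open>r1\<close> controls the differential up to a factor 2, \<open>r2\<close>
    the area density up to a factor 2, and \<open>r3\<close> keeps the disc away from the
    edge.\<close>
  define r where "r = min r1 (min (r2 / 2) r3)"
  have r: "r > 0" "r \<le> r1" "r < r2" "r \<le> r3" using r1 r2 r3 by (auto simp: r_def)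
  have rc: "cball ?x r \<subseteq> chart_image ?c" using r3 r(4) by (auto simp: int_image_def subset_iff)
  \<comment> \<open>The bound by \<open>m * r\<close> makes the parallelogram fit into the disc of
    radius \<open>r\<close>; the half makes the bound by \<eta> strict.\<close>
  define \<epsilon> where "\<epsilon> = min (\<eta> / 2) (m * r)"
  have \<epsilon>: "0 < \<epsilon>" "\<epsilon> < \<eta>" "\<epsilon> \<le> m * r" using \<eta> mm r by (auto simp: \<epsilon>_def min_def)
  define k where "k = \<epsilon> / 8"
  have k: "0 \<le> k" using \<epsilon> by (simp add: k_def)
  define S where "S = (\<lambda>z. ?x + fst z *\<^sub>R w1 + snd z *\<^sub>R w2) ` cbox (-k, -k) (k, k)"
  note S = parallelogram_area[OF k w(1), of ?x, folded S_def]
  have near: "norm (dX ?c ?x (y - ?x)) \<le> \<epsilon> / 4" "y \<in> cball ?x r" if "y \<in> S" for y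
  proof -
    from that obtain z where z: "z \<in> cbox (-k, -k) (k, k)" "y = ?x + fst z *\<^sub>R w1 + snd z *\<^sub>R w2" unfolding S_def by blast
    have "\<bar>fst z\<bar> \<le> k" "\<bar>snd z\<bar> \<le> k" using z(1) by (auto simp: mem_box Basis_prod_def inner_prod_def)
    then show n: "norm (dX ?c ?x (y - ?x)) \<le> \<epsilon> / 4" using w(2)[of "fst z" "snd z"] z(2) by (simp add: k_def algebra_simps)
    have "m * norm (y - ?x) \<le> m * r" using mm(2)[of "y - ?x"] n \<epsilon> by linarith
    then show "y \<in> cball ?x r" using mm(1) by (simp add: dist_norm norm_minus_commute)
  qed
  have Sc: "S \<subseteq> chart_image ?c" using near(2) rc by blast
  have sub: "param ?c ` S \<subseteq> {q. d p q < \<epsilon>}"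
  proof (rule image_subsetI)
    fix y assume y: "y \<in> S"
    have "d (param ?c ?x) (param ?c y) \<le> \<epsilon> / 2"
    proof (rule d_segment[OF c convex_cball rc _ near(2)[OF y]])
      show "?x \<in> cball ?x r" using r by simp
      fix z assume "z \<in> cball ?x r"
      then have z: "z \<in> cball ?x r1 \<inter> half_plane" using rc chart_facts(4)[OF c] r(2) by auto
      have "norm (dX ?c z (y - ?x)) \<le> norm (dX ?c ?x (y - ?x)) + norm (dX ?c z (y - ?x) - dX ?c ?x (y - ?x))"
        by (metis norm_triangle_sub)
      also have "\<dots> \<le> norm (dX ?c ?x (y - ?x)) + norm (dX ?c ?x (y - ?x))"
        using r1(3)[OF z, of "y - ?x"] mm(2)[of "y - ?x"] by simp
      also have "\<dots> \<le> \<epsilon> / 2" using near(1)[OF y] by simp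
      finally show "norm (dX ?c z (y - ?x)) \<le> \<epsilon> / 2" .
    qed
    then show "param ?c y \<in> {q. d p q < \<epsilon>}" using \<epsilon> c pc by simp
  qed
  have "compact (param ?c ` S)"
    by (rule compact_continuous_image[OF continuous_on_subset[OF homeomorphism_cont2[OF chart_facts(3)[OF c]] Sc] S(2)]) (use g in simp)
  then have PS: "param ?c ` S \<in> sets borel" by (intro borel_closed compact_imp_closed)
  have PSf: "param ?c ` S \<subseteq> fst ?c" using Sc param_in[OF c] by blast
  have SS: "snd ?c ` (param ?c ` S) = S"
  proof -
    have "snd ?c (param ?c y) = y" if "y \<in> S" for y using that Sc c by auto
    then show ?thesis by (simp add: image_image)
  qed
  have Sb: "S \<in> sets borel" by (rule borel_compact[OF S(2)]) (use g in simp)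
  note w_measurable[OF c, measurable]
  have "ennreal (g / 2) * emeasure lborel S = (\<integral>\<^sup>+y. ennreal (g / 2) * indicator S y \<partial>lborel)"
    using Sb by (subst nn_integral_cmult_indicator) auto
  also have "\<dots> \<le> (\<integral>\<^sup>+y. ennreal (w ?c y) * indicator S y \<partial>lborel)"
  proof (intro nn_integral_mono)
    fix y
    show "ennreal (g / 2) * indicator S y \<le> ennreal (w ?c y) * indicator S y"
    proof (cases "y \<in> S")
      case True
      then have y: "y \<in> chart_image ?c" "dist y ?x < r2" using Sc near(2)[OF True] r(3) by (auto simp: dist_commute)
      have "norm (nrm ?c y - nrm ?c ?x) < g / 2" using r2(2)[OF y] by (simp add: dist_norm)
      then have "g / 2 \<le> norm (nrm ?c y)" using norm_triangle_sub[of "nrm ?c ?x" "nrm ?c y"] by (simp add: g_def norm_minus_commute)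
      then show ?thesis using True y by (simp add: w_def)
    qed simp
  qed
  also have "\<dots> = \<kappa> ?c (param ?c ` S)" unfolding \<kappa>_def SS using Sb by (subst emeasure_density) auto
  also have "\<dots> = emeasure \<mu> (param ?c ` S)" by (rule area_measure(2)[OF c PS PSf, symmetric])
  also have "\<dots> \<le> emeasure \<mu> {q. d p q < \<epsilon>}" by (rule emeasure_mono[OF sub d_ball_sets(1)])
  also have "\<dots> = ennreal (ball_area p \<epsilon>)"
  proof -
    show ?thesis unfolding ball_area_def by (rule finite_measure.emeasure_eq_measure[OF finite_area[OF fin]])
  qed
  finally have "ennreal (g / 2) * ennreal (4 * k\<^sup>2 * (1 / g)) \<le> ennreal (ball_area p \<epsilon>)" using S(1) g by simp
  then have "ennreal (g / 2 * (4 * k\<^sup>2 * (1 / g))) \<le> ennreal (ball_area p \<epsilon>)" using g by (subst ennreal_mult) auto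
  then have "g / 2 * (4 * k\<^sup>2 * (1 / g)) \<le> ball_area p \<epsilon>" by (subst (asm) ennreal_le_iff) (simp add: ball_area_def)
  moreover have "g / 2 * (4 * k\<^sup>2 * (1 / g)) = \<epsilon>\<^sup>2 / 32" using g by (simp add: k_def power2_eq_square)
  ultimately show ?thesis using \<epsilon> by (intro exI[of _ \<epsilon>]) simp
qed

theorem infinite_area:
  assumes m: "minimal A X" and comp: "complete_surface X" and nc: "\<not> compact (UNIV :: 'a set)" and B: "compact (bdry A)"
  shows "emeasure \<mu> UNIV = \<infinity>"
proof (rule ccontr)
  assume "emeasure \<mu> UNIV \<noteq> \<infinity>"
  then have fin: "emeasure \<mu> UNIV < \<infinity>" by (simp add: less_top)
  interpret finite_measure \<mu> by (rule finite_area[OF fin])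
  define T where "T = measure \<mu> UNIV"
  \<comment> \<open>Monotonicity will give R^2 / 32 <= T once \<epsilon>^2 is cancelled. Since R >=
    1, this would imply R <= 32 T, against the choice of \<open>R\<close>.\<close>
  define R where "R = 32 * T + 1"
  have R: "R \<ge> 1" by (simp add: R_def T_def)
  obtain p where p: "\<And>q. q \<in> bdry A \<Longrightarrow> R < d p q" using far_point[OF comp nc B] by blast
  have off: "dball p R \<inter> bdry A = {}" using p by (force simp: dball_def)
  have "p \<notin> bdry A" using p[of p] R by auto
  then obtain \<epsilon> where \<epsilon>: "0 < \<epsilon>" "\<epsilon> < R" "\<epsilon>\<^sup>2 / 32 \<le> ball_area p \<epsilon>" using area_density_at_point[OF fin, of p R] R by auto
  have "\<epsilon>\<^sup>2 / 32 * R\<^sup>2 \<le> ball_area p \<epsilon> * R\<^sup>2" using \<epsilon>(3) by (rule mult_right_mono) simp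
  also have "\<dots> \<le> ball_area p R * \<epsilon>\<^sup>2" by (rule area_monotonicity[OF m fin compact_dball[OF comp] off \<epsilon>(1,2)])
  also have "\<dots> \<le> T * \<epsilon>\<^sup>2"
    unfolding ball_area_def T_def using d_ball_sets by (intro mult_right_mono finite_measure_mono) (auto simp: area_measure)
  finally have "(R\<^sup>2 / 32) * \<epsilon>\<^sup>2 \<le> T * \<epsilon>\<^sup>2" by (simp add: mult.commute)
  then have "R\<^sup>2 / 32 \<le> T" using \<epsilon>(1) by (simp add: mult_le_cancel_right)
  moreover have "R \<le> R\<^sup>2" using R by (simp add: power2_eq_square)
  ultimately show False by (simp add: R_def)
qed

end

text \<open>The minimum over the compact unit sphere is attained. If it were 0, both vectors would
  be multiples of one unit vector, and then \<open>w\<close> would be a multiple of the nonzero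
  \<open>v\<close>.\<close>

lemma cross3_independent_bound:
  fixes v w :: "real^3"
  assumes v: "v \<noteq> 0" and w: "w \<notin> span {v}"
  obtains k where "k > 0" "\<And>n. n \<bullet> n = 1 \<Longrightarrow> k \<le> (norm (cross3 n v))\<^sup>2 + (norm (cross3 n w))\<^sup>2"
proof -
  let ?f = "\<lambda>n. (norm (cross3 n v))\<^sup>2 + (norm (cross3 n w))\<^sup>2"
  have "\<exists>x\<in>sphere (0::real^3) 1. \<forall>y\<in>sphere 0 1. ?f x \<le> ?f y"
  proof (rule continuous_attains_inf)
    show "sphere (0::real^3) 1 \<noteq> {}" by simp
    show "continuous_on (sphere 0 1) ?f" by (intro continuous_intros continuous_on_cross)
  qed simp
  then obtain n0 where n0: "n0 \<in> sphere 0 1" "\<And>n. n \<in> sphere 0 1 \<Longrightarrow> ?f n0 \<le> ?f n" by blast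
  have nn: "n0 \<bullet> n0 = 1" using n0(1) by (simp add: dot_square_norm)
  have "?f n0 \<noteq> 0"
  proof
    assume "?f n0 = 0"
    then have z: "cross3 n0 v = 0" "cross3 n0 w = 0" by (simp_all add: add_nonneg_eq_0_iff)
    have "u = (n0 \<bullet> u) *\<^sub>R n0" if "cross3 n0 u = 0" for u
      using Lagrange[of n0 n0 u] that nn by simp
    then have e: "v = (n0 \<bullet> v) *\<^sub>R n0" "w = (n0 \<bullet> w) *\<^sub>R n0" using z by blast+
    then have "n0 \<bullet> v \<noteq> 0" using v by auto
    then have "n0 = (1 / (n0 \<bullet> v)) *\<^sub>R v" by (subst e(1)) simp
    then have "w = ((n0 \<bullet> w) / (n0 \<bullet> v)) *\<^sub>R v" using e(2) by (metis scaleR_scaleR times_divide_eq_right mult.right_neutral)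
    then show False using w by (metis span_base span_scale singletonI)
  qed
  moreover have "0 \<le> ?f n0" by simp
  ultimately have "?f n0 > 0" by linarith
  then show thesis using that[of "?f n0"] n0(2) by (simp add: norm_eq_1)
qed

theorem proposition6p3:
  fixes \<Omega> :: "(real^3) set"
    and A :: "'a::{t2_space, second_countable_topology} chart set"
    and X :: "'a \<Rightarrow> real^3"
  assumes "smooth_domain \<Omega>" and "\<not> bounded \<Omega>"
    and "smooth_atlas A" and "oriented_atlas A"
    and "connected (UNIV :: 'a set)" and "\<not> compact (UNIV :: 'a set)"
    and "bdry A \<noteq> {}" and "compact (bdry A)"
    and "immersion A X" and "complete_surface X"
    and "minimal A X" and "free_boundary \<Omega> A X"
    and "morse_index \<Omega> A X < \<infinity>"
    and "\<not> totally_geodesic A X"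
  shows "dim (L_star A X \<inter> L2_harmonic_tangential A X) \<le> 1"
proof -
  interpret connected_surface A X using assms by unfold_locales
  let ?S = "L_star A X \<inter> L2_harmonic_tangential A X"
  have parallel: "w \<in> span {v}" if v: "v \<noteq> 0" and L2: "(\<lambda>p. cross3 (N p) v) \<in> L2_harmonic_tangential A X" "(\<lambda>p. cross3 (N p) w) \<in> L2_harmonic_tangential A X" for v w
  proof (rule ccontr)
    assume "w \<notin> span {v}"
    from cross3_independent_bound[OF v this] obtain k where k: "k > 0" "\<And>n. n \<bullet> n = 1 \<Longrightarrow> k \<le> (norm (cross3 n v))\<^sup>2 + (norm (cross3 n w))\<^sup>2" by blast
    have fin: "(\<integral>\<^sup>+p. ennreal ((norm (cross3 (N p) v))\<^sup>2) \<partial>\<mu>) < \<infinity>" "(\<integral>\<^sup>+p. ennreal ((norm (cross3 (N p) w))\<^sup>2) \<partial>\<mu>) < \<infinity>"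
      using L2 by (simp_all add: L2_harmonic_tangential_def)
    have cm: "(\<lambda>p. ennreal ((norm (cross3 (N p) u))\<^sup>2)) \<in> borel_measurable \<mu>" for u
    proof -
      have "continuous_on UNIV (\<lambda>p. (norm (cross3 (N p) u))\<^sup>2)"
        by (intro continuous_intros continuous_on_cross C1_fun_continuous[OF C1_N])
      then have "(\<lambda>p. (norm (cross3 (N p) u))\<^sup>2) \<in> borel_measurable borel" by (rule borel_measurable_continuous_onI)
      then show ?thesis by simp
    qed
    have "ennreal k * emeasure \<mu> UNIV = (\<integral>\<^sup>+p. ennreal k \<partial>\<mu>)"
      using sets_eq_imp_space_eq[OF area_measure(1)] by simp
    also have "\<dots> \<le> (\<integral>\<^sup>+p. ennreal ((norm (cross3 (N p) v))\<^sup>2) + ennreal ((norm (cross3 (N p) w))\<^sup>2) \<partial>\<mu>)"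
    proof (intro nn_integral_mono)
      fix p
      have "ennreal k \<le> ennreal ((norm (cross3 (N p) v))\<^sup>2 + (norm (cross3 (N p) w))\<^sup>2)" by (intro ennreal_leI k(2) norm_N)
      then show "ennreal k \<le> ennreal ((norm (cross3 (N p) v))\<^sup>2) + ennreal ((norm (cross3 (N p) w))\<^sup>2)" by simp
    qed
    also have "\<dots> = (\<integral>\<^sup>+p. ennreal ((norm (cross3 (N p) v))\<^sup>2) \<partial>\<mu>) + (\<integral>\<^sup>+p. ennreal ((norm (cross3 (N p) w))\<^sup>2) \<partial>\<mu>)"
      by (rule nn_integral_add[OF cm cm])
    also have "\<dots> < \<infinity>" using fin by simp
    finally show False using infinite_area[OF assms(11,10,6,8)] k(1) by (simp add: ennreal_mult_top)
  qed
  show ?thesis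
  \<comment> \<open>The dimension is bounded by the size of a finite spanning set: the empty set if
    only the zero field occurs, and otherwise any single nonzero element.\<close>
  proof (cases "?S \<subseteq> {0}")
    case True
    then have "?S \<subseteq> span {}" by simp
    from dim_le_card[OF this] show ?thesis by simp
  next
    case False
    then obtain \<xi> where \<xi>: "\<xi> \<in> ?S" "\<xi> \<noteq> 0" by blast
    then obtain v where v: "\<xi> = (\<lambda>p. cross3 (N p) v)" unfolding L_star_eq by blast
    have v0: "v \<noteq> 0" using \<xi>(2) by (auto simp: v zero_fun_def)
    have "?S \<subseteq> span {\<xi>}"
    proof
      fix \<zeta> assume z: "\<zeta> \<in> ?S"
      then obtain w where w: "\<zeta> = (\<lambda>p. cross3 (N p) w)" unfolding L_star_eq by blast
      have "w \<in> span {v}" using parallel[OF v0] \<xi>(1) z unfolding v w by blast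
      then obtain k where "w = k *\<^sub>R v" by (auto simp: span_singleton)
      then have "\<zeta> = k *\<^sub>R \<xi>" by (simp add: w v cross_mult_right scaleR_fun_def)
      then show "\<zeta> \<in> span {\<xi>}" by (simp add: span_base span_scale)
    qed
    from dim_le_card[OF this] show ?thesis by simp
  qed
qed

end
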